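(* Let $n\ge 1$, let $D\subset\mathbb{R}^l$ be a nonempty compact set, let $b=(1,0,\dots,0)'\in\mathbb{R}^n$, and let $A=(a_{i,j})\in\mathbb{R}^{n\times n}$ with $a_{i,j}=1$ if $j=i-1$, $i=2,\dots,n$, and $a_{i,j}=0$ otherwise. Let $f:D\times\mathbb{R}^n\times\mathbb{R}\to\mathbb{R}^n$ and $g:D\times\mathbb{R}^n\times\mathbb{R}\to\mathbb{R}$ be locally Lipschitz mappings with $f(d,0,0)=0$ and $g(d,0,0)=0$ for all $d\in D$. Assume that there exist a constant $r>0$ and a locally bounded function $k:\mathbb{R}^n\to\mathbb{R}$ with $k(0)=0$, continuous at $0\in\mathbb{R}^n$, such that $0\in\mathbb{R}^n$ is robustly globally asymptotically stable (RGAS) for the sampled-data system $$\dot x(t)=Ax(t)+bu(t)+f(d(t),x(t),u(t)),\qquad u(t)=k(x(\tau_i)),\ t\in[\tau_i,\tau_{i+1}),$$ $$\tau_0=0,\quad \tau_{i+1}=\tau_i+r\exp(-w(\tau_i)),\qquad d(t)\in D,\ w(t)\in[0,+\infty).$$ Let $P\in\mathbb{R}^{n\times n}$ be a symmetric positive definite matrix and $p\in\mathbb{R}^n$ a vector such that the matrix $P(A+bp')+(A'+pb')P$ is negative definite. Define $c=-(A'+pb')^{-1}(0,\dots,0,1)'\in\mathbb{R}^n$, and assume that there exist constants $M,R,K,\omega,\delta>0$ such that the following three conditions hold: $$\max\{x'P(Ax+f(d,x,u)+bu):\ (d,x)\in D\times\mathbb{R}^n,\ u\in\mathbb{R},\ x'Px=R^2,\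 |u-p'x|\le K|c'b|\}<0,$$ $$\max\{|g(d,x,u)+c'f(d,x,u)|:\ x\in\mathbb{R}^n,\ x'Px\le R^2,\ d\in D,\ u\in\mathbb{R},\ |u-p'x|\le K|c'b|\}<K(c'b)^2,$$ and $$z\big(Mg(d,x,u)+Mc'f(d,x,u)-K(c'b)\omega b'Px\big)\le (MK(c'b)^2\omega-\delta)|z|^2-x'P\big((A+bp'+\delta I)x+f(d,x,u)\big)$$ for all $d\in D$ and all $(x,z)\in\mathbb{R}^n\times\mathbb{R}$ with $x'Px\le R^2$, $\omega|z|\le1$, where $u=p'x-Kc'b\,\omega z$. Define $\tilde k:\mathbb{R}^n\times\mathbb{R}\to\mathbb{R}$ by $$\tilde k(x,y)=\begin{cases}k(x)&\text{if }x'Px\ge R^2,\\ p'x-Kc'b\,\mathrm{sat}(\omega(y+c'x))&\text{if }x'Px<R^2.\end{cases}$$ Then for sufficiently small $\tilde r>0$, the origin $0\in\mathbb{R}^n\times\mathbb{R}$ is RGAS for the sampled-data system $$\dot x(t)=Ax(t)+f(d(t),x(t),u(t))+bu(t),\qquad \dot y(t)=x_n(t)+g(d(t),x(t),u(t)),$$ $$u(t)=\tilde k(x(\tau_i),y(\tau_i)),\ t\in[\tau_i,\tau_{i+1}),\qquad \tau_0=0,\quad \tau_{i+1}=\tau_i+\tilde r\exp(-w(\tau_i)),\qquad d(t)\in D,\ w(t)\in[0,+\infty).$$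
   Context: A prime denotes transpose, $|\cdot|$ is the Euclidean norm, $\mathrm{sat}(s)=s/\max(1,|s|)$ for $s\in\mathbb{R}$. For a set $U$, $L^\infty_{loc}([0,+\infty);U)$ denotes the space of measurable and locally essentially bounded functions defined on $[0,+\infty)$ and taking values in $U$. Sampled-data systems. Consider a system with state $\xi\in\mathbb{R}^N$ of the form $\dot\xi(t)=F(d(t),\xi(t),\xi(\tau_i))$ for $t\in[\tau_i,\tau_{i+1})$, with $\tau_0=0$, $\tau_{i+1}=\tau_i+\rho\exp(-w(\tau_i))$, $i=0,1,\dots$, where $\rho>0$ is a constant. The admissible inputs are all $d\in L^\infty_{loc}([0,+\infty);D)$ and $w\in L^\infty_{loc}([0,+\infty);[0,+\infty))$. For each initial condition $\xi(0)=\xi_0$ and inputs $(d,w)$, the unique solution is denoted $\xi(t,\xi_0,d,w)$; it is defined on $[0,t_{\max})$, where $t_{\max}\in(0,+\infty]$ is its maximal existence time, and if $t_{\max}<+\infty$ then $\limsup_{t\to t_{\max}^-}|\xi(t)|=+\infty$. Definition (RGAS). $0\in\mathbb{R}^N$ is robustly globally asymptotically stable (RGAS) for the sampled-data system if: (P1) for every $\varepsilon>0$, $\sup\{|\xi(t,\xi_0,d,w)|:\ t\ge0,\ |\xi_0|\le\varepsilon,\ (d,w)\text{ admissible inputs}\}<+\infty$; (P2) for every $\varepsilon>0$ there is $\delta(\varepsilon)>0$ such that $|\xi_0|\le\delta(\varepsilon)$ implies $|\xi(t,\xi_0,d,w)|\le\varepsilon$ for all $t\ge0$ and all admissible inputs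 $(d,w)$; (P3) for every $\varepsilon>0$ and $R_0\ge0$ there is $\tau(\varepsilon,R_0)\ge0$ such that $|\xi_0|\le R_0$ implies $|\xi(t,\xi_0,d,w)|\le\varepsilon$ for all $t\ge\tau(\varepsilon,R_0)$ and all admissible inputs $(d,w)$. "For sufficiently small $\tilde r>0$" means: there is $r^*>0$ such that the assertion holds for every $\tilde r\in(0,r^*]$. *)

theory Defs
  imports "HOL-Analysis.Analysis"
begin

section \<open>Vectors and matrices\<close>

text \<open>The linear order of the index type fixes the enumeration of the \<open>n = CARD('n)\<close>
  coordinates: \<open>idx i\<close> is the (1-based) position of \<open>i\<close>.\<close>

definition idx :: "'n::{finite,linorder} \<Rightarrow> nat"
  where "idx i = card {j. j \<le> i}"

definition first_unit :: "real^'n::{finite,linorder}"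
  where "first_unit = axis (Min UNIV) 1"

definition last_unit :: "real^'n::{finite,linorder}"
  where "last_unit = axis (Max UNIV) 1"

definition last_comp :: "real^'n::{finite,linorder} \<Rightarrow> real"
  where "last_comp x = x $ Max UNIV"

definition shift_matrix :: "real^'n::{finite,linorder}^'n::{finite,linorder}"
  where "shift_matrix = (\<chi> i j. if idx i = idx j + 1 then 1 else 0)"

text \<open>The rank-one matrix \<open>u v'\<close>.\<close>

definition outer_prod :: "real^'m \<Rightarrow> real^'n \<Rightarrow> real^'n^'m"
  where "outer_prod u v = (\<chi> i j. u $ i * v $ j)"

definition positive_definite :: "real^'n^'n \<Rightarrow> bool"
  where "positive_definite Q \<longleftrightarrow> (\<forall>x. x \<noteq> 0 \<longrightarrow> x \<bullet> (Q *v x) > 0)"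

definition negative_definite :: "real^'n^'n \<Rightarrow> bool"
  where "negative_definite Q \<longleftrightarrow> (\<forall>x. x \<noteq> 0 \<longrightarrow> x \<bullet> (Q *v x) < 0)"

section \<open>Functions\<close>

definition sat :: "real \<Rightarrow> real"
  where "sat s = s / max 1 \<bar>s\<bar>"

definition locally_lipschitz_on :: "'a::metric_space set \<Rightarrow> ('a \<Rightarrow> 'b::metric_space) \<Rightarrow> bool"
  where "locally_lipschitz_on S h \<longleftrightarrow>
    (\<forall>x\<in>S. \<exists>e>0. \<exists>L. L-lipschitz_on (cball x e \<inter> S) h)"

definition locally_bounded :: "('a::metric_space \<Rightarrow> 'b::metric_space) \<Rightarrow> bool"
  where "locally_bounded h \<longleftrightarrow> (\<forall>x. \<exists>e>0. bounded (h ` ball x e))"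

text \<open>The elements are functions, not classes modulo null sets: the sampling times depend on
  the pointwise values \<open>w(\<tau>\<^sub>i)\<close>.\<close>

definition Linf_loc :: "'a::real_normed_vector set \<Rightarrow> (real \<Rightarrow> 'a) set"
  where "Linf_loc U = {v. v \<in> borel_measurable (lebesgue_on {0..}) \<and> (\<forall>t\<ge>0. v t \<in> U) \<and>
    (\<forall>T. \<exists>B. AE t in lebesgue_on {0..T}. norm (v t) \<le> B)}"

section \<open>Sampled-data systems\<close>

primrec sample_time :: "real \<Rightarrow> (real \<Rightarrow> real) \<Rightarrow> nat \<Rightarrow> real" where
  "sample_time \<rho> w 0 = 0"
| "sample_time \<rho> w (Suc i) = sample_time \<rho> w i + \<rho> * exp (- w (sample_time \<rho> w i))"

text \<open>The sampling intervals \<open>[\<tau>\<^sub>i, \<tau>\<^sub>i\<^sub>+\<^sub>1)\<close> cover exactly \<open>[0, horizon)\<close>. The horizon is \<open>\<infinity>\<close>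
  unless the sampling times accumulate; an input \<open>w\<close> that is only essentially bounded can be
  unbounded along the sampling times and make this happen. The equations say nothing about a
  solution beyond the horizon.\<close>

definition horizon :: "real \<Rightarrow> (real \<Rightarrow> real) \<Rightarrow> ereal"
  where "horizon \<rho> w = (SUP i. ereal (sample_time \<rho> w i))"

text \<open>\<open>\<xi>\<close> solves \<open>\<xi>'(t) = F(d(t), \<xi>(t), \<xi>(\<tau>\<^sub>i))\<close>, \<open>t \<in> [\<tau>\<^sub>i, \<tau>\<^sub>i\<^sub>+\<^sub>1)\<close>, \<open>\<xi>(0) = \<xi>\<^sub>0\<close>, on \<open>[0, T)\<close> in the
  sense of Caratheodory. Since \<open>d\<close> is merely measurable, the differential equation is understood
  in integrated form, with a Lebesgue integrable right-hand side; the closed right end of the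
  interval makes \<open>\<xi>\<close> continuous across the sampling times.\<close>

definition solution_on ::
  "('d \<Rightarrow> 's \<Rightarrow> 's \<Rightarrow> 's) \<Rightarrow> real \<Rightarrow> 's::euclidean_space \<Rightarrow> (real \<Rightarrow> 'd) \<Rightarrow> (real \<Rightarrow> real)
    \<Rightarrow> ereal \<Rightarrow> (real \<Rightarrow> 's) \<Rightarrow> bool"
  where "solution_on F \<rho> \<xi>0 d w T \<xi> \<longleftrightarrow>
    T \<le> horizon \<rho> w \<and> \<xi> 0 = \<xi>0 \<and>
    (\<forall>i t. sample_time \<rho> w i \<le> t \<and> t \<le> sample_time \<rho> w (Suc i) \<and> ereal t < T \<longrightarrow>
      (\<lambda>s. F (d s) (\<xi> s) (\<xi> (sample_time \<rho> w i)))
        absolutely_integrable_on {sample_time \<rho> w i..t} \<and>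
      \<xi> t = \<xi> (sample_time \<rho> w i) +
        integral {sample_time \<rho> w i..t} (\<lambda>s. F (d s) (\<xi> s) (\<xi> (sample_time \<rho> w i))))"

text \<open>\<open>reaches D F \<rho> \<xi>\<^sub>0 t v\<close>: \<open>v = \<xi>(t, \<xi>\<^sub>0, d, w)\<close> for some admissible inputs \<open>(d, w)\<close> for which the
  solution exists up to a time beyond \<open>t \<ge> 0\<close>.\<close>

definition reaches ::
  "'d::real_normed_vector set \<Rightarrow> ('d \<Rightarrow> 's \<Rightarrow> 's \<Rightarrow> 's) \<Rightarrow> real \<Rightarrow> 's::euclidean_space \<Rightarrow> real \<Rightarrow> 's \<Rightarrow> bool"
  where "reaches D F \<rho> \<xi>0 t v \<longleftrightarrow>
    (\<exists>d\<in>Linf_loc D. \<exists>w\<in>Linf_loc {0..}. \<exists>T \<xi>.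
      solution_on F \<rho> \<xi>0 d w T \<xi> \<and> 0 \<le> t \<and> ereal t < T \<and> v = \<xi> t)"

text \<open>The first conjunct makes explicit that the solutions exist for all \<open>t \<ge> 0\<close> (up to the
  horizon, if the sampling times accumulate); the others are the boundedness, stability and
  uniform attractivity properties.\<close>

definition RGAS ::
  "'d::real_normed_vector set \<Rightarrow> ('d \<Rightarrow> 's::euclidean_space \<Rightarrow> 's \<Rightarrow> 's) \<Rightarrow> real \<Rightarrow> bool"
  where "RGAS D F \<rho> \<longleftrightarrow>
    (\<forall>\<xi>0. \<forall>d\<in>Linf_loc D. \<forall>w\<in>Linf_loc {0..}. \<exists>\<xi>. solution_on F \<rho> \<xi>0 d w (horizon \<rho> w) \<xi>) \<and>
    (\<forall>\<epsilon>>0. bdd_above {norm v | v t \<xi>0. norm \<xi>0 \<le> \<epsilon> \<and> reaches D F \<rho> \<xi>0 t v}) \<and>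
    (\<forall>\<epsilon>>0. \<exists>\<delta>>0. \<forall>\<xi>0 t v. norm \<xi>0 \<le> \<delta> \<and> reaches D F \<rho> \<xi>0 t v \<longrightarrow> norm v \<le> \<epsilon>) \<and>
    (\<forall>\<epsilon>>0. \<forall>R0\<ge>0. \<exists>\<tau>\<ge>0. \<forall>\<xi>0 t v. norm \<xi>0 \<le> R0 \<and> t \<ge> \<tau> \<and> reaches D F \<rho> \<xi>0 t v
      \<longrightarrow> norm v \<le> \<epsilon>)"

section \<open>The closed-loop systems\<close>

definition nominal_loop ::
  "real^'n^'n \<Rightarrow> real^'n \<Rightarrow> ('d \<times> (real^'n) \<times> real \<Rightarrow> real^'n) \<Rightarrow> (real^'n \<Rightarrow> real)
    \<Rightarrow> 'd \<Rightarrow> real^'n \<Rightarrow> real^'n \<Rightarrow> real^'n"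
  where "nominal_loop A b f k d x x\<^sub>\<tau> =
    (let u = k x\<^sub>\<tau> in A *v x + u *\<^sub>R b + f (d, x, u))"

definition augmented_loop ::
  "real^'n::{finite,linorder}^'n::{finite,linorder} \<Rightarrow> real^'n::{finite,linorder}
    \<Rightarrow> ('d \<times> (real^'n::{finite,linorder}) \<times> real \<Rightarrow> real^'n::{finite,linorder})
    \<Rightarrow> ('d \<times> (real^'n::{finite,linorder}) \<times> real \<Rightarrow> real)
    \<Rightarrow> ((real^'n::{finite,linorder}) \<times> real \<Rightarrow> real)
    \<Rightarrow> 'd \<Rightarrow> (real^'n::{finite,linorder}) \<times> real \<Rightarrow> (real^'n::{finite,linorder}) \<times> real
    \<Rightarrow> (real^'n::{finite,linorder}) \<times> real"
  where "augmented_loop A b f g k d \<xi> \<xi>\<^sub>\<tau> =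
    (let x = fst \<xi>; u = k \<xi>\<^sub>\<tau> in (A *v x + f (d, x, u) + u *\<^sub>R b, last_comp x + g (d, x, u)))"

definition switched_feedback ::
  "(real^'n \<Rightarrow> real) \<Rightarrow> real^'n^'n \<Rightarrow> real^'n \<Rightarrow> real^'n \<Rightarrow> real^'n \<Rightarrow> real \<Rightarrow> real \<Rightarrow> real
    \<Rightarrow> (real^'n) \<times> real \<Rightarrow> real"
  where "switched_feedback k P p b c R K \<omega> = (\<lambda>(x, y).
    if x \<bullet> (P *v x) \<ge> R\<^sup>2 then k x
    else p \<bullet> x - K * (c \<bullet> b) * sat (\<omega> * (y + c \<bullet> x)))"

end

(* Put z = y + c'x, V = x'Px and W = V + M z^2. By the choice of c, the derivative of z is
   g + c'f + c'b (u - p'x).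

   While V >= R^2 at the sampling times, x is a solution of the nominal system: the smaller
   sampling constant r' is absorbed by replacing w with w + ln (r / r'). Hence x stays bounded and
   V < R^2 at some sampling time, within a time that is uniform for bounded initial data, and y
   grows at most linearly until then. From that time on the control differs from
   p'x - K c'b sat(omega z) only by the sampling error, which is of order r'. So for small r' the
   first condition keeps V < R^2, the second one makes z^2 decrease at a constant rate as long as
   omega |z| >= 1 at the sampling times and afterwards preserves omega |z| < 1, and the third one
   makes W decrease at a rate proportional to W, the error being at most r' |(x, y)|^2 up to a
   constant. Small initial states start in this last phase, which gives stability.

   Solutions exist: the nominal solution provides x in the first phase, and in the second phase
   one Picard iteration covers a whole sampling interval, because the interval is short and the
   field is bounded and Lipschitz on the sublevel set of V. *)

theory Submission
  imports Defs
begin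

section \<open>Integral curves\<close>

text \<open>Near the origin the sampling error has to be measured relative to the state: an error
  that is merely of order \<open>h\<close> would leave a residual ball and give practical stability
  only. For the first two conditions an absolute error of order \<open>h\<close> is harmless,
  because they hold with a strict margin \<mu>. They also admit every control with
  \<open>|u - p'x| <= K |c'b|\<close>, so the saturation may stay frozen at its sampled value and
  only \<open>p'x\<close> contributes an error. The values of \<open>w\<close> at the sampling times
  have no a priori bound, so sampling intervals may be arbitrarily short and may accumulate. Hence
  every estimate on one interval is a rate times elapsed time and passes from sample to sample by
  induction, without counting samples. The decay of W is recorded as
  \<open>W(t) (1 + \<gamma> (t - a)) <= W(a)\<close>: weaker than exponential decay, but inherited
  by concatenation. Disturbances are only measurable and the control jumps at the samples, so curves
  are handled through integrals and quadratic functions of them through increments.\<close>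

definition integral_curve :: "(real \<Rightarrow> 's::euclidean_space) \<Rightarrow> real \<Rightarrow> real \<Rightarrow> (real \<Rightarrow> 's) \<Rightarrow> bool"
  where "integral_curve G a b \<xi> \<longleftrightarrow>
    G absolutely_integrable_on {a..b} \<and> (\<forall>t\<in>{a..b}. integral {a..t} G = \<xi> t - \<xi> a)"

lemma integral_curve_integrable:
  assumes "integral_curve G a b \<xi>" "a \<le> s" "t \<le> b"
  shows "G integrable_on {s..t}"
proof -
  have "G integrable_on {a..b}"
    using assms(1) by (auto simp: integral_curve_def set_lebesgue_integral_eq_integral(1))
  then show ?thesis
    by (rule integrable_on_subinterval) (use assms in auto)
qed

lemma integral_curve_increment:
  assumes c: "integral_curve G a b \<xi>" and st: "a \<le> s" "s \<le> t" "t \<le> b"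
  shows "\<xi> t - \<xi> s = integral {s..t} G"
proof -
  have "integral {a..t} G - integral {a..s} G = \<xi> t - \<xi> s"
    using c st by (simp add: integral_curve_def)
  moreover have "integral {a..s} G + integral {s..t} G = integral {a..t} G"
    by (rule Henstock_Kurzweil_Integration.integral_combine)
      (use st integral_curve_integrable[OF c] in auto)
  ultimately show ?thesis by (metis add_diff_cancel_left')
qed

lemma integral_curve_continuous:
  assumes c: "integral_curve G a b \<xi>"
  shows "continuous_on {a..b} \<xi>"
proof -
  have "continuous_on {a..b} (\<lambda>t. \<xi> a + integral {a..t} G)"
    by (intro continuous_intros indefinite_integral_continuous_1 integral_curve_integrable[OF c]) auto
  then show ?thesis
    by (rule continuous_on_eq) (use c in \<open>auto simp: integral_curve_def\<close>)
qed

lemma integral_curve_initial: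
  assumes "integral_curve G a b \<xi>" "b' \<le> b"
  shows "integral_curve G a b' \<xi>"
proof -
  have "G absolutely_integrable_on {a..b'}"
    by (rule absolutely_integrable_on_subinterval[where S = "{a..b}"])
      (use assms in \<open>auto simp: integral_curve_def\<close>)
  then show ?thesis using assms by (simp add: integral_curve_def)
qed

lemma integral_curve_cong:
  assumes c: "integral_curve G a b \<xi>" and eq: "\<And>s. s \<in> {a..b} \<Longrightarrow> H s = G s \<and> \<phi> s = \<xi> s"
  shows "integral_curve H a b \<phi>"
proof -
  have "G absolutely_integrable_on {a..b} \<longleftrightarrow> H absolutely_integrable_on {a..b}"
    by (rule set_integrable_cong) (use eq in auto)
  moreover have "integral {a..t} H = \<phi> t - \<phi> a" if "t \<in> {a..b}" for t
  proof -
    have "integral {a..t} H = integral {a..t} G"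
      using eq that by (intro Henstock_Kurzweil_Integration.integral_cong) auto
    moreover have "integral {a..t} G = \<xi> t - \<xi> a" using c that by (simp add: integral_curve_def)
    moreover have "\<phi> t = \<xi> t" "\<phi> a = \<xi> a" using eq that by auto
    ultimately show ?thesis by simp
  qed
  ultimately show ?thesis using c by (simp add: integral_curve_def)
qed

lemma integral_curve_fst:
  fixes \<xi> :: "real \<Rightarrow> 'a::euclidean_space \<times> 'b::euclidean_space"
  assumes c: "integral_curve G a b \<xi>"
  shows "integral_curve (\<lambda>s. fst (G s)) a b (\<lambda>s. fst (\<xi> s))"
proof -
  have "(fst \<circ> G) absolutely_integrable_on {a..b}"
    using c by (intro absolutely_integrable_linear bounded_linear_fst) (auto simp: integral_curve_def)
  moreover have "integral {a..t} (\<lambda>s. fst (G s)) = fst (\<xi> t) - fst (\<xi> a)" if "t \<in> {a..b}" for t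
  proof -
    have "integral {a..t} (fst \<circ> G) = fst (integral {a..t} G)"
      by (intro integral_linear bounded_linear_fst integral_curve_integrable[OF c]) (use that in auto)
    then show ?thesis using c that by (simp add: integral_curve_def o_def)
  qed
  ultimately show ?thesis by (simp add: integral_curve_def o_def)
qed

section \<open>Growth estimates, first hitting times and existence for integral curves\<close>

lemma norm_integral_le:
  fixes G :: "real \<Rightarrow> 's::euclidean_space"
  assumes "G integrable_on {s..t}" "s \<le> t" "\<And>\<sigma>. \<sigma> \<in> {s..t} \<Longrightarrow> norm (G \<sigma>) \<le> B"
  shows "norm (integral {s..t} G) \<le> B * (t - s)"
proof -
  have "norm (integral {s..t} G) \<le> integral {s..t} (\<lambda>_. B)"
    by (rule integral_norm_bound_integral) (use assms in auto)
  then show ?thesis using assms(2) by (simp add: mult.commute)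
qed

lemma integral_curve_dist_le:
  assumes c: "integral_curve G a b \<xi>" and st: "a \<le> s" "s \<le> t" "t \<le> b"
    and B: "\<And>\<sigma>. \<sigma> \<in> {s..t} \<Longrightarrow> norm (G \<sigma>) \<le> B"
  shows "norm (\<xi> t - \<xi> s) \<le> B * (t - s)"
  unfolding integral_curve_increment[OF c st]
  by (rule norm_integral_le) (use integral_curve_integrable[OF c] st B in auto)

text \<open>Cutting the interval into n equal pieces turns the quadratic terms into a total of
  \<open>C (t - s)^2 / n\<close>, which vanishes as n grows.\<close>

lemma linear_growth_of_local_bound:
  fixes q :: "real \<Rightarrow> real"
  assumes st: "s \<le> t"
    and loc: "\<And>s' t'. s \<le> s' \<Longrightarrow> s' \<le> t' \<Longrightarrow> t' \<le> t \<Longrightarrow>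
      q t' - q s' \<le> m * (t' - s') + C * (t' - s')\<^sup>2"
  shows "q t - q s \<le> m * (t - s)"
proof -
  have bound: "q t - q s \<le> m * (t - s) + C * (t - s)\<^sup>2 / real n" if n: "n > 0" for n :: nat
  proof -
    define h where "h = (t - s) / real n"
    have h: "h \<ge> 0" "real n * h = t - s" using st n by (auto simp: h_def)
    have "q (s + real j * h) - q s \<le> real j * (m * h + C * h\<^sup>2)" if "j \<le> n" for j
      using that
    proof (induction j)
      case (Suc j)
      have "real (Suc j) * h \<le> real n * h"
        using Suc.prems h(1) by (intro mult_right_mono) auto
      then have "q (s + real (Suc j) * h) - q (s + real j * h)
          \<le> m * (s + real (Suc j) * h - (s + real j * h)) + C * (s + real (Suc j) * h - (s + real j * h))\<^sup>2"
        using h by (intro loc) (auto simp: algebra_simps)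
      also have "s + real (Suc j) * h - (s + real j * h) = h" by (simp add: algebra_simps)
      finally show ?case using Suc by (simp add: algebra_simps)
    qed simp
    from this[of n] have "q t - q s \<le> real n * (m * h + C * h\<^sup>2)" using h by simp
    also have "\<dots> = m * (real n * h) + C * (real n * h) * h"
      by (simp add: algebra_simps power2_eq_square)
    also have "\<dots> = m * (t - s) + C * (t - s)\<^sup>2 / real n"
      unfolding h(2) by (simp add: h_def power2_eq_square)
    finally show ?thesis .
  qed
  have "(\<lambda>n. m * (t - s) + C * (t - s)\<^sup>2 / real n) \<longlonglongrightarrow> m * (t - s) + 0"
    by (intro tendsto_intros lim_const_over_n)
  then show ?thesis
    by (intro LIMSEQ_le_const[of _ "m * (t - s)"]) (auto intro!: exI[of _ 1] bound)
qed

text \<open>The integrand is bounded at every time, so no differentiation almost everywhere is needed: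
  \<open>Q(\<xi> t) - Q(\<xi> s) = \<integral> (\<xi> t + \<xi> s) \<bullet> S G\<close> differs from \<open>\<integral> 2 \<xi> \<bullet> S G\<close> by a term
  quadratic in \<open>t - s\<close>, which subdivision removes.\<close>

lemma integral_curve_quadratic_form_le:
  fixes \<xi> :: "real \<Rightarrow> 's::euclidean_space"
  assumes c: "integral_curve G a b \<xi>" and st: "a \<le> s" "s \<le> t" "t \<le> b"
    and B: "\<And>\<sigma>. \<sigma> \<in> {s..t} \<Longrightarrow> norm (G \<sigma>) \<le> B"
    and S: "bounded_linear S" and sym: "\<And>x y. x \<bullet> S y = S x \<bullet> y"
    and m: "\<And>\<sigma>. \<sigma> \<in> {s..t} \<Longrightarrow> 2 * (\<xi> \<sigma> \<bullet> S (G \<sigma>)) \<le> m"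
  shows "\<xi> t \<bullet> S (\<xi> t) - \<xi> s \<bullet> S (\<xi> s) \<le> m * (t - s)"
proof -
  interpret S: bounded_linear S by (rule S)
  obtain KS where KS: "KS > 0" "\<And>x. norm (S x) \<le> norm x * KS"
    using S.pos_bounded by blast
  have B0: "B \<ge> 0" using B[of s] st norm_ge_zero[of "G s"] by (simp del: norm_ge_zero)
  show ?thesis
  proof (rule linear_growth_of_local_bound[OF st(2)])
    fix s' t' assume h: "s \<le> s'" "s' \<le> t'" "t' \<le> t"
    define v where "v = S (\<xi> t' + \<xi> s')"
    have int: "G integrable_on {s'..t'}"
      using integral_curve_integrable[OF c] h st by auto
    have D: "\<xi> t' \<bullet> S (\<xi> t') - \<xi> s' \<bullet> S (\<xi> s') = v \<bullet> (\<xi> t' - \<xi> s')"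
      unfolding v_def S.add inner_diff_right inner_add_left
      using sym[of "\<xi> t'" "\<xi> s'"] by (simp add: inner_commute)
    also have "\<dots> = v \<bullet> integral {s'..t'} G"
      using integral_curve_increment[OF c, of s' t'] h st by simp
    also have "\<dots> = integral {s'..t'} (\<lambda>\<sigma>. v \<bullet> G \<sigma>)"
      using integral_linear[OF int bounded_linear_inner_right[of v]] by (simp add: o_def)
    also have "\<dots> \<le> integral {s'..t'} (\<lambda>_. m + 2 * B\<^sup>2 * KS * (t' - s'))"
    proof (rule integral_le)
      show "(\<lambda>\<sigma>. v \<bullet> G \<sigma>) integrable_on {s'..t'}"
        using integrable_linear[OF int bounded_linear_inner_right[of v]] by (simp add: o_def)
      fix \<sigma> assume \<sigma>: "\<sigma> \<in> {s'..t'}"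
      have "norm (\<xi> t' - \<xi> \<sigma>) \<le> B * (t' - \<sigma>)" "norm (\<xi> \<sigma> - \<xi> s') \<le> B * (\<sigma> - s')"
        using \<sigma> h st B by (auto intro!: integral_curve_dist_le[OF c])
      moreover have "B * (t' - \<sigma>) \<le> B * (t' - s')" "B * (\<sigma> - s') \<le> B * (t' - s')"
        using \<sigma> B0 by (auto intro!: mult_left_mono)
      ultimately have "norm ((\<xi> t' - \<xi> \<sigma>) - (\<xi> \<sigma> - \<xi> s')) \<le> 2 * (B * (t' - s'))"
        using norm_triangle_ineq4[of "\<xi> t' - \<xi> \<sigma>" "\<xi> \<sigma> - \<xi> s'"] by linarith
      then have 1: "norm (S ((\<xi> t' - \<xi> \<sigma>) - (\<xi> \<sigma> - \<xi> s'))) \<le> 2 * (B * (t' - s')) * KS"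
        using KS(2)[of "(\<xi> t' - \<xi> \<sigma>) - (\<xi> \<sigma> - \<xi> s')"] KS(1)
        by (meson mult_right_mono less_imp_le order_trans)
      have "S ((\<xi> t' - \<xi> \<sigma>) - (\<xi> \<sigma> - \<xi> s')) \<bullet> G \<sigma>
          \<le> norm (S ((\<xi> t' - \<xi> \<sigma>) - (\<xi> \<sigma> - \<xi> s'))) * norm (G \<sigma>)"
        by (rule norm_cauchy_schwarz)
      also have "\<dots> \<le> 2 * (B * (t' - s')) * KS * B"
        using 1 B[of \<sigma>] \<sigma> h B0 KS(1) by (intro mult_mono) auto
      finally have 2: "S ((\<xi> t' - \<xi> \<sigma>) - (\<xi> \<sigma> - \<xi> s')) \<bullet> G \<sigma> \<le> 2 * B\<^sup>2 * KS * (t' - s')"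
        by (simp add: power2_eq_square algebra_simps)
      have "v \<bullet> G \<sigma> = 2 * (S (\<xi> \<sigma>) \<bullet> G \<sigma>) + S ((\<xi> t' - \<xi> \<sigma>) - (\<xi> \<sigma> - \<xi> s')) \<bullet> G \<sigma>"
        by (simp add: v_def S.add S.diff inner_add_left inner_diff_left)
      then show "v \<bullet> G \<sigma> \<le> m + 2 * B\<^sup>2 * KS * (t' - s')"
        using m[of \<sigma>] 2 \<sigma> h by (simp add: sym)
    qed auto
    also have "\<dots> = m * (t' - s') + 2 * B\<^sup>2 * KS * (t' - s')\<^sup>2"
      using h by (simp add: power2_eq_square algebra_simps)
    finally show "\<xi> t' \<bullet> S (\<xi> t') - \<xi> s' \<bullet> S (\<xi> s') \<le> m * (t' - s') + 2 * B\<^sup>2 * KS * (t' - s')\<^sup>2" .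
  qed
qed

text \<open>The level set of q is closed, so there is a first hit if there is any. Only a first hit
  has to be refuted, and up to that time q stays in the closed sublevel set, where bounds that fail
  outside of it may be used.\<close>

lemma less_if_no_first_hit:
  fixes q :: "real \<Rightarrow> real"
  assumes cont: "continuous_on {a..b} q" and a: "q a < \<rho>"
    and no_hit: "\<And>t. a \<le> t \<Longrightarrow> t \<le> b \<Longrightarrow> q t = \<rho> \<Longrightarrow> (\<And>s. a \<le> s \<Longrightarrow> s \<le> t \<Longrightarrow> q s \<le> \<rho>) \<Longrightarrow> False"
    and t: "a \<le> t" "t \<le> b"
  shows "q t < \<rho>"
proof (rule ccontr)
  assume "\<not> q t < \<rho>"
  then have qt: "\<rho> \<le> q t" by simp
  have ct: "continuous_on {a..t} q" using cont t by (auto intro: continuous_on_subset)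
  define Z where "Z = {s \<in> {a..t}. q s = \<rho>}"
  have "closed Z" unfolding Z_def
    using continuous_closed_preimage_constant[OF ct] by simp
  moreover obtain s0 where "s0 \<in> Z"
    using IVT'[of q a \<rho> t] a qt t ct by (auto simp: Z_def)
  moreover have "bdd_below Z" by (auto simp: Z_def intro!: bdd_belowI[of _ a])
  ultimately have IZ: "Inf Z \<in> Z" using closed_contains_Inf by blast
  show False
  proof (rule no_hit[of "Inf Z"])
    fix s assume s: "a \<le> s" "s \<le> Inf Z"
    show "q s \<le> \<rho>"
    proof (rule ccontr)
      \<comment> \<open>An excess before the first hit would produce a still earlier hit by the
        intermediate value theorem.\<close>
      assume "\<not> q s \<le> \<rho>"
      then obtain s1 where s1: "a \<le> s1" "s1 \<le> s" "q s1 = \<rho>"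
        using IVT'[of q a \<rho> s] a s IZ continuous_on_subset[OF ct, of "{a..s}"]
        by (auto simp: Z_def)
      then have "s1 \<in> Z" using s IZ by (auto simp: Z_def)
      then have "Inf Z \<le> s1" using \<open>bdd_below Z\<close> by (rule cInf_lower)
      then have "s1 = s" using s1 s by simp
      then show False using s1 \<open>\<not> q s \<le> \<rho>\<close> by simp
    qed
  qed (use IZ t in \<open>auto simp: Z_def\<close>)
qed

text \<open>The integral operator contracts in the sup norm with factor
  \<open>L (b - a) < 1\<close>, and \<open>B (b - a) \<le> e\<close> keeps it in the ball, so the
  whole interval is covered at once. Since h may be irregular in time, integrability along
  continuous curves is a premise.\<close>

lemma Picard_caratheodory:
  fixes h :: "real \<Rightarrow> 's::euclidean_space \<Rightarrow> 's"
  assumes ab: "a \<le> b" and e: "e \<ge> 0"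
    and int: "\<And>\<phi>. continuous_on {a..b} \<phi> \<Longrightarrow> (\<And>t. t \<in> {a..b} \<Longrightarrow> \<phi> t \<in> cball x0 e) \<Longrightarrow>
      (\<lambda>s. h s (\<phi> s)) absolutely_integrable_on {a..b}"
    and bound: "\<And>s x. s \<in> {a..b} \<Longrightarrow> x \<in> cball x0 e \<Longrightarrow> norm (h s x) \<le> B"
    and lip: "\<And>s x y. s \<in> {a..b} \<Longrightarrow> x \<in> cball x0 e \<Longrightarrow> y \<in> cball x0 e \<Longrightarrow>
      norm (h s x - h s y) \<le> L * norm (x - y)"
    and L: "0 \<le> L" "L * (b - a) < 1" and B: "B * (b - a) \<le> e"
  shows "\<exists>\<phi>. \<phi> a = x0 \<and> integral_curve (\<lambda>s. h s (\<phi> s)) a b \<phi>"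
proof -
  \<comment> \<open>Curves live in the complete space of bounded continuous functions on the whole
    line; their values outside \<open>{a..b}\<close> never enter the integrals.\<close>
  define X where "X = PiC (UNIV :: real set) (\<lambda>_. cball x0 e)"
  have X: "\<psi> \<in> X \<longleftrightarrow> (\<forall>s. \<psi> s \<in> cball x0 e)" for \<psi> :: "real \<Rightarrow>\<^sub>C 's"
    by (auto simp: X_def mem_PiC_iff)
  have "complete X" unfolding X_def complete_eq_closed by (intro closed_PiC) auto
  moreover have "X \<noteq> {}"
    using X[of "const_bcontfun x0"] e by (auto simp: const_bcontfun.rep_eq)
  define N where "N \<psi> t = x0 + integral {a..t} (\<lambda>s. h s (\<psi> s))" for \<psi> :: "real \<Rightarrow> 's" and t
  have inte: "(\<lambda>s. h s (\<psi> s)) integrable_on {a..t}" if "\<psi> \<in> X" "t \<in> {a..b}" for \<psi> t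
  proof -
    have "(\<lambda>s. h s (\<psi> s)) absolutely_integrable_on {a..b}"
      using that X by (intro int) auto
    then have "(\<lambda>s. h s (\<psi> s)) integrable_on {a..b}"
      by (rule set_lebesgue_integral_eq_integral(1))
    then show ?thesis by (rule integrable_on_subinterval) (use that in auto)
  qed
  have "norm (h a x0) \<le> B" using ab e by (intro bound) auto
  then have B0: "B \<ge> 0" using norm_ge_zero[of "h a x0"] by linarith
  have contN: "continuous_on {a..b} (N \<psi>)" if "\<psi> \<in> X" for \<psi>
    unfolding N_def using inte[OF that, of b] ab
    by (intro continuous_intros indefinite_integral_continuous_1) auto
  \<comment> \<open>The iterate is defined on \<open>{a..b}\<close> only; \<open>ext_cont\<close>
    extends it by its end values, so it is bounded and continuous everywhere.\<close>
  define F where "F \<psi> = Bcontfun (ext_cont (N (apply_bcontfun \<psi>)) a b)" for \<psi>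
  have F: "F \<psi> s = N \<psi> (clamp a b s)" if "\<psi> \<in> X" for \<psi> s
  proof -
    have c: "continuous_on (cbox a b) (N \<psi>)" using contN[OF that] by simp
    then have "bounded (N \<psi> ` cbox a b)"
      by (intro compact_imp_bounded compact_continuous_image) auto
    then have "ext_cont (N \<psi>) a b \<in> bcontfun"
      unfolding bcontfun_def ext_cont_def
      using clamp_continuous_on[OF c] clamp_bounded by blast
    then show ?thesis by (simp add: F_def Bcontfun_inverse) (simp add: ext_cont_def)
  qed
  have cl: "clamp a b s \<in> {a..b}" for s using ab clamp_in_interval[of a b s] by auto
  have "F ` X \<subseteq> X"
  proof (rule image_subsetI)
    fix \<psi> assume psi: "\<psi> \<in> X"
    have "N \<psi> t \<in> cball x0 e" if t: "t \<in> {a..b}" for t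
    proof -
      have "norm (integral {a..t} (\<lambda>s. h s (\<psi> s))) \<le> B * (t - a)"
        using t psi X by (intro norm_integral_le inte bound) auto
      also have "\<dots> \<le> B * (b - a)" using t B0 by (intro mult_left_mono) auto
      finally show ?thesis using B by (simp add: N_def dist_norm)
    qed
    then show "F \<psi> \<in> X" using X F[OF psi] cl by auto
  qed
  moreover have "dist (F \<psi>) (F \<psi>') \<le> (L * (b - a)) * dist \<psi> \<psi>'" if psi: "\<psi> \<in> X" "\<psi>' \<in> X" for \<psi> \<psi>'
  proof (rule dist_bound)
    fix s
    define t where "t = clamp a b s"
    have t: "t \<in> {a..b}" using cl by (simp add: t_def)
    have "dist (F \<psi> s) (F \<psi>' s) = norm (integral {a..t} (\<lambda>s. h s (\<psi> s) - h s (\<psi>' s)))"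
      using psi
      by (simp add: F N_def t_def[symmetric] dist_norm
        Henstock_Kurzweil_Integration.integral_diff[OF inte[OF psi(1) t] inte[OF psi(2) t]])
    also have "\<dots> \<le> (L * dist \<psi> \<psi>') * (t - a)"
    proof (rule norm_integral_le)
      fix \<sigma> assume "\<sigma> \<in> {a..t}"
      then have "norm (h \<sigma> (\<psi> \<sigma>) - h \<sigma> (\<psi>' \<sigma>)) \<le> L * norm (\<psi> \<sigma> - \<psi>' \<sigma>)"
        using t psi X by (intro lip) auto
      also have "\<dots> \<le> L * dist \<psi> \<psi>'"
        using L dist_bounded[of \<psi> \<sigma> \<psi>'] by (intro mult_left_mono) (auto simp: dist_norm)
      finally show "norm (h \<sigma> (\<psi> \<sigma>) - h \<sigma> (\<psi>' \<sigma>)) \<le> L * dist \<psi> \<psi>'" .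
    qed (use psi inte t in \<open>auto intro: integrable_diff\<close>)
    also have "\<dots> \<le> (L * dist \<psi> \<psi>') * (b - a)"
      using t L by (intro mult_left_mono) auto
    finally show "dist (F \<psi> s) (F \<psi>' s) \<le> (L * (b - a)) * dist \<psi> \<psi>'"
      by (simp add: algebra_simps)
  qed
  ultimately obtain \<psi> where psi: "\<psi> \<in> X" "F \<psi> = \<psi>"
    using Banach_fix[of X "L * (b - a)" F] L ab \<open>X \<noteq> {}\<close> by auto
  have eq: "integral {a..t} (\<lambda>s. h s (\<psi> s)) = \<psi> t - x0" if "t \<in> {a..b}" for t
  proof -
    have "clamp a b t = t" using that ab clamp_cancel_cbox[of t a b] by simp
    then show ?thesis using F[OF psi(1), of t] psi(2) by (simp add: N_def)
  qed
  show ?thesis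
  proof (intro exI[of _ "apply_bcontfun \<psi>"] conjI)
    show "\<psi> a = x0" using eq[of a] ab by simp
    moreover have "(\<lambda>s. h s (\<psi> s)) absolutely_integrable_on {a..b}"
      using X psi(1) by (intro int) auto
    ultimately show "integral_curve (\<lambda>s. h s (\<psi> s)) a b \<psi>"
      using eq by (simp add: integral_curve_def)
  qed
qed

section \<open>Locally Lipschitz maps\<close>

lemma locally_lipschitz_on_imp_continuous_on:
  assumes "locally_lipschitz_on S h"
  shows "continuous_on S h"
  unfolding continuous_on_eq_continuous_within
proof
  fix x assume x: "x \<in> S"
  then obtain e L where e: "e > 0" and L: "L-lipschitz_on (cball x e \<inter> S) h"
    using assms unfolding locally_lipschitz_on_def by blast
  have "continuous (at x within cball x e \<inter> S) h"
    using lipschitz_on_continuous_within[OF L] x e by auto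
  moreover have "at x within cball x e \<inter> S = at x within S"
    using e by (intro at_within_nhd[of x "ball x e"]) auto
  ultimately show "continuous (at x within S) h" by simp
qed

text \<open>The set need not be convex, so local constants cannot be chained along segments.
  Instead, pairs with slope above n are at distance at most \<open>C / n\<close>, because h is
  bounded on the compact set. Along a subsequence both points approach the same limit, where a local
  constant L applies; this is absurd once n exceeds L.\<close>

lemma locally_lipschitz_on_compact:
  fixes h :: "'a::metric_space \<Rightarrow> 'b::metric_space"
  assumes h: "locally_lipschitz_on S h" and T: "compact T" "T \<subseteq> S"
  shows "\<exists>L. L-lipschitz_on T h"
proof (rule ccontr)
  assume no: "\<not> ?thesis"
  have "\<exists>x\<in>T. \<exists>y\<in>T. real n * dist x y < dist (h x) (h y)" for n
    using no unfolding lipschitz_on_def by (meson not_le of_nat_0_le_iff)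
  then obtain x y where xy: "\<And>n. x n \<in> T" "\<And>n. y n \<in> T"
      "\<And>n. real n * dist (x n) (y n) < dist (h (x n)) (h (y n))"
    by metis
  have "continuous_on T h"
    using locally_lipschitz_on_imp_continuous_on[OF h] T(2) by (rule continuous_on_subset)
  then have "bounded (h ` T)" using T(1) by (simp add: compact_continuous_image compact_imp_bounded)
  then obtain C where C: "\<And>u v. u \<in> T \<Longrightarrow> v \<in> T \<Longrightarrow> dist (h u) (h v) \<le> C"
    using bounded_two_points[of "h ` T"] by auto
  obtain l \<sigma> where l: "l \<in> T" and \<sigma>: "strict_mono (\<sigma> :: nat \<Rightarrow> nat)" and lim: "(x \<circ> \<sigma>) \<longlonglongrightarrow> l"
    using T(1) xy(1) unfolding compact_def by meson
  obtain e L where e: "e > 0" and L: "L-lipschitz_on (cball l e \<inter> S) h"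
    using h l T(2) unfolding locally_lipschitz_on_def by blast
  have \<sigma>n: "n \<le> \<sigma> n" for n using \<sigma> by (rule seq_suble)
  have d: "dist (x (\<sigma> n)) (y (\<sigma> n)) \<le> C / real n" if "n > 0" for n
  proof -
    have "real n * dist (x (\<sigma> n)) (y (\<sigma> n)) \<le> real (\<sigma> n) * dist (x (\<sigma> n)) (y (\<sigma> n))"
      using \<sigma>n[of n] by (intro mult_right_mono) auto
    also have "\<dots> \<le> C" using xy C order_less_imp_le order_trans by meson
    finally show ?thesis using that by (simp add: field_simps)
  qed
  have "\<forall>\<^sub>F n in sequentially. dist (x (\<sigma> n)) l < e / 2"
    using lim e tendstoD[of "x \<circ> \<sigma>" l sequentially "e / 2"] by simp
  moreover have "(\<lambda>n. C / real n) \<longlonglongrightarrow> 0" by (rule lim_const_over_n)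
  then have "\<forall>\<^sub>F n in sequentially. C / real n < e / 2"
    using e by (intro order_tendstoD(2)) auto
  moreover have "\<forall>\<^sub>F n in sequentially. n > nat \<lceil>L\<rceil>"
    by (rule eventually_gt_at_top)
  ultimately have "\<forall>\<^sub>F n in sequentially. False"
  proof eventually_elim
    case (elim n)
    have n: "n > 0" "L \<le> real n" using elim(3) by linarith+
    have "dist (y (\<sigma> n)) l \<le> dist (x (\<sigma> n)) (y (\<sigma> n)) + dist (x (\<sigma> n)) l"
      by (metis dist_commute dist_triangle)
    then have "dist (x (\<sigma> n)) l \<le> e" "dist (y (\<sigma> n)) l \<le> e"
      using elim(1,2) d[OF n(1)] e by linarith+
    then have "dist (h (x (\<sigma> n))) (h (y (\<sigma> n))) \<le> L * dist (x (\<sigma> n)) (y (\<sigma> n))"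
      using xy T(2) by (intro lipschitz_onD[OF L]) (auto simp: dist_commute)
    also have "\<dots> \<le> real (\<sigma> n) * dist (x (\<sigma> n)) (y (\<sigma> n))"
      using n(2) \<sigma>n[of n] by (intro mult_right_mono) auto
    finally show False using xy(3)[of "\<sigma> n"] by simp
  qed
  then show False by simp
qed

lemma locally_bounded_compact:
  fixes h :: "'a::metric_space \<Rightarrow> 'b::metric_space"
  assumes h: "locally_bounded h" and T: "compact T"
  shows "bounded (h ` T)"
proof -
  obtain e where e: "\<And>x. e x > 0" "\<And>x. bounded (h ` ball x (e x))"
    using h unfolding locally_bounded_def by metis
  have "T \<subseteq> (\<Union>x\<in>T. ball x (e x))" using e(1) by force
  then obtain F where F: "F \<subseteq> T" "finite F" "T \<subseteq> (\<Union>x\<in>F. ball x (e x))"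
    using compactE_image[of T T "\<lambda>x. ball x (e x)"] T by blast
  have "bounded (\<Union>x\<in>F. h ` ball x (e x))" using F e by auto
  moreover have "h ` T \<subseteq> (\<Union>x\<in>F. h ` ball x (e x))" using F(3) by blast
  ultimately show ?thesis by (rule bounded_subset)
qed

section \<open>Sampling times\<close>

lemma sample_time_less_Suc: "\<rho> > 0 \<Longrightarrow> sample_time \<rho> w i < sample_time \<rho> w (Suc i)"
  by simp

lemma sample_time_mono: "\<rho> > 0 \<Longrightarrow> i \<le> j \<Longrightarrow> sample_time \<rho> w i \<le> sample_time \<rho> w j"
  by (rule lift_Suc_mono_le[of "sample_time \<rho> w"]) auto

lemma sample_time_nonneg: "\<rho> > 0 \<Longrightarrow> 0 \<le> sample_time \<rho> w i"
  using sample_time_mono[of \<rho> 0 i w] by simp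

lemma sample_time_step_le:
  assumes "\<rho> > 0" "\<And>t. t \<ge> 0 \<Longrightarrow> w t \<ge> 0"
  shows "sample_time \<rho> w (Suc i) - sample_time \<rho> w i \<le> \<rho>"
  using assms sample_time_nonneg[of \<rho> w i] by simp

lemma horizon_sample_intervalE:
  assumes \<rho>: "\<rho> > 0" and t: "0 \<le> t" "ereal t < horizon \<rho> w"
  obtains i where "sample_time \<rho> w i \<le> t" "t < sample_time \<rho> w (Suc i)"
proof -
  have ex: "\<exists>j. t < sample_time \<rho> w j"
    using t(2) by (auto simp: horizon_def less_SUP_iff)
  define j where "j = (LEAST j. t < sample_time \<rho> w j)"
  have j: "t < sample_time \<rho> w j" unfolding j_def using ex by (rule LeastI_ex)
  then obtain i where i: "j = Suc i" using t by (cases j) auto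
  have "\<not> t < sample_time \<rho> w i"
    using not_less_Least[of i "\<lambda>j. t < sample_time \<rho> w j"] i unfolding j_def by simp
  then show ?thesis using that[of i] j i by auto
qed

lemma sample_time_less_horizon:
  assumes \<rho>: "\<rho> > 0"
  shows "ereal (sample_time \<rho> w i) < horizon \<rho> w"
proof -
  have "ereal (sample_time \<rho> w i) < ereal (sample_time \<rho> w (Suc i))" using \<rho> by simp
  also have "\<dots> \<le> horizon \<rho> w" unfolding horizon_def by (rule SUP_upper) simp
  finally show ?thesis .
qed

lemma sample_time_rescale:
  assumes "0 < \<rho>'" "0 < \<rho>"
  shows "sample_time \<rho> (\<lambda>t. w t + ln (\<rho> / \<rho>')) i = sample_time \<rho>' w i"
proof (induction i)
  case (Suc i)
  have "\<rho> * exp (- (x + ln (\<rho> / \<rho>'))) = \<rho>' * exp (- x)" for x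
    using assms by (simp add: exp_diff exp_minus exp_add field_simps)
  with Suc show ?case by simp
qed simp

lemma horizon_rescale:
  assumes "0 < \<rho>'" "0 < \<rho>"
  shows "horizon \<rho> (\<lambda>t. w t + ln (\<rho> / \<rho>')) = horizon \<rho>' w"
  unfolding horizon_def by (simp add: sample_time_rescale[OF assms])

lemma Linf_loc_add_const:
  assumes w: "w \<in> Linf_loc {0..}" and c: "(c::real) \<ge> 0"
  shows "(\<lambda>t. w t + c) \<in> Linf_loc {0..}"
proof -
  have "\<exists>B. AE t in lebesgue_on {0..T}. norm (w t + c) \<le> B" for T
  proof -
    obtain B where "AE t in lebesgue_on {0..T}. norm (w t) \<le> B"
      using w by (auto simp: Linf_loc_def)
    then have "AE t in lebesgue_on {0..T}. norm (w t + c) \<le> B + c"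
      by eventually_elim (use c in auto)
    then show ?thesis by blast
  qed
  then show ?thesis using w c by (auto simp: Linf_loc_def)
qed

lemma solution_on_integral_curve:
  assumes "solution_on F \<rho> \<xi>0 d w T \<xi>" "sample_time \<rho> w i \<le> t" "t \<le> sample_time \<rho> w (Suc i)" "ereal t < T"
  shows "integral_curve (\<lambda>s. F (d s) (\<xi> s) (\<xi> (sample_time \<rho> w i))) (sample_time \<rho> w i) t \<xi>"
proof -
  let ?G = "\<lambda>s. F (d s) (\<xi> s) (\<xi> (sample_time \<rho> w i))"
  have *: "?G absolutely_integrable_on {sample_time \<rho> w i..t'} \<and>
      \<xi> t' = \<xi> (sample_time \<rho> w i) + integral {sample_time \<rho> w i..t'} ?G"
    if "sample_time \<rho> w i \<le> t'" "t' \<le> t" for t'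
  proof -
    have "ereal t' < T" using that assms(4) by (meson ereal_less_eq(3) le_less_trans)
    then show ?thesis using assms(1,3) that unfolding solution_on_def by fastforce
  qed
  have "integral {sample_time \<rho> w i..t'} ?G = \<xi> t' - \<xi> (sample_time \<rho> w i)"
    if "t' \<in> {sample_time \<rho> w i..t}" for t'
    using that *[of t'] by (metis add_diff_cancel_left' atLeastAtMost_iff)
  then show ?thesis
    using *[of t] assms(2) by (simp add: integral_curve_def)
qed

lemma solution_onI:
  assumes "T \<le> horizon \<rho> w" "\<xi> 0 = \<xi>0"
    and "\<And>i t. sample_time \<rho> w i \<le> t \<Longrightarrow> t \<le> sample_time \<rho> w (Suc i) \<Longrightarrow> ereal t < T \<Longrightarrow>
      integral_curve (\<lambda>s. F (d s) (\<xi> s) (\<xi> (sample_time \<rho> w i))) (sample_time \<rho> w i) t \<xi>"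
  shows "solution_on F \<rho> \<xi>0 d w T \<xi>"
  unfolding solution_on_def
proof (intro conjI allI impI; (elim conjE)?)
  fix i t assume t: "sample_time \<rho> w i \<le> t" "t \<le> sample_time \<rho> w (Suc i)" "ereal t < T"
  show "(\<lambda>s. F (d s) (\<xi> s) (\<xi> (sample_time \<rho> w i))) absolutely_integrable_on {sample_time \<rho> w i..t}"
    "\<xi> t = \<xi> (sample_time \<rho> w i) +
       integral {sample_time \<rho> w i..t} (\<lambda>s. F (d s) (\<xi> s) (\<xi> (sample_time \<rho> w i)))"
    using assms(3)[OF t] t by (auto simp: integral_curve_def)
qed (use assms in auto)

section \<open>The loop with saturated feedback\<close>

lemma abs_sat_le: "\<bar>sat s\<bar> \<le> 1"
  by (simp add: sat_def abs_div divide_le_eq max_def)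

lemma sat_eq_self: "\<bar>s\<bar> \<le> 1 \<Longrightarrow> sat s = s"
  by (simp add: sat_def max_def)

lemma sat_ge_1: "1 \<le> s \<Longrightarrow> sat s = 1"
  by (simp add: sat_def max_def)

lemma sat_le_m1: "s \<le> -1 \<Longrightarrow> sat s = -1"
  by (auto simp: sat_def max_def)

lemma ex_small_step:
  assumes "0 \<le> C" "0 < e" "0 \<le> C'" "0 < (e'::real)"
  shows "\<exists>h0>0. \<forall>h. 0 \<le> h \<and> h \<le> h0 \<longrightarrow> C * h \<le> e \<and> C' * h \<le> e'"
proof -
  \<comment> \<open>The added 1 keeps the denominators positive when C or C' is 0.\<close>
  define h0 where "h0 = min (e / (C + 1)) (e' / (C' + 1))"
  have "C * h \<le> e \<and> C' * h \<le> e'" if h: "0 \<le> h" "h \<le> h0" for h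
  proof -
    have "(C + 1) * h \<le> e" "(C' + 1) * h \<le> e'"
      using h assms by (auto simp: h0_def field_simps)
    then show ?thesis using h by (simp add: algebra_simps)
  qed
  moreover have "h0 > 0" using assms by (simp add: h0_def)
  ultimately show ?thesis by blast
qed

text \<open>Two steps combine because
  \<open>(1 + \<gamma> h) (1 + \<gamma> a) \<ge> 1 + \<gamma> (a + h)\<close> for nonnegative a and
  h. The \<open>max 0\<close> is for a clock that has not started: a negative a counts as no elapsed
  time.\<close>

lemma decay_chain:
  fixes w w' :: real
  assumes "w' * (1 + \<gamma> * h) \<le> w" "w * (1 + \<gamma> * max 0 a) \<le> C" "0 \<le> w'" "0 \<le> h" "0 \<le> \<gamma>"
  shows "w' * (1 + \<gamma> * max 0 (a + h)) \<le> C"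
proof -
  have "max 0 (a + h) \<le> h + max 0 a" using assms(4) by auto
  then have "\<gamma> * max 0 (a + h) \<le> \<gamma> * h + \<gamma> * max 0 a"
    using assms(5) mult_left_mono[of "max 0 (a + h)" "h + max 0 a" \<gamma>] by (simp add: distrib_left)
  moreover have "0 \<le> (\<gamma> * h) * (\<gamma> * max 0 a)" using assms by simp
  ultimately have "1 + \<gamma> * max 0 (a + h) \<le> (1 + \<gamma> * h) * (1 + \<gamma> * max 0 a)"
    by (simp add: distrib_left distrib_right)
  then have "w' * (1 + \<gamma> * max 0 (a + h)) \<le> w' * ((1 + \<gamma> * h) * (1 + \<gamma> * max 0 a))"
    using assms(3) by (rule mult_left_mono)
  also have "\<dots> = (w' * (1 + \<gamma> * h)) * (1 + \<gamma> * max 0 a)" by (simp add: mult.assoc)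
  also have "\<dots> \<le> w * (1 + \<gamma> * max 0 a)"
    using assms by (intro mult_right_mono) auto
  finally show ?thesis using assms(2) by linarith
qed

text \<open>\<Phi> is continuous only over D, so the argument is first shown measurable into the
  subspace and then composed. Compactness of D and of the image of the curve supplies the bound on
  the integrand.\<close>

lemma absolutely_integrable_along_curve:
  fixes D :: "'d::euclidean_space set" and x :: "real \<Rightarrow> 'a::euclidean_space"
    and \<Phi> :: "'d \<times> 'a \<times> real \<Rightarrow> 'e::euclidean_space"
  assumes D: "compact D" and \<Phi>: "continuous_on (D \<times> UNIV \<times> UNIV) \<Phi>"
    and d: "d \<in> Linf_loc D" and x: "continuous_on {a..b} x" and a: "0 \<le> a"
  shows "(\<lambda>s. \<Phi> (d s, x s, u)) absolutely_integrable_on {a..b}"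
proof -
  let ?M = "lebesgue_on {a..b}"
  let ?E = "D \<times> (UNIV :: 'a set) \<times> (UNIV :: real set)"
  have "d \<in> borel_measurable (lebesgue_on {0..})" using d by (simp add: Linf_loc_def)
  then have dm: "d \<in> borel_measurable ?M"
    by (rule measurable_restrict_mono) (use a in auto)
  have xm: "x \<in> borel_measurable ?M"
    using x by (intro continuous_imp_measurable_on_sets_lebesgue) auto
  have "(\<lambda>s. (d s, x s, u)) \<in> measurable ?M (restrict_space borel ?E)"
  proof (rule measurable_restrict_space2)
    show "(\<lambda>s. (d s, x s, u)) \<in> space ?M \<rightarrow> ?E"
      using d a by (auto simp: Linf_loc_def)
    show "(\<lambda>s. (d s, x s, u)) \<in> borel_measurable ?M"
      using dm xm by (intro borel_measurable_Pair) auto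
  qed
  moreover have "\<Phi> \<in> borel_measurable (restrict_space borel ?E)"
    using \<Phi> by (rule borel_measurable_continuous_on_restrict)
  ultimately have meas: "(\<lambda>s. \<Phi> (d s, x s, u)) \<in> borel_measurable ?M"
    by (rule measurable_compose)
  have "compact (D \<times> x ` {a..b} \<times> {u})"
    using D x by (intro compact_Times compact_continuous_image) auto
  then have "bounded (\<Phi> ` (D \<times> x ` {a..b} \<times> {u}))"
    using \<Phi> by (intro compact_imp_bounded compact_continuous_image continuous_on_subset[OF \<Phi>]) auto
  then obtain C where C: "\<And>v. v \<in> \<Phi> ` (D \<times> x ` {a..b} \<times> {u}) \<Longrightarrow> norm v \<le> C"
    by (auto simp: bounded_iff)
  show ?thesis
  proof (rule measurable_bounded_by_integrable_imp_absolutely_integrable[OF meas])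
    show "norm (\<Phi> (d s, x s, u)) \<le> C" if "s \<in> {a..b}" for s
      using that d a by (intro C imageI) (auto simp: Linf_loc_def)
  qed auto
qed

text \<open>The field \<open>\<Phi> (d, x, u)\<close> is the derivative of the state \<open>(x, y)\<close>; it does not depend on
  \<open>y\<close>. The number \<open>\<beta>\<close> stands for \<open>c'b\<close>. The left-hand side of \<open>drift_bound\<close> is
  \<open>\<bar>g + c'f\<bar>\<close>, because \<open>c'(A + b p')x = - x\<^sub>n\<close>.\<close>

locale saturated_loop =
  fixes D :: "'d::euclidean_space set"
    and \<Phi> :: "'d \<times> 'a::euclidean_space \<times> real \<Rightarrow> 'a \<times> real"
    and P :: "'a \<Rightarrow> 'a" and p c :: 'a and \<beta> M R K \<omega> \<delta> \<mu> \<rho> U L :: real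
  assumes D: "compact D"
    and field_continuous: "continuous_on (D \<times> UNIV \<times> UNIV) \<Phi>"
    and field_0: "d \<in> D \<Longrightarrow> \<Phi> (d, 0, 0) = 0"
    and P_linear: "bounded_linear P" and P_sym: "x \<bullet> P y = P x \<bullet> y"
    and P_pos: "x \<noteq> 0 \<Longrightarrow> x \<bullet> P x > 0"
    and pos: "M > 0" "R > 0" "K > 0" "\<omega> > 0" "\<delta> > 0" "\<mu> > 0" "L > 0"
    and norm_less: "x \<bullet> P x \<le> R\<^sup>2 \<Longrightarrow> norm x + 1 \<le> \<rho>"
    and control_bound: "norm p * \<rho> + K * \<bar>\<beta>\<bar> \<le> U"
    and field_lipschitz: "d \<in> D \<Longrightarrow> norm x \<le> \<rho> \<Longrightarrow> norm x' \<le> \<rho> \<Longrightarrow> \<bar>u\<bar> \<le> U \<Longrightarrow> \<bar>u'\<bar> \<le> U \<Longrightarrow>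
      norm (\<Phi> (d, x, u) - \<Phi> (d, x', u')) \<le> L * (norm (x - x') + \<bar>u - u'\<bar>)"
    and boundary_decrease: "d \<in> D \<Longrightarrow> x \<bullet> P x = R\<^sup>2 \<Longrightarrow> \<bar>u - p \<bullet> x\<bar> \<le> K * \<bar>\<beta>\<bar> \<Longrightarrow>
      x \<bullet> P (fst (\<Phi> (d, x, u))) \<le> - \<mu>"
    and drift_bound: "d \<in> D \<Longrightarrow> x \<bullet> P x \<le> R\<^sup>2 \<Longrightarrow> \<bar>u - p \<bullet> x\<bar> \<le> K * \<bar>\<beta>\<bar> \<Longrightarrow>
      \<bar>snd (\<Phi> (d, x, u)) + c \<bullet> fst (\<Phi> (d, x, u)) - \<beta> * (u - p \<bullet> x)\<bar> \<le> K * \<beta>\<^sup>2 - \<mu>"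
    and local_decrease: "d \<in> D \<Longrightarrow> x \<bullet> P x \<le> R\<^sup>2 \<Longrightarrow> \<omega> * \<bar>z\<bar> \<le> 1 \<Longrightarrow> u = p \<bullet> x - K * \<beta> * \<omega> * z \<Longrightarrow>
      x \<bullet> P (fst (\<Phi> (d, x, u))) + M * z * (snd (\<Phi> (d, x, u)) + c \<bullet> fst (\<Phi> (d, x, u)))
        \<le> - \<delta> * (z\<^sup>2 + x \<bullet> P x)"
begin

section \<open>Functions of the state and arcs of the saturated loop\<close>

definition V :: "'a \<times> real \<Rightarrow> real" where "V \<xi> = fst \<xi> \<bullet> P (fst \<xi>)"
definition Z :: "'a \<times> real \<Rightarrow> real" where "Z \<xi> = snd \<xi> + c \<bullet> fst \<xi>"
definition W :: "'a \<times> real \<Rightarrow> real" where "W \<xi> = V \<xi> + M * (Z \<xi>)\<^sup>2"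
definition B :: real where "B = L * (\<rho> + U)"
definition feedback :: "'a \<times> real \<Rightarrow> real"
  where "feedback \<xi> = p \<bullet> fst \<xi> - K * \<beta> * sat (\<omega> * Z \<xi>)"

text \<open>The control is frozen at the left end, which is meant to be a sampling time. The right
  end is any time up to the next sample, so the estimates also apply to a solution that is followed
  only part of the way.\<close>

definition loop_arc :: "(real \<Rightarrow> 'd) \<Rightarrow> real \<Rightarrow> real \<Rightarrow> (real \<Rightarrow> 'a \<times> real) \<Rightarrow> bool"
  where "loop_arc d a b \<xi> \<longleftrightarrow> (\<forall>s\<in>{a..b}. d s \<in> D) \<and> V (\<xi> a) < R\<^sup>2 \<and>
    integral_curve (\<lambda>s. \<Phi> (d s, fst (\<xi> s), feedback (\<xi> a))) a b \<xi>"

sublocale P: bounded_linear P by (rule P_linear)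

lemma Z_linear: "bounded_linear Z"
  unfolding Z_def
  by (intro bounded_linear_add bounded_linear_snd bounded_linear_compose[OF bounded_linear_inner_right bounded_linear_fst])

lemma Z_diff: "Z (x - y) = Z x - Z y"
  by (simp add: Z_def inner_diff_right)

lemma abs_Z_le: "\<bar>Z \<xi>\<bar> \<le> (1 + norm c) * norm \<xi>"
proof -
  have "\<bar>Z \<xi>\<bar> \<le> \<bar>snd \<xi>\<bar> + \<bar>c \<bullet> fst \<xi>\<bar>" by (simp add: Z_def)
  also have "\<dots> \<le> norm \<xi> + norm c * norm \<xi>"
    using norm_snd_le[of "snd \<xi>" "fst \<xi>"] norm_fst_le[of "fst \<xi>" "snd \<xi>"]
      Cauchy_Schwarz_ineq2[of c "fst \<xi>"]
      mult_left_mono[of "norm (fst \<xi>)" "norm \<xi>" "norm c"]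
    by (intro add_mono) auto
  finally show ?thesis by (simp add: algebra_simps)
qed

lemma V_nonneg: "0 \<le> V \<xi>"
  using P_pos[of "fst \<xi>"] by (cases "fst \<xi> = 0") (auto simp: V_def P.zero)

lemma W_nonneg: "0 \<le> W \<xi>"
  using V_nonneg pos by (simp add: W_def)

lemma \<rho>_ge_1: "1 \<le> \<rho>"
  using norm_less[of 0] by (simp add: P.zero)

lemma norm_fst_le_\<rho>: "V \<xi> \<le> R\<^sup>2 \<Longrightarrow> norm (fst \<xi>) \<le> \<rho>"
  using norm_less[of "fst \<xi>"] by (simp add: V_def)

lemma abs_inner_p_le: "norm x \<le> \<rho> \<Longrightarrow> \<bar>p \<bullet> x\<bar> \<le> norm p * \<rho>"
  using Cauchy_Schwarz_ineq2[of p x] mult_left_mono[of "norm x" \<rho> "norm p"] by simp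

lemma control_le_U:
  assumes "norm x \<le> \<rho>" "\<bar>s\<bar> \<le> 1"
  shows "\<bar>p \<bullet> x - K * \<beta> * s\<bar> \<le> U"
proof -
  have "\<bar>K * \<beta> * s\<bar> \<le> K * \<bar>\<beta>\<bar> * 1"
    unfolding abs_mult using assms(2) pos by (intro mult_mono) auto
  then show ?thesis using abs_inner_p_le[OF assms(1)] control_bound by linarith
qed

lemma feedback_le_U: "V \<xi> \<le> R\<^sup>2 \<Longrightarrow> \<bar>feedback \<xi>\<bar> \<le> U"
  unfolding feedback_def using control_le_U norm_fst_le_\<rho> abs_sat_le by blast

lemma U_nonneg: "0 \<le> U"
  using control_le_U[of 0 0] \<rho>_ge_1 by simp

lemma B_pos: "B > 0"
  using pos \<rho>_ge_1 U_nonneg by (simp add: B_def)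

lemma norm_field_le_linear:
  assumes "d \<in> D" "norm x \<le> \<rho>" "\<bar>u\<bar> \<le> U"
  shows "norm (\<Phi> (d, x, u)) \<le> L * (norm x + \<bar>u\<bar>)"
  using field_lipschitz[of d x 0 u 0] assms \<rho>_ge_1 U_nonneg by (simp add: field_0)

lemma norm_field_le:
  assumes "d \<in> D" "norm x \<le> \<rho>" "\<bar>u\<bar> \<le> U"
  shows "norm (\<Phi> (d, x, u)) \<le> B"
proof -
  have "L * (norm x + \<bar>u\<bar>) \<le> B"
    unfolding B_def using assms pos by (intro mult_left_mono) auto
  then show ?thesis using norm_field_le_linear[OF assms] by linarith
qed

text \<open>V as a symmetric quadratic form on the product space, the shape demanded by
  \<open>integral_curve_quadratic_form_le\<close>.\<close>

lemma quadratic_V: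
  "bounded_linear (\<lambda>\<xi>. (P (fst \<xi>), 0::real))"
  "x \<bullet> (P (fst y), 0) = (P (fst x), 0::real) \<bullet> y"
  "V \<xi> = \<xi> \<bullet> (P (fst \<xi>), 0)"
  by (auto simp: V_def inner_prod_def P_sym
      intro!: bounded_linear_Pair bounded_linear_compose[OF P_linear] bounded_linear_fst)

text \<open>Z is the inner product with \<open>(c, 1)\<close>, so its square is a rank-one
  form.\<close>

lemma quadratic_Z:
  "bounded_linear (\<lambda>\<xi>. Z \<xi> *\<^sub>R (c, 1::real))"
  "x \<bullet> (Z y *\<^sub>R (c, 1)) = (Z x *\<^sub>R (c, 1)) \<bullet> y"
  "x \<bullet> (Z y *\<^sub>R (c, 1)) = Z x * Z y"
  using bounded_linear_scaleR_const[OF Z_linear, of "(c, 1::real)"]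
  by (auto simp: inner_prod_def Z_def inner_commute algebra_simps)

text \<open>On the sublevel set the field is bounded by B. The sublevel condition is assumed only up
  to t, so that these bounds are available at a first hit of the boundary, when invariance is not
  yet known.\<close>

lemma loop_arc_dist:
  assumes arc: "loop_arc d a b \<xi>" and st: "a \<le> s" "s \<le> t" "t \<le> b"
    and V: "\<And>\<sigma>. a \<le> \<sigma> \<Longrightarrow> \<sigma> \<le> t \<Longrightarrow> V (\<xi> \<sigma>) \<le> R\<^sup>2"
  shows "norm (\<xi> t - \<xi> s) \<le> B * (b - a)" "norm (fst (\<xi> t) - fst (\<xi> s)) \<le> B * (b - a)"
    "\<bar>Z (\<xi> t) - Z (\<xi> s)\<bar> \<le> (1 + norm c) * B * (b - a)"
    "\<And>\<sigma>. a \<le> \<sigma> \<Longrightarrow> \<sigma> \<le> t \<Longrightarrow> norm (\<Phi> (d \<sigma>, fst (\<xi> \<sigma>), feedback (\<xi> a))) \<le> B"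
proof -
  show bound: "norm (\<Phi> (d \<sigma>, fst (\<xi> \<sigma>), feedback (\<xi> a))) \<le> B" if "a \<le> \<sigma>" "\<sigma> \<le> t" for \<sigma>
    using that V arc st by (intro norm_field_le norm_fst_le_\<rho> feedback_le_U) (auto simp: loop_arc_def)
  have "norm (\<xi> t - \<xi> s) \<le> B * (t - s)"
    using arc st bound unfolding loop_arc_def by (intro integral_curve_dist_le) auto
  also have "\<dots> \<le> B * (b - a)" using st B_pos by (intro mult_left_mono) auto
  finally show 1: "norm (\<xi> t - \<xi> s) \<le> B * (b - a)" .
  show "norm (fst (\<xi> t) - fst (\<xi> s)) \<le> B * (b - a)"
    using 1 unfolding fst_diff[symmetric] by (metis norm_fst_le order_trans prod.collapse)
  have "(1 + norm c) * norm (\<xi> t - \<xi> s) \<le> (1 + norm c) * (B * (b - a))"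
    using 1 by (intro mult_left_mono) (auto intro: add_nonneg_nonneg)
  then show "\<bar>Z (\<xi> t) - Z (\<xi> s)\<bar> \<le> (1 + norm c) * B * (b - a)"
    using abs_Z_le[of "\<xi> t - \<xi> s"] by (simp add: Z_diff mult.assoc)
qed

text \<open>The first condition speaks about boundary points only. If an arc reaches the boundary at
  t1, all of it up to t1 lies within \<open>B h\<close> of that boundary point, so the inequality
  holds along it up to an error \<open>C h \<le> \<mu>\<close>. Hence V cannot have grown on the way
  to t1.\<close>

lemma sublevel_invariant:
  "\<exists>h0>0. \<forall>d a b \<xi>. loop_arc d a b \<xi> \<and> b - a \<le> h0 \<longrightarrow> (\<forall>t\<in>{a..b}. V (\<xi> t) < R\<^sup>2)"
proof -
  obtain KP where KP: "KP > 0" "\<And>x. norm (P x) \<le> norm x * KP" using P.pos_bounded by blast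
  \<comment> \<open>The first summand is the cost of replacing x(s) by x(t1) as the left factor of
    the form, the second the cost of replacing the field at s by the one at t1.\<close>
  define C where "C = B * KP * B + \<rho> * KP * L * (B + norm p * B)"
  have "0 \<le> C" using B_pos KP pos \<rho>_ge_1 by (auto simp: C_def intro!: add_nonneg_nonneg mult_nonneg_nonneg)
  then obtain h0 where h0: "h0 > 0" "\<And>h. 0 \<le> h \<Longrightarrow> h \<le> h0 \<Longrightarrow> C * h \<le> \<mu>"
    using ex_small_step[of C \<mu> 0 1] pos by auto
  have "V (\<xi> t) < R\<^sup>2" if arc: "loop_arc d a b \<xi>" and h: "b - a \<le> h0" and t: "t \<in> {a..b}" for d a b \<xi> t
  proof (rule less_if_no_first_hit[where q = "\<lambda>t. V (\<xi> t)" and a = a and b = b])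
    have curve: "integral_curve (\<lambda>s. \<Phi> (d s, fst (\<xi> s), feedback (\<xi> a))) a b \<xi>"
      using arc by (simp add: loop_arc_def)
    show "continuous_on {a..b} (\<lambda>t. V (\<xi> t))"
      unfolding V_def using integral_curve_continuous[OF curve] by (intro continuous_intros P.continuous_on)
    show "V (\<xi> a) < R\<^sup>2" using arc by (simp add: loop_arc_def)
    fix t1 assume t1: "a \<le> t1" "t1 \<le> b" "V (\<xi> t1) = R\<^sup>2" and le: "\<And>s. a \<le> s \<Longrightarrow> s \<le> t1 \<Longrightarrow> V (\<xi> s) \<le> R\<^sup>2"
    define h where "h = b - a"
    have hh: "0 \<le> h" "h \<le> h0" using t h by (auto simp: h_def)
    have dist: "norm (fst (\<xi> t1) - fst (\<xi> s)) \<le> B * h" if "a \<le> s" "s \<le> t1" for s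
      unfolding h_def using that t1 le by (intro loop_arc_dist[OF arc]) auto
    have decr: "2 * (\<xi> s \<bullet> (P (fst (\<Phi> (d s, fst (\<xi> s), feedback (\<xi> a)))), 0)) \<le> 0" if s: "s \<in> {a..t1}" for s
    proof -
      \<comment> \<open>The comparison control u' takes \<open>p'x\<close> at t1 but keeps the
        saturation sampled at a. It is therefore admissible in the first condition, and
        \<open>u - u'\<close> involves only the displacement of x.\<close>
      define u u' where "u = feedback (\<xi> a)" and "u' = p \<bullet> fst (\<xi> t1) - K * \<beta> * sat (\<omega> * Z (\<xi> a))"
      define F F' where "F = fst (\<Phi> (d s, fst (\<xi> s), u))" and "F' = fst (\<Phi> (d s, fst (\<xi> t1), u'))"
      have ds: "d s \<in> D" using arc s t1 by (auto simp: loop_arc_def)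
      have nx: "norm (fst (\<xi> s)) \<le> \<rho>" "norm (fst (\<xi> t1)) \<le> \<rho>"
        using norm_fst_le_\<rho> le s by auto
      have U: "\<bar>u\<bar> \<le> U" "\<bar>u'\<bar> \<le> U"
        using feedback_le_U le[of a] t1 control_le_U nx abs_sat_le by (auto simp: u_def u'_def)
      have "\<bar>u' - p \<bullet> fst (\<xi> t1)\<bar> \<le> K * \<bar>\<beta>\<bar>"
        using abs_sat_le[of "\<omega> * Z (\<xi> a)"] pos mult_left_mono[of "\<bar>sat (\<omega> * Z (\<xi> a))\<bar>" 1 "K * \<bar>\<beta>\<bar>"]
        by (simp add: u'_def abs_mult)
      then have main: "fst (\<xi> t1) \<bullet> P F' \<le> - \<mu>"
        unfolding F'_def using ds t1(3) by (intro boundary_decrease) (auto simp: V_def)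
      have "u - u' = p \<bullet> (fst (\<xi> a) - fst (\<xi> t1))"
        by (simp add: u_def u'_def feedback_def inner_diff_right)
      then have "\<bar>u - u'\<bar> \<le> norm p * norm (fst (\<xi> a) - fst (\<xi> t1))"
        by (simp add: Cauchy_Schwarz_ineq2)
      also have "\<dots> \<le> norm p * (B * h)"
        using dist[of a] t1 by (intro mult_left_mono) (auto simp: norm_minus_commute)
      finally have uu: "\<bar>u - u'\<bar> \<le> norm p * (B * h)" .
      have "norm (F - F') \<le> norm (\<Phi> (d s, fst (\<xi> s), u) - \<Phi> (d s, fst (\<xi> t1), u'))"
        unfolding F_def F'_def fst_diff[symmetric] by (metis norm_fst_le prod.collapse)
      also have "\<dots> \<le> L * (norm (fst (\<xi> s) - fst (\<xi> t1)) + \<bar>u - u'\<bar>)"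
        by (intro field_lipschitz ds nx U)
      also have "\<dots> \<le> L * (B * h + norm p * (B * h))"
        using uu dist[of s] s pos by (intro mult_left_mono add_mono) (auto simp: norm_minus_commute)
      finally have FF: "norm (F - F') \<le> L * (B * h + norm p * (B * h))" .
      have "norm F \<le> norm (\<Phi> (d s, fst (\<xi> s), u))"
        unfolding F_def by (metis norm_fst_le prod.collapse)
      then have F: "norm F \<le> B" using norm_field_le[OF ds nx(1) U(1)] by linarith
      have "(fst (\<xi> s) - fst (\<xi> t1)) \<bullet> P F \<le> norm (fst (\<xi> s) - fst (\<xi> t1)) * norm (P F)"
        by (rule norm_cauchy_schwarz)
      also have "\<dots> \<le> (B * h) * (B * KP)"
        using dist[of s] s KP(1) F order_trans[OF KP(2)[of F] mult_right_mono[OF F]] B_pos hh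
        by (intro mult_mono) (auto simp: norm_minus_commute)
      finally have 1: "(fst (\<xi> s) - fst (\<xi> t1)) \<bullet> P F \<le> (B * h) * (B * KP)" .
      have "fst (\<xi> t1) \<bullet> P (F - F') \<le> norm (fst (\<xi> t1)) * norm (P (F - F'))"
        by (rule norm_cauchy_schwarz)
      also have "\<dots> \<le> \<rho> * (L * (B * h + norm p * (B * h)) * KP)"
        using nx KP(1) FF order_trans[OF KP(2)[of "F - F'"] mult_right_mono[OF FF]] \<rho>_ge_1
        by (intro mult_mono) auto
      finally have 2: "fst (\<xi> t1) \<bullet> P (F - F') \<le> \<rho> * (L * (B * h + norm p * (B * h)) * KP)" .
      have "fst (\<xi> s) \<bullet> P F = fst (\<xi> t1) \<bullet> P F' + (fst (\<xi> s) - fst (\<xi> t1)) \<bullet> P F + fst (\<xi> t1) \<bullet> P (F - F')"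
        by (simp add: P.diff inner_diff_left inner_diff_right)
      also have "\<dots> \<le> - \<mu> + C * h"
        using main 1 2 by (simp add: C_def algebra_simps)
      also have "\<dots> \<le> 0" using h0(2)[OF hh] by simp
      finally show ?thesis by (simp add: F_def u_def inner_prod_def)
    qed
    have "V (\<xi> t1) - V (\<xi> a) \<le> 0 * (t1 - a)"
      unfolding quadratic_V(3)
    proof (rule integral_curve_quadratic_form_le[OF curve _ _ _ _ quadratic_V(1)])
      show "norm (\<Phi> (d \<sigma>, fst (\<xi> \<sigma>), feedback (\<xi> a))) \<le> B" if "\<sigma> \<in> {a..t1}" for \<sigma>
        using that t1 le by (intro loop_arc_dist(4)[OF arc]) auto
      show "2 * (\<xi> \<sigma> \<bullet> (P (fst (\<Phi> (d \<sigma>, fst (\<xi> \<sigma>), feedback (\<xi> a)))), 0)) \<le> 0" if "\<sigma> \<in> {a..t1}" for \<sigma>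
        using decr that by simp
    qed (use t1 quadratic_V(2) in auto)
    then show False using t1 arc by (simp add: loop_arc_def)
  qed (use t in auto)
  then show ?thesis using h0(1) by blast
qed

text \<open>For \<open>u' = p'x - K \<beta> s\<close> the feedback contributes exactly
  \<open>- K \<beta>^2 s\<close> to the derivative of Z, and \<open>drift_bound\<close> controls the
  rest. A control error e costs at most its Lipschitz effect. In the applications s is the sampled
  saturation.\<close>

lemma Z_derivative_bound:
  assumes d: "d \<in> D" and x: "x \<bullet> P x \<le> R\<^sup>2" and s: "\<bar>s\<bar> \<le> 1" and u: "\<bar>u\<bar> \<le> U"
    and e: "\<bar>u - (p \<bullet> x - K * \<beta> * s)\<bar> \<le> e"
  shows "\<bar>Z (\<Phi> (d, x, u)) + K * \<beta>\<^sup>2 * s\<bar> \<le> K * \<beta>\<^sup>2 - \<mu> + (1 + norm c) * L * e"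
proof -
  define u' where "u' = p \<bullet> x - K * \<beta> * s"
  have nx: "norm x \<le> \<rho>" using norm_less[OF x] by simp
  have u': "\<bar>u'\<bar> \<le> U" unfolding u'_def by (rule control_le_U[OF nx s])
  have "\<bar>u' - p \<bullet> x\<bar> \<le> K * \<bar>\<beta>\<bar>"
    using s pos mult_left_mono[of "\<bar>s\<bar>" 1 "K * \<bar>\<beta>\<bar>"] by (simp add: u'_def abs_mult)
  from drift_bound[OF d x this]
  have 1: "\<bar>Z (\<Phi> (d, x, u')) + K * \<beta>\<^sup>2 * s\<bar> \<le> K * \<beta>\<^sup>2 - \<mu>"
    by (simp add: Z_def u'_def power2_eq_square algebra_simps)
  have "\<bar>Z (\<Phi> (d, x, u)) - Z (\<Phi> (d, x, u'))\<bar> \<le> (1 + norm c) * norm (\<Phi> (d, x, u) - \<Phi> (d, x, u'))"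
    using abs_Z_le[of "\<Phi> (d, x, u) - \<Phi> (d, x, u')"] by (simp add: Z_diff)
  also have "\<dots> \<le> (1 + norm c) * (L * (norm (x - x) + \<bar>u - u'\<bar>))"
    by (intro mult_left_mono field_lipschitz d nx u u') (auto intro: add_nonneg_nonneg)
  also have "\<dots> \<le> (1 + norm c) * (L * e)"
    using e pos by (intro mult_left_mono) (auto simp: u'_def intro: add_nonneg_nonneg)
  finally show ?thesis using 1 by (simp add: mult.assoc)
qed

text \<open>Both sides contain the same sampled saturation, which cancels; the error is
  \<open>p'\<close> applied to the displacement of x.\<close>

lemma loop_arc_control_error:
  assumes arc: "loop_arc d a b \<xi>" and V: "\<And>\<sigma>. a \<le> \<sigma> \<Longrightarrow> \<sigma> \<le> t \<Longrightarrow> V (\<xi> \<sigma>) \<le> R\<^sup>2"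
    and t: "a \<le> t" "t \<le> b"
  shows "\<bar>feedback (\<xi> a) - (p \<bullet> fst (\<xi> t) - K * \<beta> * sat (\<omega> * Z (\<xi> a)))\<bar> \<le> norm p * (B * (b - a))"
proof -
  have "\<bar>feedback (\<xi> a) - (p \<bullet> fst (\<xi> t) - K * \<beta> * sat (\<omega> * Z (\<xi> a)))\<bar> = \<bar>p \<bullet> (fst (\<xi> t) - fst (\<xi> a))\<bar>"
    by (simp add: feedback_def inner_diff_right)
  also have "\<dots> \<le> norm p * norm (fst (\<xi> t) - fst (\<xi> a))" by (rule Cauchy_Schwarz_ineq2)
  also have "\<dots> \<le> norm p * (B * (b - a))"
    using loop_arc_dist(2)[OF arc _ t V] by (intro mult_left_mono) auto
  finally show ?thesis .
qed

lemma Z_square_bound: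
  assumes arc: "loop_arc d a b \<xi>" and V: "\<And>\<sigma>. a \<le> \<sigma> \<Longrightarrow> \<sigma> \<le> t \<Longrightarrow> V (\<xi> \<sigma>) \<le> R\<^sup>2"
    and t: "a \<le> t" "t \<le> b"
    and m: "\<And>\<sigma>. a \<le> \<sigma> \<Longrightarrow> \<sigma> \<le> t \<Longrightarrow> 2 * (Z (\<xi> \<sigma>) * Z (\<Phi> (d \<sigma>, fst (\<xi> \<sigma>), feedback (\<xi> a)))) \<le> m"
  shows "(Z (\<xi> t))\<^sup>2 - (Z (\<xi> a))\<^sup>2 \<le> m * (t - a)"
proof -
  have curve: "integral_curve (\<lambda>s. \<Phi> (d s, fst (\<xi> s), feedback (\<xi> a))) a b \<xi>"
    using arc by (simp add: loop_arc_def)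
  have "\<xi> t \<bullet> (Z (\<xi> t) *\<^sub>R (c, 1)) - \<xi> a \<bullet> (Z (\<xi> a) *\<^sub>R (c, 1)) \<le> m * (t - a)"
  proof (rule integral_curve_quadratic_form_le[OF curve _ _ _ _ quadratic_Z(1)])
    show "norm (\<Phi> (d \<sigma>, fst (\<xi> \<sigma>), feedback (\<xi> a))) \<le> B" if "\<sigma> \<in> {a..t}" for \<sigma>
      using that t V by (intro loop_arc_dist(4)[OF arc]) auto
    show "2 * (\<xi> \<sigma> \<bullet> (Z (\<Phi> (d \<sigma>, fst (\<xi> \<sigma>), feedback (\<xi> a))) *\<^sub>R (c, 1))) \<le> m"
      if "\<sigma> \<in> {a..t}" for \<sigma>
      unfolding quadratic_Z(3) using that by (intro m) auto
  qed (use t quadratic_Z(2) in auto)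
  then show ?thesis unfolding quadratic_Z(3) power2_eq_square .
qed

lemma saturated_decrease:
  "\<exists>h0>0. \<forall>d a b \<xi>. loop_arc d a b \<xi> \<and> b - a \<le> h0 \<and> (\<forall>t\<in>{a..b}. V (\<xi> t) < R\<^sup>2) \<and> \<omega> * \<bar>Z (\<xi> a)\<bar> \<ge> 1
    \<longrightarrow> (\<forall>t\<in>{a..b}. (Z (\<xi> t))\<^sup>2 \<le> (Z (\<xi> a))\<^sup>2 - \<mu> / (2 * \<omega>) * (t - a))"
proof -
  have "0 \<le> (1 + norm c) * B" "0 \<le> (1 + norm c) * L * (norm p * B)"
    using B_pos pos by (auto intro!: mult_nonneg_nonneg add_nonneg_nonneg)
  \<comment> \<open>Half of \<open>1 / \<omega>\<close> is reserved for the motion of Z during the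
    arc, half of \<mu> for the sampling error.\<close>
  then obtain h0 where h0: "h0 > 0" "\<And>h. 0 \<le> h \<Longrightarrow> h \<le> h0 \<Longrightarrow>
      (1 + norm c) * B * h \<le> 1 / (2 * \<omega>) \<and> (1 + norm c) * L * (norm p * B) * h \<le> \<mu> / 2"
    using ex_small_step[of "(1 + norm c) * B" "1 / (2 * \<omega>)" "(1 + norm c) * L * (norm p * B)" "\<mu> / 2"] pos
    by auto
  have "(Z (\<xi> t))\<^sup>2 \<le> (Z (\<xi> a))\<^sup>2 - \<mu> / (2 * \<omega>) * (t - a)"
    if arc: "loop_arc d a b \<xi>" and h: "b - a \<le> h0" and V: "\<forall>t\<in>{a..b}. V (\<xi> t) < R\<^sup>2"
      and Za: "\<omega> * \<bar>Z (\<xi> a)\<bar> \<ge> 1" and t: "t \<in> {a..b}" for d a b \<xi> t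
  proof -
    have Vle: "V (\<xi> \<sigma>) \<le> R\<^sup>2" if "a \<le> \<sigma>" "\<sigma> \<le> b" for \<sigma>
      using V that by (simp add: less_imp_le)
    have small: "(1 + norm c) * B * (b - a) \<le> 1 / (2 * \<omega>)"
      "(1 + norm c) * L * (norm p * B) * (b - a) \<le> \<mu> / 2"
      using h0(2)[of "b - a"] h t by auto
    have "(Z (\<xi> t))\<^sup>2 - (Z (\<xi> a))\<^sup>2 \<le> (- \<mu> / (2 * \<omega>)) * (t - a)"
    proof (rule Z_square_bound[OF arc])
      fix \<sigma> assume \<sigma>: "a \<le> \<sigma>" "\<sigma> \<le> t"
      then have \<sigma>b: "\<sigma> \<le> b" using t by simp
      define zd where "zd = Z (\<Phi> (d \<sigma>, fst (\<xi> \<sigma>), feedback (\<xi> a)))"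
      define s where "s = sat (\<omega> * Z (\<xi> a))"
      have "\<bar>zd + K * \<beta>\<^sup>2 * s\<bar> \<le> K * \<beta>\<^sup>2 - \<mu> + (1 + norm c) * L * (norm p * (B * (b - a)))"
        unfolding zd_def s_def using arc \<sigma> \<sigma>b Vle
        by (intro Z_derivative_bound loop_arc_control_error abs_sat_le feedback_le_U)
          (auto simp: loop_arc_def V_def)
      then have zd: "\<bar>zd + K * \<beta>\<^sup>2 * s\<bar> \<le> K * \<beta>\<^sup>2 - \<mu> / 2"
        using small(2) unfolding mult.assoc by linarith
      have zz: "\<bar>Z (\<xi> \<sigma>) - Z (\<xi> a)\<bar> \<le> 1 / (2 * \<omega>)"
        using loop_arc_dist(3)[OF arc, of a \<sigma>] \<sigma> \<sigma>b Vle small(1) by force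
      have w: "1 / (2 * \<omega>) + 1 / (2 * \<omega>) = 1 / \<omega>" using pos by (simp add: field_simps)
      have half: "0 < 1 / (2 * \<omega>)" using pos by simp
      have "Z (\<xi> \<sigma>) * zd \<le> - (1 / (2 * \<omega>) * (\<mu> / 2))"
      proof (cases "Z (\<xi> a) \<ge> 0")
        case True
        then have z: "1 / \<omega> \<le> Z (\<xi> a)" using Za pos by (simp add: field_simps)
        then have "s = 1" using pos unfolding s_def by (intro sat_ge_1) (simp add: field_simps)
        then have "zd \<le> - (\<mu> / 2)" using zd by (simp add: abs_le_iff)
        moreover have "1 / (2 * \<omega>) \<le> Z (\<xi> \<sigma>)" using zz z w by linarith
        ultimately have "1 / (2 * \<omega>) * (\<mu> / 2) \<le> Z (\<xi> \<sigma>) * (- zd)"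
          using pos half by (intro mult_mono) linarith+
        then show ?thesis by simp
      next
        case False
        then have z: "1 / \<omega> \<le> - Z (\<xi> a)" using Za pos by (simp add: field_simps)
        then have "s = - 1" using pos unfolding s_def by (intro sat_le_m1) (simp add: field_simps)
        then have "\<mu> / 2 \<le> zd" using zd by (simp add: abs_le_iff)
        moreover have "1 / (2 * \<omega>) \<le> - Z (\<xi> \<sigma>)" using zz z w by linarith
        ultimately have "1 / (2 * \<omega>) * (\<mu> / 2) \<le> (- Z (\<xi> \<sigma>)) * zd"
          using pos half by (intro mult_mono) linarith+
        then show ?thesis by simp
      qed
      then show "2 * (Z (\<xi> \<sigma>) * zd) \<le> - \<mu> / (2 * \<omega>)" by simp
    qed (use t Vle in auto)
    then show ?thesis by simp
  qed
  then show ?thesis using h0(1) by blast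
qed

lemma unsaturated_invariant:
  "\<exists>h0>0. \<forall>d a b \<xi>. loop_arc d a b \<xi> \<and> b - a \<le> h0 \<and> (\<forall>t\<in>{a..b}. V (\<xi> t) < R\<^sup>2) \<and> \<omega> * \<bar>Z (\<xi> a)\<bar> < 1
    \<longrightarrow> (\<forall>t\<in>{a..b}. \<omega> * \<bar>Z (\<xi> t)\<bar> < 1)"
proof -
  define C where "C = (1 + norm c) * L * (norm p * B) + K * \<beta>\<^sup>2 * \<omega> * ((1 + norm c) * B)"
  have "0 \<le> (1 + norm c) * B" "0 \<le> C"
    unfolding C_def using B_pos pos by (auto intro!: mult_nonneg_nonneg add_nonneg_nonneg)
  then obtain h0 where h0: "h0 > 0" "\<And>h. 0 \<le> h \<Longrightarrow> h \<le> h0 \<Longrightarrow>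
      (1 + norm c) * B * h \<le> 1 / (2 * \<omega>) \<and> C * h \<le> \<mu>"
    using ex_small_step[of "(1 + norm c) * B" "1 / (2 * \<omega>)" C \<mu>] pos by auto
  \<comment> \<open>Passing to squares lets a single first-hit argument treat both signs of
    Z.\<close>
  have iff: "\<omega> * \<bar>y\<bar> < 1 \<longleftrightarrow> y\<^sup>2 < (1 / \<omega>)\<^sup>2" for y
  proof -
    have "\<omega> * \<bar>y\<bar> < 1 \<longleftrightarrow> \<bar>y\<bar> < \<bar>1 / \<omega>\<bar>" using pos by (simp add: field_simps)
    then show ?thesis by (simp only: not_le[symmetric] abs_le_square_iff)
  qed
  have "(Z (\<xi> t))\<^sup>2 < (1 / \<omega>)\<^sup>2"
    if arc: "loop_arc d a b \<xi>" and h: "b - a \<le> h0" and V: "\<forall>t\<in>{a..b}. V (\<xi> t) < R\<^sup>2"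
      and Za: "\<omega> * \<bar>Z (\<xi> a)\<bar> < 1" and t: "t \<in> {a..b}" for d a b \<xi> t
  proof (rule less_if_no_first_hit[where q = "\<lambda>t. (Z (\<xi> t))\<^sup>2" and a = a and b = b])
    have Vle: "V (\<xi> \<sigma>) \<le> R\<^sup>2" if "a \<le> \<sigma>" "\<sigma> \<le> b" for \<sigma>
      using V that by (simp add: less_imp_le)
    have small: "(1 + norm c) * B * (b - a) \<le> 1 / (2 * \<omega>)" "C * (b - a) \<le> \<mu>"
      using h0(2)[of "b - a"] h t by auto
    have curve: "integral_curve (\<lambda>s. \<Phi> (d s, fst (\<xi> s), feedback (\<xi> a))) a b \<xi>"
      using arc by (simp add: loop_arc_def)
    show "continuous_on {a..b} (\<lambda>t. (Z (\<xi> t))\<^sup>2)"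
      using integral_curve_continuous[OF curve]
      by (intro continuous_intros bounded_linear.continuous_on[OF Z_linear])
    show Za2: "(Z (\<xi> a))\<^sup>2 < (1 / \<omega>)\<^sup>2" using Za iff by simp
    fix t1 assume t1: "a \<le> t1" "t1 \<le> b" "(Z (\<xi> t1))\<^sup>2 = (1 / \<omega>)\<^sup>2"
    have "(Z (\<xi> t1))\<^sup>2 - (Z (\<xi> a))\<^sup>2 \<le> 0 * (t1 - a)"
    proof (rule Z_square_bound[OF arc])
      fix \<sigma> assume \<sigma>: "a \<le> \<sigma>" "\<sigma> \<le> t1"
      then have \<sigma>b: "\<sigma> \<le> b" using t1 by simp
      define zd where "zd = Z (\<Phi> (d \<sigma>, fst (\<xi> \<sigma>), feedback (\<xi> a)))"
      define za where "za = Z (\<xi> a)"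
      have s: "sat (\<omega> * Z (\<xi> a)) = \<omega> * za"
        unfolding za_def using Za pos by (intro sat_eq_self) (simp add: abs_mult)
      have "\<bar>zd + K * \<beta>\<^sup>2 * sat (\<omega> * Z (\<xi> a))\<bar> \<le> K * \<beta>\<^sup>2 - \<mu> + (1 + norm c) * L * (norm p * (B * (b - a)))"
        unfolding zd_def using arc \<sigma> \<sigma>b Vle
        by (intro Z_derivative_bound loop_arc_control_error abs_sat_le feedback_le_U)
          (auto simp: loop_arc_def V_def)
      then have zd: "\<bar>zd + K * \<beta>\<^sup>2 * (\<omega> * za)\<bar> \<le> K * \<beta>\<^sup>2 - K * \<beta>\<^sup>2 * \<omega> * ((1 + norm c) * B * (b - a))"
        unfolding s using small(2) by (simp add: C_def algebra_simps)
      have z1: "\<bar>Z (\<xi> t1) - Z (\<xi> \<sigma>)\<bar> \<le> 1 / (2 * \<omega>)"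
        using loop_arc_dist(3)[OF arc, of \<sigma> t1] \<sigma> \<sigma>b t1 Vle small(1) by force
      have z2: "\<bar>Z (\<xi> t1) - za\<bar> \<le> (1 + norm c) * B * (b - a)"
        unfolding za_def using loop_arc_dist(3)[OF arc, of a t1] t1 Vle by force
      have w: "1 / (2 * \<omega>) + 1 / (2 * \<omega>) = 1 / \<omega>" using pos by (simp add: field_simps)
      have half: "0 < 1 / (2 * \<omega>)" using pos by simp
      have kb: "0 \<le> K * \<beta>\<^sup>2 * \<omega>" using pos by simp
      have "Z (\<xi> t1) = 1 / \<omega> \<or> Z (\<xi> t1) = - (1 / \<omega>)"
        using t1(3) by (simp only: power2_eq_iff)
      then have "Z (\<xi> \<sigma>) * zd \<le> 0"
      proof
        assume z: "Z (\<xi> t1) = 1 / \<omega>"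
        have "K * \<beta>\<^sup>2 * \<omega> * (1 / \<omega> - (1 + norm c) * B * (b - a)) \<le> K * \<beta>\<^sup>2 * \<omega> * za"
          using z2 z kb by (intro mult_left_mono) auto
        then have "zd \<le> 0" using zd pos by (simp add: abs_le_iff algebra_simps)
        moreover have "0 \<le> Z (\<xi> \<sigma>)" using z1 z w half by linarith
        ultimately show ?thesis by (simp add: mult_nonneg_nonpos)
      next
        assume z: "Z (\<xi> t1) = - (1 / \<omega>)"
        have "K * \<beta>\<^sup>2 * \<omega> * za \<le> K * \<beta>\<^sup>2 * \<omega> * (- (1 / \<omega>) + (1 + norm c) * B * (b - a))"
          using z2 z kb by (intro mult_left_mono) auto
        then have "0 \<le> zd" using zd pos by (simp add: abs_le_iff algebra_simps)
        moreover have "Z (\<xi> \<sigma>) \<le> 0" using z1 z w half by linarith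
        ultimately show ?thesis by (simp add: mult_nonpos_nonneg)
      qed
      then show "2 * (Z (\<xi> \<sigma>) * zd) \<le> 0" by linarith
    qed (use t1 Vle in auto)
    then show False using t1 Za2 by simp
  qed (use t in auto)
  then show ?thesis using h0(1) by (auto simp: iff)
qed

text \<open>The form is homogeneous of degree two and positive off the origin: V detects x, and for
  x = 0 the value of Z is y. Its minimum over the unit sphere is the constant.\<close>

lemma square_sum_coercive: "\<exists>\<kappa>>0. \<forall>\<xi>. \<kappa> * (norm \<xi>)\<^sup>2 \<le> V \<xi> + (Z \<xi>)\<^sup>2"
proof -
  define q where "q \<xi> = V \<xi> + (Z \<xi>)\<^sup>2" for \<xi>
  let ?S = "sphere (0 :: 'a \<times> real) 1"
  have "continuous_on ?S q"
    unfolding q_def V_def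
    by (intro continuous_intros P.continuous_on bounded_linear.continuous_on[OF Z_linear])
  moreover have "(0, 1) \<in> ?S" by (simp add: norm_Pair)
  then have "?S \<noteq> {}" by blast
  ultimately obtain v where v: "v \<in> ?S" "\<And>w. w \<in> ?S \<Longrightarrow> q v \<le> q w"
    using continuous_attains_inf[of ?S q] by auto
  have qpos: "q v > 0"
  proof (cases "fst v = 0")
    case True
    then have "snd v \<noteq> 0" using v(1) by (auto simp: prod_eq_iff norm_prod_def)
    then show ?thesis using True V_nonneg[of v] by (simp add: q_def Z_def add_nonneg_pos)
  next
    case False
    then have "V v > 0" by (simp add: V_def P_pos)
    then show ?thesis by (simp add: q_def add_pos_nonneg)
  qed
  have "q v * (norm \<xi>)\<^sup>2 \<le> q \<xi>" for \<xi>
  proof (cases "\<xi> = 0")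
    case True
    then show ?thesis by (simp add: q_def V_def Z_def P.zero)
  next
    case False
    define e where "e = inverse (norm \<xi>) *\<^sub>R \<xi>"
    have "\<xi> = norm \<xi> *\<^sub>R e" using False by (simp add: e_def)
    then have "q \<xi> = q (norm \<xi> *\<^sub>R e)" by simp
    also have "\<dots> = (norm \<xi>)\<^sup>2 * q e"
      by (simp add: q_def V_def Z_def P.scaleR power2_eq_square algebra_simps)
    also have "\<dots> \<ge> (norm \<xi>)\<^sup>2 * q v"
      using False by (intro mult_left_mono v(2)) (auto simp: e_def)
    finally show ?thesis by (simp add: mult.commute)
  qed
  then show ?thesis unfolding q_def[symmetric] using qpos by blast
qed

lemma W_coercive: "\<exists>\<kappa>>0. \<forall>\<xi>. \<kappa> * (norm \<xi>)\<^sup>2 \<le> W \<xi>"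
proof -
  obtain \<kappa> where \<kappa>: "\<kappa> > 0" "\<And>\<xi>. \<kappa> * (norm \<xi>)\<^sup>2 \<le> V \<xi> + (Z \<xi>)\<^sup>2"
    using square_sum_coercive by blast
  have "min 1 M * \<kappa> * (norm \<xi>)\<^sup>2 \<le> W \<xi>" for \<xi>
  proof -
    have "min 1 M * (\<kappa> * (norm \<xi>)\<^sup>2) \<le> min 1 M * (V \<xi> + (Z \<xi>)\<^sup>2)"
      using \<kappa>(2)[of \<xi>] pos by (intro mult_left_mono) auto
    also have "\<dots> = min 1 M * V \<xi> + min 1 M * (Z \<xi>)\<^sup>2" by (simp add: algebra_simps)
    also have "\<dots> \<le> 1 * V \<xi> + M * (Z \<xi>)\<^sup>2"
      using V_nonneg by (intro add_mono mult_right_mono) auto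
    finally show ?thesis by (simp add: W_def mult.assoc)
  qed
  moreover have "min 1 M * \<kappa> > 0" using \<kappa>(1) pos by simp
  ultimately show ?thesis by blast
qed

text \<open>All errors are kept proportional to the norm of the current state, so that they are
  absorbed by half of \<delta> through coercivity. The other half, with
  \<open>W \<le> (1 + M) (V + Z^2)\<close>, gives the rate
  \<open>\<delta> / (1 + M)\<close>.\<close>

lemma W_decrease:
  "\<exists>h0>0. \<forall>d a b \<xi>. loop_arc d a b \<xi> \<and> b - a \<le> h0 \<and> (\<forall>t\<in>{a..b}. V (\<xi> t) < R\<^sup>2 \<and> \<omega> * \<bar>Z (\<xi> t)\<bar> < 1)
    \<longrightarrow> (\<forall>t\<in>{a..b}. W (\<xi> t) * (1 + \<delta> / (1 + M) * (t - a)) \<le> W (\<xi> a))"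
proof -
  obtain KP where KP: "KP > 0" "\<And>x. norm (P x) \<le> norm x * KP" using P.pos_bounded by blast
  obtain \<kappa> where \<kappa>: "\<kappa> > 0" "\<And>\<xi>. \<kappa> * (norm \<xi>)\<^sup>2 \<le> V \<xi> + (Z \<xi>)\<^sup>2"
    using square_sum_coercive by blast
  \<comment> \<open>E bounds the gain of the unsaturated feedback from the state to u. The number
    \<open>H |\<xi>| e\<close> bounds the effect of a control error e on half the derivative of
    W.\<close>
  define E where "E = norm p + K * \<bar>\<beta>\<bar> * \<omega> * (1 + norm c)"
  define H where "H = KP * L + M * (1 + norm c) * (1 + norm c) * L"
  have EH: "0 \<le> E" "0 \<le> H" unfolding E_def H_def
    using pos KP(1) by (auto intro!: add_nonneg_nonneg mult_nonneg_nonneg)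
  then obtain h0 where h0: "h0 > 0" "\<And>h. 0 \<le> h \<Longrightarrow> h \<le> h0 \<Longrightarrow>
      2 * L * (1 + E) * h \<le> 1 / 2 \<and> H * E * (4 * L * (1 + E)) * h \<le> \<delta> * \<kappa> / 2"
    using ex_small_step[of "2 * L * (1 + E)" "1 / 2" "H * E * (4 * L * (1 + E))" "\<delta> * \<kappa> / 2"] pos \<kappa>(1)
    by auto
  have "W (\<xi> t) * (1 + \<delta> / (1 + M) * (t - a)) \<le> W (\<xi> a)"
    if arc: "loop_arc d a b \<xi>" and h: "b - a \<le> h0"
      and VZ: "\<forall>t\<in>{a..b}. V (\<xi> t) < R\<^sup>2 \<and> \<omega> * \<bar>Z (\<xi> t)\<bar> < 1" and t: "t \<in> {a..b}" for d a b \<xi> t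
  proof -
    define hh where "hh = b - a"
    have hh: "0 \<le> hh" "2 * L * (1 + E) * hh \<le> 1 / 2" "H * E * (4 * L * (1 + E)) * hh \<le> \<delta> * \<kappa> / 2"
      using h0(2)[of hh] h t by (auto simp: hh_def)
    have Vle: "V (\<xi> \<sigma>) \<le> R\<^sup>2" "\<omega> * \<bar>Z (\<xi> \<sigma>)\<bar> \<le> 1" if "a \<le> \<sigma>" "\<sigma> \<le> b" for \<sigma>
      using VZ that by (auto simp: less_imp_le)
    define F where "F \<sigma> = \<Phi> (d \<sigma>, fst (\<xi> \<sigma>), feedback (\<xi> a))" for \<sigma>
    have curve: "integral_curve F a b \<xi>"
      using arc by (simp add: loop_arc_def F_def[abs_def])
    have lin: "feedback (\<xi> a) = p \<bullet> fst (\<xi> a) - K * \<beta> * \<omega> * Z (\<xi> a)"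
      using Vle(2)[of a] t pos by (simp add: feedback_def sat_eq_self abs_mult)
    have lin_bound: "\<bar>p \<bullet> fst \<eta> - K * \<beta> * \<omega> * Z \<eta>\<bar> \<le> E * norm \<eta>" for \<eta>
    proof -
      have "\<bar>p \<bullet> fst \<eta>\<bar> \<le> norm p * norm \<eta>"
        using Cauchy_Schwarz_ineq2[of p "fst \<eta>"] norm_fst_le[of "fst \<eta>" "snd \<eta>"]
          mult_left_mono[of "norm (fst \<eta>)" "norm \<eta>" "norm p"] by simp
      moreover have "\<bar>K * \<beta> * \<omega> * Z \<eta>\<bar> \<le> K * \<bar>\<beta>\<bar> * \<omega> * ((1 + norm c) * norm \<eta>)"
        unfolding abs_mult using pos abs_Z_le[of \<eta>] by (intro mult_mono) auto
      ultimately show ?thesis by (simp add: E_def algebra_simps)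
    qed
    have F_le: "norm (F \<sigma>) \<le> L * (norm (\<xi> \<sigma>) + E * norm (\<xi> a))" if "a \<le> \<sigma>" "\<sigma> \<le> b" for \<sigma>
    proof -
      have "norm (F \<sigma>) \<le> L * (norm (fst (\<xi> \<sigma>)) + \<bar>feedback (\<xi> a)\<bar>)"
        unfolding F_def using that arc Vle t
        by (intro norm_field_le_linear norm_fst_le_\<rho> feedback_le_U) (auto simp: loop_arc_def)
      also have "\<dots> \<le> L * (norm (\<xi> \<sigma>) + E * norm (\<xi> a))"
        using pos lin_bound[of "\<xi> a"] norm_fst_le[of "fst (\<xi> \<sigma>)" "snd (\<xi> \<sigma>)"]
        by (intro mult_left_mono add_mono) (auto simp: lin)
      finally show ?thesis .
    qed
    \<comment> \<open>The largest deviation m from the sample occurs on both sides of its own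
      estimate \<open>m \<le> L h m + L (1 + E) h N\<close>. As \<open>L h \<le> 1/2\<close>, this
      can be solved for m and yields a bound proportional to the norm N of the sample.\<close>
    have "continuous_on {a..b} (\<lambda>\<sigma>. norm (\<xi> \<sigma> - \<xi> a))"
      by (intro continuous_intros integral_curve_continuous[OF curve])
    then obtain s where s: "a \<le> s" "s \<le> b" and
        max: "\<And>\<sigma>. a \<le> \<sigma> \<Longrightarrow> \<sigma> \<le> b \<Longrightarrow> norm (\<xi> \<sigma> - \<xi> a) \<le> norm (\<xi> s - \<xi> a)"
      using continuous_attains_sup[of "{a..b}" "\<lambda>\<sigma>. norm (\<xi> \<sigma> - \<xi> a)"] t by auto
    define m where "m = norm (\<xi> s - \<xi> a)"
    define N where "N = norm (\<xi> a)"
    have xi_le: "norm (\<xi> \<sigma>) \<le> N + m" if "a \<le> \<sigma>" "\<sigma> \<le> b" for \<sigma>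
      using max[OF that] norm_triangle_sub[of "\<xi> \<sigma>" "\<xi> a"] by (simp add: N_def m_def)
    have m0: "0 \<le> m" "0 \<le> N" by (auto simp: m_def N_def)
    have "m \<le> L * ((N + m) + E * N) * (s - a)"
      unfolding m_def
    proof (rule integral_curve_dist_le[OF curve])
      fix \<sigma> assume "\<sigma> \<in> {a..s}"
      then have \<sigma>: "a \<le> \<sigma>" "\<sigma> \<le> b" using s by auto
      have "L * (norm (\<xi> \<sigma>) + E * norm (\<xi> a)) \<le> L * ((N + m) + E * N)"
        using xi_le[OF \<sigma>] pos by (intro mult_left_mono) (auto simp: N_def)
      then show "norm (F \<sigma>) \<le> L * (N + norm (\<xi> s - \<xi> a) + E * N)"
        using F_le[OF \<sigma>] by (simp add: m_def)
    qed (use s in auto)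
    also have "\<dots> \<le> L * ((N + m) + E * N) * hh"
      using s pos EH m0 by (intro mult_left_mono) (auto simp: hh_def)
    finally have m1: "m \<le> L * hh * m + L * (1 + E) * hh * N" by (simp add: algebra_simps)
    have "L * hh * 1 \<le> L * hh * (1 + E)" using pos hh EH by (intro mult_left_mono) auto
    then have Lh: "L * hh \<le> 1 / 2" using hh(2) by (simp add: algebra_simps)
    then have "L * hh * m \<le> 1 / 2 * m" using m0 by (intro mult_right_mono)
    then have m2: "m \<le> 2 * L * (1 + E) * hh * N" using m1 by (simp add: algebra_simps)
    have "2 * L * (1 + E) * hh * N \<le> 1 / 2 * N" using hh(2) m0 by (intro mult_right_mono)
    then have m3: "m \<le> N / 2" using m2 by simp
    \<comment> \<open>Because \<open>m \<le> N / 2\<close>, the sampled state is at most twice as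
      large as the current one. The error is thereby expressed through the state at which the
      decrease is measured.\<close>
    have dev: "norm (\<xi> \<sigma> - \<xi> a) \<le> 4 * L * (1 + E) * hh * norm (\<xi> \<sigma>)" if \<sigma>: "a \<le> \<sigma>" "\<sigma> \<le> b" for \<sigma>
    proof -
      have "N \<le> norm (\<xi> \<sigma>) + m"
        using max[OF \<sigma>] norm_triangle_sub[of "\<xi> a" "\<xi> \<sigma>"] by (simp add: N_def m_def norm_minus_commute)
      then have "N \<le> 2 * norm (\<xi> \<sigma>)" using m3 by simp
      then have "2 * L * (1 + E) * hh * N \<le> 2 * L * (1 + E) * hh * (2 * norm (\<xi> \<sigma>))"
        using pos EH hh by (intro mult_left_mono) auto
      also have "\<dots> = 4 * L * (1 + E) * hh * norm (\<xi> \<sigma>)" by simp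
      finally show ?thesis using m2 max[OF \<sigma>] unfolding m_def by linarith
    qed
    have deriv: "fst (\<xi> \<sigma>) \<bullet> P (fst (F \<sigma>)) + M * (Z (\<xi> \<sigma>) * Z (F \<sigma>)) \<le> - (\<delta> / 2) * (V (\<xi> \<sigma>) + (Z (\<xi> \<sigma>))\<^sup>2)"
      if \<sigma>: "a \<le> \<sigma>" "\<sigma> \<le> b" for \<sigma>
    proof -
      define x z where "x = fst (\<xi> \<sigma>)" and "z = Z (\<xi> \<sigma>)"
      define u where "u = p \<bullet> x - K * \<beta> * \<omega> * z"
      define F' where "F' = \<Phi> (d \<sigma>, x, u)"
      have dD: "d \<sigma> \<in> D" using arc \<sigma> by (simp add: loop_arc_def)
      have Vx: "x \<bullet> P x \<le> R\<^sup>2" using Vle(1)[OF \<sigma>] by (simp add: V_def x_def)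
      have zw: "\<omega> * \<bar>z\<bar> \<le> 1" using Vle(2)[OF \<sigma>] by (simp add: z_def)
      have nx: "norm x \<le> \<rho>" unfolding x_def by (intro norm_fst_le_\<rho> Vle \<sigma>)
      have U: "\<bar>u\<bar> \<le> U" "\<bar>feedback (\<xi> a)\<bar> \<le> U"
        using control_le_U[OF nx, of "\<omega> * z"] zw pos feedback_le_U Vle(1)[of a] t
        by (auto simp: u_def abs_mult mult.assoc)
      have "feedback (\<xi> a) - u = p \<bullet> fst (\<xi> a - \<xi> \<sigma>) - K * \<beta> * \<omega> * Z (\<xi> a - \<xi> \<sigma>)"
        by (simp add: lin u_def x_def z_def Z_diff inner_diff_right right_diff_distrib)
      then have "\<bar>feedback (\<xi> a) - u\<bar> \<le> E * norm (\<xi> \<sigma> - \<xi> a)"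
        using lin_bound[of "\<xi> a - \<xi> \<sigma>"] by (simp add: norm_minus_commute)
      also have "\<dots> \<le> E * (4 * L * (1 + E) * hh * norm (\<xi> \<sigma>))"
        using dev[OF \<sigma>] EH by (intro mult_left_mono)
      finally have eu: "\<bar>feedback (\<xi> a) - u\<bar> \<le> E * (4 * L * (1 + E) * hh * norm (\<xi> \<sigma>))" .
      define e where "e = E * (4 * L * (1 + E) * hh * norm (\<xi> \<sigma>))"
      have "norm (F \<sigma> - F') \<le> L * (norm (x - x) + \<bar>feedback (\<xi> a) - u\<bar>)"
        unfolding F_def F'_def x_def[symmetric] by (intro field_lipschitz dD nx U)
      also have "\<dots> \<le> L * e" using eu pos by (intro mult_left_mono) (auto simp: e_def)
      finally have FF: "norm (F \<sigma> - F') \<le> L * e" .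
      have nle: "norm x \<le> norm (\<xi> \<sigma>)" "\<bar>z\<bar> \<le> (1 + norm c) * norm (\<xi> \<sigma>)"
        using norm_fst_le[of "fst (\<xi> \<sigma>)" "snd (\<xi> \<sigma>)"] abs_Z_le by (auto simp: x_def z_def)
      have "norm (fst (F \<sigma> - F')) \<le> L * e"
        using FF by (metis norm_fst_le order_trans prod.collapse)
      then have "norm (P (fst (F \<sigma> - F'))) \<le> L * e * KP"
        using KP order_trans[OF KP(2) mult_right_mono] by simp
      then have "norm x * norm (P (fst (F \<sigma> - F'))) \<le> norm (\<xi> \<sigma>) * (L * e * KP)"
        using nle by (intro mult_mono) auto
      then have 1: "x \<bullet> P (fst (F \<sigma> - F')) \<le> norm (\<xi> \<sigma>) * (L * e * KP)"
        using norm_cauchy_schwarz[of x "P (fst (F \<sigma> - F'))"] by linarith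
      have "\<bar>Z (F \<sigma> - F')\<bar> \<le> (1 + norm c) * (L * e)"
        using abs_Z_le[of "F \<sigma> - F'"] mult_left_mono[OF FF, of "1 + norm c"] by simp
      then have "\<bar>z\<bar> * \<bar>Z (F \<sigma> - F')\<bar> \<le> (1 + norm c) * norm (\<xi> \<sigma>) * ((1 + norm c) * (L * e))"
        using nle by (intro mult_mono) auto
      then have "z * Z (F \<sigma> - F') \<le> (1 + norm c) * norm (\<xi> \<sigma>) * ((1 + norm c) * (L * e))"
        by (metis abs_ge_self abs_mult order_trans)
      then have 2: "M * (z * Z (F \<sigma> - F')) \<le> M * ((1 + norm c) * norm (\<xi> \<sigma>) * ((1 + norm c) * (L * e)))"
        using pos by (intro mult_left_mono) auto
      have 3: "x \<bullet> P (fst F') + M * (z * Z F') \<le> - \<delta> * (z\<^sup>2 + x \<bullet> P x)"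
        using local_decrease[OF dD Vx zw u_def] by (simp add: F'_def Z_def mult.assoc)
      have "x \<bullet> P (fst (F \<sigma>)) + M * (z * Z (F \<sigma>))
          = (x \<bullet> P (fst F') + M * (z * Z F')) + x \<bullet> P (fst (F \<sigma> - F')) + M * (z * Z (F \<sigma> - F'))"
        by (simp add: P.diff Z_diff inner_diff_right algebra_simps)
      also have "\<dots> \<le> - \<delta> * (z\<^sup>2 + x \<bullet> P x) + H * E * (4 * L * (1 + E)) * hh * (norm (\<xi> \<sigma>))\<^sup>2"
        using 1 2 3 by (simp add: H_def e_def power2_eq_square algebra_simps)
      also have "H * E * (4 * L * (1 + E)) * hh * (norm (\<xi> \<sigma>))\<^sup>2 \<le> \<delta> * \<kappa> / 2 * (norm (\<xi> \<sigma>))\<^sup>2"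
        using hh(3) by (intro mult_right_mono) auto
      also have "\<dots> = \<delta> / 2 * (\<kappa> * (norm (\<xi> \<sigma>))\<^sup>2)" by simp
      also have "\<dots> \<le> \<delta> / 2 * (V (\<xi> \<sigma>) + (Z (\<xi> \<sigma>))\<^sup>2)"
        using \<kappa>(2) pos by (intro mult_left_mono) auto
      finally show ?thesis
        by (simp add: x_def[symmetric] z_def[symmetric] V_def algebra_simps)
    qed
    let ?S = "\<lambda>\<xi>. (P (fst \<xi>), 0::real) + M *\<^sub>R (Z \<xi> *\<^sub>R (c, 1))"
    have S: "bounded_linear ?S"
      by (intro bounded_linear_add quadratic_V(1) bounded_linear_compose[OF bounded_linear_scaleR_right quadratic_Z(1)])
    have Ssym: "x \<bullet> ?S y = ?S x \<bullet> y" for x y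
      by (simp only: inner_add_left inner_add_right inner_scaleR_right[of x M] inner_scaleR_left[of M] quadratic_V(2)[of x y] quadratic_Z(2)[of x y])
    have SW: "x \<bullet> ?S x = W x" for x
      by (simp only: inner_add_right inner_scaleR_right[of x M] quadratic_V(3)[symmetric] quadratic_Z(3) W_def power2_eq_square)
    have SF: "x \<bullet> ?S y = fst x \<bullet> P (fst y) + M * (Z x * Z y)" for x y
      by (simp only: inner_add_right inner_scaleR_right[of x M] quadratic_Z(3)) (simp add: inner_prod_def)
    have W_le: "W \<eta> \<le> (1 + M) * (V \<eta> + (Z \<eta>)\<^sup>2)" for \<eta>
      using V_nonneg[of \<eta>] pos by (simp add: W_def algebra_simps)
    have deriv_W: "2 * (\<xi> \<sigma> \<bullet> ?S (F \<sigma>)) \<le> - (\<delta> / (1 + M)) * W (\<xi> \<sigma>)" if \<sigma>: "a \<le> \<sigma>" "\<sigma> \<le> b" for \<sigma>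
    proof -
      have "\<delta> / (1 + M) * W (\<xi> \<sigma>) \<le> \<delta> / (1 + M) * ((1 + M) * (V (\<xi> \<sigma>) + (Z (\<xi> \<sigma>))\<^sup>2))"
        using W_le pos by (intro mult_left_mono) auto
      also have "\<dots> = \<delta> * (V (\<xi> \<sigma>) + (Z (\<xi> \<sigma>))\<^sup>2)" using pos by simp
      finally show ?thesis using deriv[OF \<sigma>] unfolding SF by simp
    qed
    have bound: "norm (F \<sigma>) \<le> B" if "a \<le> \<sigma>" "\<sigma> \<le> b" for \<sigma>
      unfolding F_def using that Vle by (intro loop_arc_dist(4)[OF arc _ _ _ _ _ order_refl, of \<sigma>]) auto
    have mono: "W (\<xi> t) \<le> W (\<xi> s)" if "a \<le> s" "s \<le> t" for s
    proof -
      have "\<xi> t \<bullet> ?S (\<xi> t) - \<xi> s \<bullet> ?S (\<xi> s) \<le> 0 * (t - s)"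
      proof (rule integral_curve_quadratic_form_le[OF curve _ _ _ _ S Ssym])
        show "norm (F \<sigma>) \<le> B" if "\<sigma> \<in> {s..t}" for \<sigma>
          using that \<open>a \<le> s\<close> t by (intro bound) auto
        show "2 * (\<xi> \<sigma> \<bullet> ?S (F \<sigma>)) \<le> 0" if "\<sigma> \<in> {s..t}" for \<sigma>
        proof -
          have "0 \<le> \<delta> / (1 + M) * W (\<xi> \<sigma>)" using W_nonneg pos by simp
          then show ?thesis using deriv_W[of \<sigma>] that \<open>a \<le> s\<close> t by simp
        qed
      qed (use that t in auto)
      then show ?thesis by (simp only: SW)
    qed
    \<comment> \<open>The quadratic-form lemma wants a constant rate. As W does not increase, its
      last value W(t) is the smallest and may stand in for W(\<sigma>); moving it to the left
      produces the factor \<open>1 + \<gamma> (t - a)\<close>.\<close>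
    have "\<xi> t \<bullet> ?S (\<xi> t) - \<xi> a \<bullet> ?S (\<xi> a) \<le> (- (\<delta> / (1 + M)) * W (\<xi> t)) * (t - a)"
    proof (rule integral_curve_quadratic_form_le[OF curve _ _ _ _ S Ssym])
      show "norm (F \<sigma>) \<le> B" if "\<sigma> \<in> {a..t}" for \<sigma>
        using that t by (intro bound) auto
      show "2 * (\<xi> \<sigma> \<bullet> ?S (F \<sigma>)) \<le> - (\<delta> / (1 + M)) * W (\<xi> t)" if "\<sigma> \<in> {a..t}" for \<sigma>
      proof -
        have "\<delta> / (1 + M) * W (\<xi> t) \<le> \<delta> / (1 + M) * W (\<xi> \<sigma>)"
          using mono that pos by (intro mult_left_mono) auto
        then show ?thesis using deriv_W[of \<sigma>] that t by simp
      qed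
    qed (use t in auto)
    then show ?thesis unfolding SW by (simp add: algebra_simps)
  qed
  then show ?thesis using h0(1) by blast
qed

lemma loop_arc_dynamics:
  "\<exists>h0>0. \<forall>d a b \<xi>. loop_arc d a b \<xi> \<and> b - a \<le> h0 \<longrightarrow> (\<forall>t\<in>{a..b}. V (\<xi> t) < R\<^sup>2 \<and>
    (1 \<le> \<omega> * \<bar>Z (\<xi> a)\<bar> \<longrightarrow> (Z (\<xi> t))\<^sup>2 \<le> (Z (\<xi> a))\<^sup>2 - \<mu> / (2 * \<omega>) * (t - a)) \<and>
    (\<omega> * \<bar>Z (\<xi> a)\<bar> < 1 \<longrightarrow> \<omega> * \<bar>Z (\<xi> t)\<bar> < 1 \<and> W (\<xi> t) * (1 + \<delta> / (1 + M) * (t - a)) \<le> W (\<xi> a)))"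
proof -
  obtain h1 where h1: "h1 > 0" and 1: "\<And>d a b \<xi>. loop_arc d a b \<xi> \<Longrightarrow> b - a \<le> h1 \<Longrightarrow> \<forall>t\<in>{a..b}. V (\<xi> t) < R\<^sup>2"
    using sublevel_invariant by blast
  obtain h2 where h2: "h2 > 0" and 2: "\<And>d a b \<xi>. loop_arc d a b \<xi> \<Longrightarrow> b - a \<le> h2 \<Longrightarrow>
      \<forall>t\<in>{a..b}. V (\<xi> t) < R\<^sup>2 \<Longrightarrow> \<omega> * \<bar>Z (\<xi> a)\<bar> \<ge> 1 \<Longrightarrow>
      \<forall>t\<in>{a..b}. (Z (\<xi> t))\<^sup>2 \<le> (Z (\<xi> a))\<^sup>2 - \<mu> / (2 * \<omega>) * (t - a)"
    using saturated_decrease by blast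
  obtain h3 where h3: "h3 > 0" and 3: "\<And>d a b \<xi>. loop_arc d a b \<xi> \<Longrightarrow> b - a \<le> h3 \<Longrightarrow>
      \<forall>t\<in>{a..b}. V (\<xi> t) < R\<^sup>2 \<Longrightarrow> \<omega> * \<bar>Z (\<xi> a)\<bar> < 1 \<Longrightarrow> \<forall>t\<in>{a..b}. \<omega> * \<bar>Z (\<xi> t)\<bar> < 1"
    using unsaturated_invariant by blast
  obtain h4 where h4: "h4 > 0" and 4: "\<And>d a b \<xi>. loop_arc d a b \<xi> \<Longrightarrow> b - a \<le> h4 \<Longrightarrow>
      \<forall>t\<in>{a..b}. V (\<xi> t) < R\<^sup>2 \<and> \<omega> * \<bar>Z (\<xi> t)\<bar> < 1 \<Longrightarrow>
      \<forall>t\<in>{a..b}. W (\<xi> t) * (1 + \<delta> / (1 + M) * (t - a)) \<le> W (\<xi> a)"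
    using W_decrease by blast
  show ?thesis
  proof (intro exI[of _ "Min {h1, h2, h3, h4}"] conjI allI impI ballI)
    fix d a b \<xi> t assume arc: "loop_arc d a b \<xi> \<and> b - a \<le> Min {h1, h2, h3, h4}" and t: "t \<in> {a..b}"
    then have le: "b - a \<le> h1" "b - a \<le> h2" "b - a \<le> h3" "b - a \<le> h4" by auto
    note V = 1[OF conjunct1[OF arc] le(1)]
    show "V (\<xi> t) < R\<^sup>2" using V t by blast
    show "(Z (\<xi> t))\<^sup>2 \<le> (Z (\<xi> a))\<^sup>2 - \<mu> / (2 * \<omega>) * (t - a)" if "1 \<le> \<omega> * \<bar>Z (\<xi> a)\<bar>"
      using 2[OF conjunct1[OF arc] le(2) V that] t by blast
    show "\<omega> * \<bar>Z (\<xi> t)\<bar> < 1" "W (\<xi> t) * (1 + \<delta> / (1 + M) * (t - a)) \<le> W (\<xi> a)"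
      if "\<omega> * \<bar>Z (\<xi> a)\<bar> < 1"
      using 3[OF conjunct1[OF arc] le(3) V that] 4[OF conjunct1[OF arc] le(4)] V t by blast+
  qed (use h1 h2 h3 h4 in auto)
qed

text \<open>The length depends on L and B only, so it is the same for every start in the sublevel
  set. Picard iteration runs in the unit ball around the start; invariance of the sublevel set is a
  separate matter.\<close>

lemma loop_arc_exists:
  "\<exists>h0>0. \<forall>d a b \<xi>0. d \<in> Linf_loc D \<and> 0 \<le> a \<and> a \<le> b \<and> b - a \<le> h0 \<and> V \<xi>0 < R\<^sup>2
    \<longrightarrow> (\<exists>\<xi>. \<xi> a = \<xi>0 \<and> loop_arc d a b \<xi>)"
proof -
  obtain h0 where h0: "h0 > 0" "\<And>h. 0 \<le> h \<Longrightarrow> h \<le> h0 \<Longrightarrow> L * h \<le> 1 / 2 \<and> B * h \<le> 1"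
    using ex_small_step[of L "1 / 2" B 1] pos B_pos by auto
  have "\<exists>\<xi>. \<xi> a = \<xi>0 \<and> loop_arc d a b \<xi>"
    if d: "d \<in> Linf_loc D" and ab: "0 \<le> a" "a \<le> b" "b - a \<le> h0" and V0: "V \<xi>0 < R\<^sup>2" for d a b \<xi>0
  proof -
    have dD: "d s \<in> D" if "s \<in> {a..b}" for s using d ab that by (auto simp: Linf_loc_def)
    have u: "\<bar>feedback \<xi>0\<bar> \<le> U" using V0 by (intro feedback_le_U) simp
    \<comment> \<open>The margin 1 in \<open>norm_less\<close> keeps this unit ball inside the
      region where the field is bounded and Lipschitz.\<close>
    have ball: "norm (fst x) \<le> \<rho>" if "x \<in> cball \<xi>0 1" for x
    proof -
      have "norm (fst (\<xi>0 - x)) \<le> norm (\<xi>0 - x)" by (metis norm_fst_le prod.collapse)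
      then have "norm (fst \<xi>0 - fst x) \<le> 1" using that by (simp add: dist_norm)
      then show ?thesis
        using norm_less[of "fst \<xi>0"] V0 norm_triangle_sub[of "fst x" "fst \<xi>0"]
        by (simp add: V_def norm_minus_commute)
    qed
    have "\<exists>\<phi>. \<phi> a = \<xi>0 \<and> integral_curve (\<lambda>s. \<Phi> (d s, fst (\<phi> s), feedback \<xi>0)) a b \<phi>"
    proof (rule Picard_caratheodory[where e = 1 and B = B and L = L])
      show "(\<lambda>s. \<Phi> (d s, fst (\<phi> s), feedback \<xi>0)) absolutely_integrable_on {a..b}"
        if "continuous_on {a..b} \<phi>" for \<phi>
        using that ab by (intro absolutely_integrable_along_curve[OF D field_continuous d] continuous_intros)
      show "norm (\<Phi> (d s, fst x, feedback \<xi>0)) \<le> B" if "s \<in> {a..b}" "x \<in> cball \<xi>0 1" for s x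
        using that by (intro norm_field_le dD ball u)
      show "norm (\<Phi> (d s, fst x, feedback \<xi>0) - \<Phi> (d s, fst y, feedback \<xi>0)) \<le> L * norm (x - y)"
        if "s \<in> {a..b}" "x \<in> cball \<xi>0 1" "y \<in> cball \<xi>0 1" for s x y
      proof -
        have "norm (\<Phi> (d s, fst x, feedback \<xi>0) - \<Phi> (d s, fst y, feedback \<xi>0)) \<le> L * (norm (fst x - fst y) + \<bar>feedback \<xi>0 - feedback \<xi>0\<bar>)"
          using that by (intro field_lipschitz dD ball u)
        also have "norm (fst x - fst y) \<le> norm (x - y)"
          unfolding fst_diff[symmetric] by (metis norm_fst_le prod.collapse)
        finally show ?thesis using pos by simp
      qed
      show "L * (b - a) < 1" "B * (b - a) \<le> 1" using h0(2)[of "b - a"] ab by auto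
    qed (use ab pos in auto)
    then show ?thesis using V0 dD by (auto simp: loop_arc_def)
  qed
  then show ?thesis using h0(1) by blast
qed

lemma W_small: "e > 0 \<Longrightarrow> \<exists>\<eta>>0. \<forall>\<xi>. norm \<xi> \<le> \<eta> \<longrightarrow> W \<xi> < e"
proof -
  assume e: "e > 0"
  have "continuous_on UNIV W"
    unfolding W_def V_def
    by (intro continuous_intros P.continuous_on bounded_linear.continuous_on[OF Z_linear])
  then have "isCont W 0" by (metis UNIV_I continuous_on_eq_continuous_at open_UNIV)
  moreover have "W 0 = 0" by (simp add: W_def V_def Z_def P.zero)
  ultimately obtain \<eta> where \<eta>: "\<eta> > 0" "\<And>\<xi>. dist \<xi> 0 < \<eta> \<Longrightarrow> dist (W \<xi>) 0 < e"
    using e unfolding continuous_at_eps_delta by metis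
  have "W \<xi> < e" if "norm \<xi> \<le> \<eta> / 2" for \<xi>
    using \<eta>(2)[of \<xi>] that \<eta>(1) by (simp add: dist_real_def)
  then show ?thesis using \<eta>(1) half_gt_zero by blast
qed

definition switched :: "('a \<Rightarrow> real) \<Rightarrow> 'a \<times> real \<Rightarrow> real"
  where "switched k \<xi> = (if V \<xi> \<ge> R\<^sup>2 then k (fst \<xi>) else feedback \<xi>)"

end

section \<open>The switched loop\<close>

text \<open>Fixes one step size r' and takes the arc estimates as assumptions, so that the global
  argument sees just two rates: \<nu> for the square of Z in saturation and \<gamma> for W. They
  become \<open>\<mu> / (2 * \<omega>)\<close> and \<open>\<delta> / (1 + M)\<close>.\<close>

locale switched_loop = saturated_loop D \<Phi> P p c \<beta> M R K \<omega> \<delta> \<mu> \<rho> U L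
  for D :: "'d::euclidean_space set"
    and \<Phi> :: "'d \<times> 'a::euclidean_space \<times> real \<Rightarrow> 'a \<times> real"
    and P :: "'a \<Rightarrow> 'a" and p c :: 'a and \<beta> M R K \<omega> \<delta> \<mu> \<rho> U L :: real +
  fixes k :: "'a \<Rightarrow> real" and r r' \<nu> \<gamma> :: real
  assumes r: "0 < r" "0 < r'" "r' \<le> r" and rates: "\<nu> > 0" "\<gamma> > 0"
    and k: "locally_bounded k"
    and nominal: "RGAS D (\<lambda>d x x\<^sub>\<tau>. fst (\<Phi> (d, x, k x\<^sub>\<tau>))) r"
    and arc_V: "loop_arc d a b \<xi> \<Longrightarrow> b - a \<le> r' \<Longrightarrow> t \<in> {a..b} \<Longrightarrow> V (\<xi> t) < R\<^sup>2"
    and arc_saturated: "loop_arc d a b \<xi> \<Longrightarrow> b - a \<le> r' \<Longrightarrow> t \<in> {a..b} \<Longrightarrow> 1 \<le> \<omega> * \<bar>Z (\<xi> a)\<bar> \<Longrightarrow>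
      (Z (\<xi> t))\<^sup>2 \<le> (Z (\<xi> a))\<^sup>2 - \<nu> * (t - a)"
    and arc_Z: "loop_arc d a b \<xi> \<Longrightarrow> b - a \<le> r' \<Longrightarrow> t \<in> {a..b} \<Longrightarrow> \<omega> * \<bar>Z (\<xi> a)\<bar> < 1 \<Longrightarrow> \<omega> * \<bar>Z (\<xi> t)\<bar> < 1"
    and arc_W: "loop_arc d a b \<xi> \<Longrightarrow> b - a \<le> r' \<Longrightarrow> t \<in> {a..b} \<Longrightarrow> \<omega> * \<bar>Z (\<xi> a)\<bar> < 1 \<Longrightarrow>
      W (\<xi> t) * (1 + \<gamma> * (t - a)) \<le> W (\<xi> a)"
    and arc_exists: "d \<in> Linf_loc D \<Longrightarrow> 0 \<le> a \<Longrightarrow> a \<le> b \<Longrightarrow> b - a \<le> r' \<Longrightarrow> V \<xi>0 < R\<^sup>2 \<Longrightarrow>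
      \<exists>\<xi>. \<xi> a = \<xi>0 \<and> loop_arc d a b \<xi>"
begin

abbreviation F_nom :: "'d \<Rightarrow> 'a \<Rightarrow> 'a \<Rightarrow> 'a"
  where "F_nom \<equiv> \<lambda>d x x\<^sub>\<tau>. fst (\<Phi> (d, x, k x\<^sub>\<tau>))"

abbreviation F_sw :: "'d \<Rightarrow> 'a \<times> real \<Rightarrow> 'a \<times> real \<Rightarrow> 'a \<times> real"
  where "F_sw \<equiv> \<lambda>d \<xi> \<xi>\<^sub>\<tau>. \<Phi> (d, fst \<xi>, switched k \<xi>\<^sub>\<tau>)"

abbreviation w_nom :: "(real \<Rightarrow> real) \<Rightarrow> real \<Rightarrow> real"
  where "w_nom w \<equiv> (\<lambda>t. w t + ln (r / r'))"

text \<open>The shifted input has to stay nonnegative; here \<open>r' \<le> r\<close>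
  enters.\<close>

lemma w_nom: "w \<in> Linf_loc {0..} \<Longrightarrow> w_nom w \<in> Linf_loc {0..}"
  using r by (intro Linf_loc_add_const) auto

lemma sample_step: "w \<in> Linf_loc {0..} \<Longrightarrow> sample_time r' w (Suc i) - sample_time r' w i \<le> r'"
  by (rule sample_time_step_le) (use r in \<open>auto simp: Linf_loc_def\<close>)

text \<open>Far out the field has no uniform bound, so x is borrowed from the nominal solution. As y
  does not enter the field, it is obtained by mere integration.\<close>

lemma global_solution_exists:
  assumes d: "d \<in> Linf_loc D" and w: "w \<in> Linf_loc {0..}"
  shows "\<exists>\<xi>. solution_on F_sw r' \<xi>0 d w (horizon r' w) \<xi>"
proof -
  define \<tau> where "\<tau> i = sample_time r' w i" for i
  have \<tau>: "0 \<le> \<tau> i" "\<tau> i < \<tau> (Suc i)" "\<tau> (Suc i) - \<tau> i \<le> r'" for i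
    using sample_time_nonneg[OF r(2)] sample_time_less_Suc[OF r(2)] sample_step[OF w] by (auto simp only: \<tau>_def)
  obtain x where x: "solution_on F_nom r (fst \<xi>0) d (w_nom w) (horizon r (w_nom w)) x"
    using nominal d w_nom[OF w] unfolding RGAS_def by meson
  have x0: "x 0 = fst \<xi>0" using x by (simp add: solution_on_def)
  have xc: "integral_curve (\<lambda>s. fst (\<Phi> (d s, x s, k (x (\<tau> i))))) (\<tau> i) (\<tau> (Suc i)) x" for i
    using solution_on_integral_curve[OF x, of i "\<tau> (Suc i)"] \<tau>(2)[of i] sample_time_less_horizon[OF r(2)]
    by (simp only: \<tau>_def sample_time_rescale[OF r(2,1)] horizon_rescale[OF r(2,1)])
  \<comment> \<open>The invariant at samples. The nominal solution may be followed until the first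
    sample in the sublevel set; from there on the second alternative reproduces itself.\<close>
  define good where "good i v \<longleftrightarrow> fst v = x (\<tau> i) \<or> V v < R\<^sup>2" for i v
  have step: "\<exists>\<phi>. \<phi> (\<tau> i) = v \<and> integral_curve (\<lambda>s. F_sw (d s) (\<phi> s) v) (\<tau> i) (\<tau> (Suc i)) \<phi>
      \<and> good (Suc i) (\<phi> (\<tau> (Suc i)))" if v: "good i v" for i v
  proof (cases "V v < R\<^sup>2")
    case True
    obtain \<phi> where \<phi>: "\<phi> (\<tau> i) = v" "loop_arc d (\<tau> i) (\<tau> (Suc i)) \<phi>"
      using arc_exists[OF d _ _ _ True, of "\<tau> i" "\<tau> (Suc i)"] \<tau>[of i] by auto
    have "V (\<phi> (\<tau> (Suc i))) < R\<^sup>2"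
      using arc_V[OF \<phi>(2) \<tau>(3)] \<tau>(2)[of i] by simp
    then show ?thesis
      using \<phi> True by (intro exI[of _ \<phi>]) (auto simp: loop_arc_def good_def switched_def)
  next
    case False
    then have fv: "fst v = x (\<tau> i)" using v by (simp add: good_def)
    define F where "F s = \<Phi> (d s, x s, k (x (\<tau> i)))" for s
    have Fi: "F absolutely_integrable_on {\<tau> i..\<tau> (Suc i)}"
      unfolding F_def[abs_def]
      by (rule absolutely_integrable_along_curve[OF D field_continuous d integral_curve_continuous[OF xc] \<tau>(1)])
    define \<phi> where "\<phi> s = v + integral {\<tau> i..s} F" for s
    have \<phi>0: "\<phi> (\<tau> i) = v" by (simp add: \<phi>_def)
    have \<phi>c: "integral_curve F (\<tau> i) (\<tau> (Suc i)) \<phi>"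
      using Fi by (simp add: integral_curve_def \<phi>_def)
    have fst\<phi>: "fst (\<phi> s) = x s" if s: "s \<in> {\<tau> i..\<tau> (Suc i)}" for s
    proof -
      have "integral {\<tau> i..s} (\<lambda>s. fst (F s)) = fst (\<phi> s) - fst (\<phi> (\<tau> i))"
        using integral_curve_fst[OF \<phi>c] s by (simp add: integral_curve_def)
      moreover have "integral {\<tau> i..s} (\<lambda>s. fst (F s)) = x s - x (\<tau> i)"
        using xc[of i] s by (simp add: integral_curve_def F_def)
      ultimately show ?thesis by (simp add: \<phi>0 fv)
    qed
    have "integral_curve (\<lambda>s. F_sw (d s) (\<phi> s) v) (\<tau> i) (\<tau> (Suc i)) \<phi>"
      by (rule integral_curve_cong[OF \<phi>c]) (use False in \<open>simp add: fst\<phi> F_def switched_def fv\<close>)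
    moreover have "good (Suc i) (\<phi> (\<tau> (Suc i)))"
      using fst\<phi>[of "\<tau> (Suc i)"] \<tau>(2)[of i] by (simp add: good_def)
    ultimately show ?thesis using \<phi>0 by blast
  qed
  define piece where "piece i \<phi> \<longleftrightarrow>
    integral_curve (\<lambda>s. F_sw (d s) (\<phi> s) (\<phi> (\<tau> i))) (\<tau> i) (\<tau> (Suc i)) \<phi> \<and> good (Suc i) (\<phi> (\<tau> (Suc i)))" for i \<phi>
  \<comment> \<open>Pieces are chosen one after another, each starting where its predecessor ends.
    The initial value is attached to piece 0 inside the invariant.\<close>
  have "\<exists>f. \<forall>i. (piece i (f i) \<and> (i = 0 \<longrightarrow> f i 0 = \<xi>0)) \<and> f (Suc i) (\<tau> (Suc i)) = f i (\<tau> (Suc i))"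
  proof (rule dependent_nat_choice)
    have "good 0 \<xi>0" using x0 by (simp add: good_def \<tau>_def)
    from step[OF this] show "\<exists>\<phi>. piece 0 \<phi> \<and> ((0::nat) = 0 \<longrightarrow> \<phi> 0 = \<xi>0)"
      by (auto simp: piece_def \<tau>_def)
    fix \<phi> i assume "piece i \<phi> \<and> (i = 0 \<longrightarrow> \<phi> 0 = \<xi>0)"
    then have "good (Suc i) (\<phi> (\<tau> (Suc i)))" by (simp add: piece_def)
    then obtain \<psi> where \<psi>: "\<psi> (\<tau> (Suc i)) = \<phi> (\<tau> (Suc i))"
      "integral_curve (\<lambda>s. F_sw (d s) (\<psi> s) (\<phi> (\<tau> (Suc i)))) (\<tau> (Suc i)) (\<tau> (Suc (Suc i))) \<psi>"
      "good (Suc (Suc i)) (\<psi> (\<tau> (Suc (Suc i))))"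
      using step by blast
    then have "piece (Suc i) \<psi>" by (simp add: piece_def)
    then show "\<exists>\<psi>. (piece (Suc i) \<psi> \<and> (Suc i = 0 \<longrightarrow> \<psi> 0 = \<xi>0)) \<and> \<psi> (\<tau> (Suc i)) = \<phi> (\<tau> (Suc i))"
      using \<psi>(1) by blast
  qed
  then obtain f where f: "\<And>i. piece i (f i)" "f 0 0 = \<xi>0" "\<And>i. f (Suc i) (\<tau> (Suc i)) = f i (\<tau> (Suc i))"
    by auto
  \<comment> \<open>At a sampling time this selects the later piece; agreement of neighbouring
    pieces there makes the formula valid on closed intervals.\<close>
  define \<xi> where "\<xi> t = f (LEAST i. t < \<tau> (Suc i)) t" for t
  have \<tau>_mono: "i \<le> j \<Longrightarrow> \<tau> i \<le> \<tau> j" for i j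
    unfolding \<tau>_def by (rule sample_time_mono[OF r(2)])
  have \<xi>_less: "\<xi> t = f i t" if "\<tau> i \<le> t" "t < \<tau> (Suc i)" for t i
  proof -
    have "(LEAST i. t < \<tau> (Suc i)) = i"
    proof (rule Least_equality)
      fix j assume "t < \<tau> (Suc j)"
      then show "i \<le> j" using \<tau>_mono[of "Suc j" i] that by (meson leD le_less_trans not_less_eq_eq)
    qed (use that in simp)
    then show ?thesis by (simp add: \<xi>_def)
  qed
  have \<xi>_eq: "\<xi> t = f i t" if "\<tau> i \<le> t" "t \<le> \<tau> (Suc i)" for t i
  proof (cases "t = \<tau> (Suc i)")
    case True
    then show ?thesis using \<xi>_less[of "Suc i" t] \<tau>(2)[of "Suc i"] f(3)[of i] by simp
  next
    case False
    then show ?thesis using \<xi>_less that by simp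
  qed
  have "solution_on F_sw r' \<xi>0 d w (horizon r' w) \<xi>"
  proof (rule solution_onI)
    show "\<xi> 0 = \<xi>0" using \<xi>_less[of 0 0] \<tau>(2)[of 0] f(2) by (simp add: \<tau>_def)
    fix i t assume t: "sample_time r' w i \<le> t" "t \<le> sample_time r' w (Suc i)"
    have "integral_curve (\<lambda>s. F_sw (d s) (f i s) (f i (\<tau> i))) (\<tau> i) t (f i)"
      using f(1)[of i] t unfolding piece_def \<tau>_def by (blast intro: integral_curve_initial)
    then have "integral_curve (\<lambda>s. F_sw (d s) (\<xi> s) (\<xi> (\<tau> i))) (\<tau> i) t \<xi>"
    proof (rule integral_curve_cong)
      fix s assume "s \<in> {\<tau> i..t}"
      then have "\<xi> s = f i s" "\<xi> (\<tau> i) = f i (\<tau> i)"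
        using t \<xi>_eq[of i] \<tau>(2)[of i] unfolding \<tau>_def[symmetric] by auto
      then show "F_sw (d s) (\<xi> s) (\<xi> (\<tau> i)) = F_sw (d s) (f i s) (f i (\<tau> i)) \<and> \<xi> s = f i s"
        by simp
    qed
    then show "integral_curve (\<lambda>s. F_sw (d s) (\<xi> s) (\<xi> (sample_time r' w i))) (sample_time r' w i) t \<xi>"
      by (simp only: \<tau>_def)
  qed simp
  then show ?thesis by blast
qed

section \<open>Behaviour of arbitrary solutions of the switched loop\<close>

lemma solution_loop_arc:
  assumes sol: "solution_on F_sw r' \<xi>0 d w T \<xi>" and d: "d \<in> Linf_loc D" and w: "w \<in> Linf_loc {0..}"
    and V: "V (\<xi> (sample_time r' w i)) < R\<^sup>2"
    and t: "sample_time r' w i \<le> t" "t \<le> sample_time r' w (Suc i)" "ereal t < T"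
  shows "loop_arc d (sample_time r' w i) t \<xi>" "t - sample_time r' w i \<le> r'"
proof -
  have "switched k (\<xi> (sample_time r' w i)) = feedback (\<xi> (sample_time r' w i))"
    using V by (simp add: switched_def)
  then have "integral_curve (\<lambda>s. \<Phi> (d s, fst (\<xi> s), feedback (\<xi> (sample_time r' w i)))) (sample_time r' w i) t \<xi>"
    using solution_on_integral_curve[OF sol t] by simp
  then show "loop_arc d (sample_time r' w i) t \<xi>"
    using V d sample_time_nonneg[OF r(2), of w i] by (auto simp: loop_arc_def Linf_loc_def)
  show "t - sample_time r' w i \<le> r'" using sample_step[OF w, of i] t(2) by linarith
qed

text \<open>\<open>reaches\<close> accepts a solution on any \<open>[0, T)\<close> within the
  horizon. The x-part, cut off at the end of the current interval, therefore counts as a nominal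
  solution, whatever control is applied afterwards.\<close>

lemma solution_nominal:
  assumes sol: "solution_on F_sw r' \<xi>0 d w T \<xi>" and d: "d \<in> Linf_loc D" and w: "w \<in> Linf_loc {0..}"
    and V: "\<And>j. j \<le> i \<Longrightarrow> R\<^sup>2 \<le> V (\<xi> (sample_time r' w j))"
    and t: "sample_time r' w i \<le> t" "t < sample_time r' w (Suc i)" "ereal t < T"
  shows "reaches D F_nom r (fst \<xi>0) t (fst (\<xi> t))"
proof -
  define T' where "T' = min T (ereal (sample_time r' w (Suc i)))"
  have "solution_on F_nom r (fst \<xi>0) d (w_nom w) T' (\<lambda>t. fst (\<xi> t))"
  proof (rule solution_onI)
    show "T' \<le> horizon r (w_nom w)"
      using sol unfolding horizon_rescale[OF r(2,1)] by (auto simp: solution_on_def T'_def min_def)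
    show "fst (\<xi> 0) = fst \<xi>0" using sol by (simp add: solution_on_def)
    fix j s assume s0: "sample_time r (w_nom w) j \<le> s" "s \<le> sample_time r (w_nom w) (Suc j)" "ereal s < T'"
    note s = s0[unfolded sample_time_rescale[OF r(2,1)]]
    have "s < sample_time r' w (Suc i)" "ereal s < T" using s(3) by (auto simp: T'_def)
    then have "j \<le> i"
      using s(1) sample_time_mono[OF r(2), of "Suc i" j w] by (meson leD le_less_trans not_less_eq_eq)
    then have "switched k (\<xi> (sample_time r' w j)) = k (fst (\<xi> (sample_time r' w j)))"
      using V by (simp add: switched_def)
    then show "integral_curve (\<lambda>\<sigma>. F_nom (d \<sigma>) (fst (\<xi> \<sigma>)) (fst (\<xi> (sample_time r (w_nom w) j))))
        (sample_time r (w_nom w) j) s (\<lambda>t. fst (\<xi> t))"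
      using integral_curve_fst[OF solution_on_integral_curve[OF sol s(1,2) \<open>ereal s < T\<close>]]
      unfolding sample_time_rescale[OF r(2,1)] by simp
  qed
  moreover have "ereal t < T'" using t by (simp add: T'_def)
  moreover have "0 \<le> t" using t(1) sample_time_nonneg[OF r(2)] order_trans by blast
  ultimately show ?thesis unfolding reaches_def using d w_nom[OF w] by blast
qed

text \<open>This is the source of stability: the third phase, once entered, is never left. Induction
  over samples reaches every time below the horizon, also when the samples accumulate.\<close>

lemma solution_unsaturated:
  assumes sol: "solution_on F_sw r' \<xi>0 d w T \<xi>" and d: "d \<in> Linf_loc D" and w: "w \<in> Linf_loc {0..}"
    and start: "V \<xi>0 < R\<^sup>2" "\<omega> * \<bar>Z \<xi>0\<bar> < 1" and t: "0 \<le> t" "ereal t < T"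
  shows "W (\<xi> t) \<le> W \<xi>0"
proof -
  define good where "good v \<longleftrightarrow> V v < R\<^sup>2 \<and> \<omega> * \<bar>Z v\<bar> < 1 \<and> W v \<le> W \<xi>0" for v
  have step: "good (\<xi> s)" if g: "good (\<xi> (sample_time r' w i))"
    and s: "sample_time r' w i \<le> s" "s \<le> sample_time r' w (Suc i)" "ereal s < T" for i s
  proof -
    note arc = solution_loop_arc[OF sol d w _ s]
    have "V (\<xi> s) < R\<^sup>2" "\<omega> * \<bar>Z (\<xi> s)\<bar> < 1"
      "W (\<xi> s) * (1 + \<gamma> * (s - sample_time r' w i)) \<le> W (\<xi> (sample_time r' w i))"
      using g s arc_V[OF arc] arc_Z[OF arc] arc_W[OF arc] by (auto simp: good_def)
    moreover have "W (\<xi> s) * 1 \<le> W (\<xi> s) * (1 + \<gamma> * (s - sample_time r' w i))"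
      using W_nonneg rates s by (intro mult_left_mono) auto
    ultimately show ?thesis using g by (simp add: good_def)
  qed
  have good: "good (\<xi> (sample_time r' w i))" if "ereal (sample_time r' w i) < T" for i
    using that
  proof (induction i)
    case 0
    then show ?case using sol start by (simp add: solution_on_def good_def)
  next
    case (Suc i)
    have "ereal (sample_time r' w i) < T"
      using Suc.prems sample_time_less_Suc[OF r(2), of w i] by (meson ereal_less_eq(3) le_less_trans less_imp_le)
    then show ?case using step[OF Suc.IH _ order_refl Suc.prems] sample_time_less_Suc[OF r(2), of w i] by simp
  qed
  have "ereal t < horizon r' w" using sol t(2) by (auto simp: solution_on_def)
  then obtain i where i: "sample_time r' w i \<le> t" "t < sample_time r' w (Suc i)"
    using horizon_sample_intervalE[OF r(2) t(1)] by blast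
  then have "ereal (sample_time r' w i) < T" using t(2) by (meson ereal_less_eq(3) le_less_trans)
  then have "good (\<xi> t)" using step[OF good] i t(2) by simp
  then show ?thesis by (simp add: good_def)
qed

text \<open>The three cases: the nominal feedback is still active; the saturated feedback is active and
  \<open>z\<close> is still decreasing; the unsaturated feedback is active.\<close>

definition phase_bounds :: "real \<Rightarrow> real \<Rightarrow> real \<Rightarrow> real \<Rightarrow> real \<Rightarrow> real \<Rightarrow> real \<Rightarrow> 'a \<times> real \<Rightarrow> bool"
  where "phase_bounds T1 T2 X Y Q C t v \<longleftrightarrow>
    (t \<le> T1 \<and> norm (fst v) \<le> X \<and> \<bar>snd v\<bar> \<le> Y) \<or>
    (t \<le> T2 \<and> V v < R\<^sup>2 \<and> (Z v)\<^sup>2 \<le> Q) \<or>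
    (V v < R\<^sup>2 \<and> \<omega> * \<bar>Z v\<bar> < 1 \<and> W v * (1 + \<gamma> * max 0 (t - T2)) \<le> C)"

text \<open>The constants depend on R0 but not on the inputs, as boundedness and uniform
  attractivity require. Their uniformity comes from that of the nominal RGAS properties and from the
  fixed rates \<nu> and \<gamma>.\<close>

lemma reaches_phase_bounds:
  assumes R0: "R0 \<ge> 0"
  shows "\<exists>T1 T2 X Y Q C. 0 \<le> T1 \<and> T1 \<le> T2 \<and>
    (\<forall>\<xi>0 t v. norm \<xi>0 \<le> R0 \<and> reaches D F_sw r' \<xi>0 t v \<longrightarrow> phase_bounds T1 T2 X Y Q C t v)"
proof -
  \<comment> \<open>Boundedness is formulated for positive radii, whereas R0 may be 0.\<close>
  have "bdd_above {norm v | v t x0. norm x0 \<le> R0 + 1 \<and> reaches D F_nom r x0 t v}"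
    using nominal R0 unfolding RGAS_def by auto
  then obtain X0 where X0: "\<And>v t x0. norm x0 \<le> R0 + 1 \<Longrightarrow> reaches D F_nom r x0 t v \<Longrightarrow> norm v \<le> X0"
    unfolding bdd_above_def by blast
  \<comment> \<open>\<rho> covers states with \<open>V < R^2\<close>, such as the sample that ends
    the nominal phase, where \<open>solution_nominal\<close> no longer applies.\<close>
  define X where "X = max X0 \<rho>"
  have X: "0 \<le> X" "X0 \<le> X" "\<rho> \<le> X" using \<rho>_ge_1 by (auto simp: X_def)
  obtain \<eta> where \<eta>: "\<eta> > 0" "\<And>\<xi>. norm \<xi> \<le> \<eta> \<Longrightarrow> W \<xi> < R\<^sup>2"
    using W_small[of "R\<^sup>2"] pos by auto
  have V_small: "V \<xi> < R\<^sup>2" if "norm (fst \<xi>) \<le> \<eta>" for \<xi>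
  proof -
    have "V \<xi> = V (fst \<xi>, 0)" by (simp add: V_def)
    also have "\<dots> \<le> W (fst \<xi>, 0)" using pos by (simp add: W_def)
    also have "\<dots> < R\<^sup>2" using that by (intro \<eta>(2)) (simp add: norm_Pair)
    finally show ?thesis .
  qed
  obtain \<tau>0 where \<tau>0: "\<tau>0 \<ge> 0" "\<And>x0 t v. norm x0 \<le> R0 \<Longrightarrow> \<tau>0 \<le> t \<Longrightarrow> reaches D F_nom r x0 t v \<Longrightarrow> norm v \<le> \<eta>"
    using nominal \<eta>(1) R0 unfolding RGAS_def by meson
  \<comment> \<open>By attractivity, a sample at which k is applied comes before \<tau>0, and its
    interval has length at most r'.\<close>
  define T1 where "T1 = \<tau>0 + r'"
  have T1: "0 \<le> T1" using \<tau>0(1) r by (simp add: T1_def)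
  have "bounded (k ` cball 0 X)" using locally_bounded_compact[OF k] by simp
  then obtain Kb where Kb: "\<And>x. norm x \<le> X \<Longrightarrow> \<bar>k x\<bar> \<le> Kb"
    unfolding bounded_iff by (metis image_eqI mem_cball_0 real_norm_def)
  have "compact (\<Phi> ` (D \<times> cball 0 X \<times> {-Kb..Kb}))"
    using D by (intro compact_continuous_image continuous_on_subset[OF field_continuous] compact_Times) auto
  then have "bounded (\<Phi> ` (D \<times> cball 0 X \<times> {-Kb..Kb}))" by (rule compact_imp_bounded)
  then obtain C1 where C1: "\<And>v. v \<in> \<Phi> ` (D \<times> cball 0 X \<times> {-Kb..Kb}) \<Longrightarrow> norm v \<le> C1"
    unfolding bounded_iff by blast
  define C where "C = max 0 C1"
  have C0: "C \<ge> 0" by (simp add: C_def)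
  have C: "norm (\<Phi> (d, x, u)) \<le> C" if "d \<in> D" "norm x \<le> X" "\<bar>u\<bar> \<le> Kb" for d x u
  proof -
    have "(d, x, u) \<in> D \<times> cball 0 X \<times> {-Kb..Kb}" using that by auto
    then have "norm (\<Phi> (d, x, u)) \<le> C1" by (intro C1 imageI)
    then show "norm (\<Phi> (d, x, u)) \<le> C" by (simp add: C_def)
  qed
  \<comment> \<open>Y allows for linear growth of y until T1, and Zm bounds |Z| on entering the
    sublevel set. The budget \<open>Zm^2\<close> for the square of Z is then spent at rate \<nu>, at
    the latest by T2; Q adds what entry before T1 may leave over.\<close>
  define Y where "Y = R0 + C * T1"
  define Zm where "Zm = (1 + norm c) * (X + Y)"
  define Q where "Q = Zm\<^sup>2 + \<nu> * T1"
  define T2 where "T2 = T1 + Zm\<^sup>2 / \<nu>"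
  define Wm where "Wm = R\<^sup>2 + M * (1 / \<omega>)\<^sup>2"
  have T12: "T1 \<le> T2" using rates by (simp add: T2_def)
  have W_le: "W v \<le> Wm" if "V v < R\<^sup>2" "\<omega> * \<bar>Z v\<bar> < 1" for v
  proof -
    have "\<bar>Z v\<bar> \<le> 1 / \<omega>" using that(2) pos by (simp add: field_simps)
    then have "(Z v)\<^sup>2 \<le> (1 / \<omega>)\<^sup>2" using abs_le_square_iff[of "Z v" "1 / \<omega>"] pos by simp
    then have "M * (Z v)\<^sup>2 \<le> M * (1 / \<omega>)\<^sup>2" using pos by (intro mult_left_mono) auto
    then show ?thesis using that(1) unfolding W_def Wm_def by linarith
  qed
  \<comment> \<open>Both clocks start at the fixed times T1 and T2 instead of the actual switching
    times. Switching earlier only makes the inequalities easier: until T2 the decay factor of phase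
    3 is 1.\<close>
  define phase2 phase3
    where "phase2 t v \<longleftrightarrow> V v < R\<^sup>2 \<and> (Z v)\<^sup>2 + \<nu> * (t - T1) \<le> Zm\<^sup>2"
      and "phase3 t v \<longleftrightarrow> V v < R\<^sup>2 \<and> \<omega> * \<bar>Z v\<bar> < 1 \<and> W v * (1 + \<gamma> * max 0 (t - T2)) \<le> Wm" for t v
  have phase2_T2: "t \<le> T2" if "phase2 t v" for t v
  proof -
    have "\<nu> * (t - T1) \<le> Zm\<^sup>2" using that zero_le_power2[of "Z v"] unfolding phase2_def by linarith
    then have "t - T1 \<le> Zm\<^sup>2 / \<nu>" using rates by (simp add: field_simps)
    then show ?thesis by (simp add: T2_def)
  qed
  have phase23: "phase3 t v" if "phase2 t v" "\<omega> * \<bar>Z v\<bar> < 1" for t v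
    using that phase2_T2[OF that(1)] W_le[of v] by (simp add: phase3_def phase2_def max_def)
  have main: "(t \<le> T1 \<and> norm (fst (\<xi> t)) \<le> X \<and> \<bar>snd (\<xi> t)\<bar> \<le> Y) \<or> phase2 t (\<xi> t) \<or> phase3 t (\<xi> t)"
    if sol: "solution_on F_sw r' \<xi>0 d w T \<xi>" and d: "d \<in> Linf_loc D" and w: "w \<in> Linf_loc {0..}"
      and \<xi>0: "norm \<xi>0 \<le> R0" and t: "0 \<le> t" "ereal t < T" for \<xi>0 d w T \<xi> t
  proof -
    define \<tau> where "\<tau> i = sample_time r' w i" for i
    have \<tau>: "0 \<le> \<tau> i" "\<tau> i < \<tau> (Suc i)" "\<tau> (Suc i) - \<tau> i \<le> r'" for i
      using sample_time_nonneg[OF r(2)] sample_time_less_Suc[OF r(2)] sample_step[OF w] by (auto simp only: \<tau>_def)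
    have fst0: "norm (fst \<xi>0) \<le> R0" "\<bar>snd \<xi>0\<bar> \<le> R0"
      using \<xi>0 norm_fst_le[of "fst \<xi>0" "snd \<xi>0"] norm_snd_le[of "snd \<xi>0" "fst \<xi>0"] by auto
    define high where "high i \<longleftrightarrow> (\<forall>j\<le>i. R\<^sup>2 \<le> V (\<xi> (\<tau> j))) \<and> \<bar>snd (\<xi> (\<tau> i))\<bar> \<le> R0 + C * \<tau> i" for i
    have reach: "reaches D F_nom r (fst \<xi>0) s (fst (\<xi> s))"
      if "\<And>j. j \<le> i \<Longrightarrow> R\<^sup>2 \<le> V (\<xi> (\<tau> j))" "\<tau> i \<le> s" "s < \<tau> (Suc i)" "ereal s < T" for i s
      using that unfolding \<tau>_def by (rule solution_nominal[OF sol d w])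
    have high_step: "s \<le> T1 \<and> norm (fst (\<xi> s)) \<le> X \<and> \<bar>snd (\<xi> s)\<bar> \<le> R0 + C * s"
      if hi: "high i" and s: "\<tau> i \<le> s" "s \<le> \<tau> (Suc i)" "ereal s < T" for i s
    proof -
      have hj: "\<And>j. j \<le> i \<Longrightarrow> R\<^sup>2 \<le> V (\<xi> (\<tau> j))" using hi by (simp add: high_def)
      have iT: "ereal (\<tau> i) < T" using s by (meson ereal_less_eq(3) le_less_trans)
      have "\<not> \<tau>0 \<le> \<tau> i"
      proof
        assume "\<tau>0 \<le> \<tau> i"
        then have "norm (fst (\<xi> (\<tau> i))) \<le> \<eta>"
          using \<tau>0(2) fst0(1) reach[OF hj order_refl \<tau>(2) iT] by blast
        then show False using V_small hj[of i] by fastforce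
      qed
      then have sT: "s \<le> T1" using s(2) \<tau>(3)[of i] by (simp add: T1_def)
      have fstX: "norm (fst (\<xi> \<sigma>)) \<le> X" if \<sigma>: "\<tau> i \<le> \<sigma>" "\<sigma> \<le> \<tau> (Suc i)" "ereal \<sigma> < T" for \<sigma>
      proof (cases "V (\<xi> \<sigma>) < R\<^sup>2")
        case True
        then show ?thesis using norm_fst_le_\<rho>[of "\<xi> \<sigma>"] X(3) by simp
      next
        case False
        have "reaches D F_nom r (fst \<xi>0) \<sigma> (fst (\<xi> \<sigma>))"
        \<comment> \<open>\<open>solution_nominal\<close> stops short of the next sample. At that
          sample itself, \<open>V \<ge> R^2\<close> means that k is applied again, so the lemma is
          used with \<open>Suc i\<close>.\<close>
        proof (cases "\<sigma> = \<tau> (Suc i)")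
          case True
          have "R\<^sup>2 \<le> V (\<xi> (\<tau> j))" if "j \<le> Suc i" for j
            using that hj[of j] False True by (cases "j = Suc i") auto
          then show ?thesis using reach[of "Suc i" \<sigma>] True \<tau>(2)[of "Suc i"] \<sigma>(3) by simp
        next
          case False
          then show ?thesis using reach[OF hj] \<sigma> by simp
        qed
        then have "norm (fst (\<xi> \<sigma>)) \<le> X0" using X0 fst0(1) by force
        then show ?thesis using X(2) by linarith
      qed
      have "norm (\<xi> s - \<xi> (\<tau> i)) \<le> C * (s - \<tau> i)"
      proof (rule integral_curve_dist_le)
        show "integral_curve (\<lambda>\<sigma>. \<Phi> (d \<sigma>, fst (\<xi> \<sigma>), switched k (\<xi> (\<tau> i)))) (\<tau> i) s \<xi>"
          using solution_on_integral_curve[OF sol] s unfolding \<tau>_def by simp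
        fix \<sigma> assume \<sigma>: "\<sigma> \<in> {\<tau> i..s}"
        then have "ereal \<sigma> < T" using s(3) by (meson atLeastAtMost_iff ereal_less_eq(3) le_less_trans)
        then have "norm (fst (\<xi> \<sigma>)) \<le> X" using fstX \<sigma> s(2) by simp
        moreover have "\<bar>switched k (\<xi> (\<tau> i))\<bar> \<le> Kb"
          using hj[of i] Kb fstX[of "\<tau> i"] iT \<tau>(2)[of i] by (simp add: switched_def)
        moreover have "d \<sigma> \<in> D" using d \<sigma> \<tau>(1)[of i] by (auto simp: Linf_loc_def)
        ultimately show "norm (\<Phi> (d \<sigma>, fst (\<xi> \<sigma>), switched k (\<xi> (\<tau> i)))) \<le> C"
          by (intro C)
      qed (use s in auto)
      moreover have "\<bar>snd (\<xi> s) - snd (\<xi> (\<tau> i))\<bar> \<le> norm (\<xi> s - \<xi> (\<tau> i))"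
        unfolding snd_diff[symmetric] by (metis norm_snd_le prod.collapse real_norm_def)
      moreover have "\<bar>snd (\<xi> (\<tau> i))\<bar> \<le> R0 + C * \<tau> i" using hi by (simp add: high_def)
      ultimately have "\<bar>snd (\<xi> s)\<bar> \<le> R0 + C * s" by (simp add: right_diff_distrib)
      then show ?thesis using sT fstX[OF s] by simp
    qed
    have snd_Y: "\<bar>snd (\<xi> s)\<bar> \<le> Y" if "\<bar>snd (\<xi> s)\<bar> \<le> R0 + C * s" "s \<le> T1" for s
      using that mult_left_mono[OF that(2) C0] by (simp add: Y_def)
    have enter: "phase2 s (\<xi> s)" if "V (\<xi> s) < R\<^sup>2" "s \<le> T1" "norm (fst (\<xi> s)) \<le> X" "\<bar>snd (\<xi> s)\<bar> \<le> Y" for s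
    proof -
      have "norm (\<xi> s) \<le> X + Y"
        using that norm_Pair_le[of "fst (\<xi> s)" "snd (\<xi> s)"] by simp
      then have "\<bar>Z (\<xi> s)\<bar> \<le> Zm"
        using abs_Z_le[of "\<xi> s"] mult_left_mono[of "norm (\<xi> s)" "X + Y" "1 + norm c"] by (simp add: Zm_def)
      then have "(Z (\<xi> s))\<^sup>2 \<le> Zm\<^sup>2"
        using abs_le_square_iff[of "Z (\<xi> s)" Zm] by simp
      moreover have "\<nu> * (s - T1) \<le> 0" using that rates by (simp add: mult_nonneg_nonpos)
      ultimately show ?thesis using that(1) by (simp add: phase2_def)
    qed
    have low_step: "phase2 s (\<xi> s) \<or> phase3 s (\<xi> s)"
      if ph: "phase2 (\<tau> i) (\<xi> (\<tau> i)) \<or> phase3 (\<tau> i) (\<xi> (\<tau> i))"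
        and s: "\<tau> i \<le> s" "s \<le> \<tau> (Suc i)" "ereal s < T" for i s
    proof -
      have Vi: "V (\<xi> (\<tau> i)) < R\<^sup>2" using ph by (auto simp: phase2_def phase3_def)
      have arc: "loop_arc d (\<tau> i) s \<xi>" "s - \<tau> i \<le> r'"
        using solution_loop_arc[OF sol d w, of i s] Vi s by (auto simp: \<tau>_def)
      have Vs: "V (\<xi> s) < R\<^sup>2" using arc_V[OF arc] s by simp
      show ?thesis
      proof (cases "\<omega> * \<bar>Z (\<xi> (\<tau> i))\<bar> < 1")
        case True
        then have "phase3 (\<tau> i) (\<xi> (\<tau> i))" using ph phase23 by blast
        then have "W (\<xi> s) * (1 + \<gamma> * max 0 (\<tau> i - T2 + (s - \<tau> i))) \<le> Wm"
          using arc_W[OF arc _ True, of s] s W_nonneg rates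
          by (intro decay_chain[where w = "W (\<xi> (\<tau> i))"]) (auto simp: phase3_def)
        then have "phase3 s (\<xi> s)"
          using Vs arc_Z[OF arc _ True, of s] s by (simp add: phase3_def)
        then show ?thesis ..
      next
        case False
        then have "phase2 (\<tau> i) (\<xi> (\<tau> i))" using ph by (simp add: phase3_def)
        moreover have "(Z (\<xi> s))\<^sup>2 \<le> (Z (\<xi> (\<tau> i)))\<^sup>2 - \<nu> * (s - \<tau> i)"
          using arc_saturated[OF arc, of s] False s by simp
        ultimately have "phase2 s (\<xi> s)" using Vs by (simp add: phase2_def right_diff_distrib)
        then show ?thesis ..
      qed
    qed
    have samples: "high i \<or> phase2 (\<tau> i) (\<xi> (\<tau> i)) \<or> phase3 (\<tau> i) (\<xi> (\<tau> i))" if "ereal (\<tau> i) < T" for i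
      using that
    proof (induction i)
      case 0
      have e: "\<tau> 0 = 0" "\<xi> 0 = \<xi>0" using sol by (auto simp: \<tau>_def solution_on_def)
      show ?case
      proof (cases "V \<xi>0 < R\<^sup>2")
        case True
        have "R0 \<le> Y" using C0 T1 by (simp add: Y_def)
        moreover have "norm (fst \<xi>0) \<le> X" using norm_fst_le_\<rho>[of \<xi>0] True X(3) by simp
        ultimately have "phase2 0 (\<xi> 0)" using enter[of 0] e True T1 fst0 by simp
        then show ?thesis by (simp add: e)
      next
        case False
        then show ?thesis using fst0 by (simp add: high_def e)
      qed
    next
      case (Suc i)
      have iT: "ereal (\<tau> i) < T"
        using Suc.prems \<tau>(2)[of i] by (meson ereal_less_eq(3) le_less_trans less_imp_le)
      from Suc.IH[OF this] show ?case
      proof (elim disjE)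
        assume hi: "high i"
        note hs = high_step[OF hi less_imp_le[OF \<tau>(2)] order_refl Suc.prems]
        show ?case
        proof (cases "V (\<xi> (\<tau> (Suc i))) < R\<^sup>2")
          case True
          then show ?thesis using enter hs snd_Y by blast
        next
          case False
          then have "R\<^sup>2 \<le> V (\<xi> (\<tau> j))" if "j \<le> Suc i" for j
            using hi that by (cases "j = Suc i") (auto simp: high_def)
          then show ?thesis using hs by (simp add: high_def)
        qed
      qed (use low_step[OF _ less_imp_le[OF \<tau>(2)] order_refl Suc.prems] in blast)+
    qed
    have "ereal t < horizon r' w" using sol t(2) by (auto simp: solution_on_def)
    then obtain i where i: "\<tau> i \<le> t" "t < \<tau> (Suc i)"
      using horizon_sample_intervalE[OF r(2) t(1)] unfolding \<tau>_def by blast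
    then have "ereal (\<tau> i) < T" using t(2) by (meson ereal_less_eq(3) le_less_trans)
    from samples[OF this] show ?thesis
      using high_step[OF _ i(1) less_imp_le[OF i(2)] t(2)] low_step[OF _ i(1) less_imp_le[OF i(2)] t(2)] snd_Y
      by blast
  qed
  have phase2_Q: "(Z v)\<^sup>2 \<le> Q" if "phase2 t v" "0 \<le> t" for t v
  proof -
    have "0 \<le> \<nu> * t" using rates that by simp
    then show ?thesis using that(1) by (simp add: phase2_def Q_def right_diff_distrib)
  qed
  have "phase_bounds T1 T2 X Y Q Wm t v" if "norm \<xi>0 \<le> R0" and rv: "reaches D F_sw r' \<xi>0 t v" for \<xi>0 t v
  proof -
    obtain d w T \<xi> where *: "d \<in> Linf_loc D" "w \<in> Linf_loc {0..}" "solution_on F_sw r' \<xi>0 d w T \<xi>"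
        "0 \<le> t" "ereal t < T" "v = \<xi> t"
      using rv unfolding reaches_def by blast
    show ?thesis
      using main[OF *(3,1,2) that(1) *(4,5)] phase2_T2[of t "\<xi> t"] phase2_Q[of t "\<xi> t"] *(4,6)
      by (auto simp: phase2_def phase3_def phase_bounds_def)
  qed
  then show ?thesis using T1 T12 by blast
qed

theorem switched_RGAS: "RGAS D F_sw r'"
  unfolding RGAS_def
proof (intro conjI allI impI ballI)
  show "\<exists>\<xi>. solution_on F_sw r' \<xi>0 d w (horizon r' w) \<xi>" if "d \<in> Linf_loc D" "w \<in> Linf_loc {0..}" for \<xi>0 d w
    using that by (rule global_solution_exists)
  obtain \<kappa> where \<kappa>: "\<kappa> > 0" "\<And>\<xi>. \<kappa> * (norm \<xi>)\<^sup>2 \<le> W \<xi>" using W_coercive by blast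
  have norm_le: "norm v \<le> e" if "e > 0" "W v \<le> \<kappa> * e\<^sup>2" for v e
  proof -
    have "\<kappa> * (norm v)\<^sup>2 \<le> \<kappa> * e\<^sup>2" using \<kappa>(2)[of v] that by linarith
    then have "(norm v)\<^sup>2 \<le> e\<^sup>2" using \<kappa>(1) by simp
    then show ?thesis by (rule power2_le_imp_le) (use that(1) in simp)
  qed
  fix \<epsilon> :: real assume \<epsilon>: "\<epsilon> > 0"
  show "bdd_above {norm v | v t \<xi>0. norm \<xi>0 \<le> \<epsilon> \<and> reaches D F_sw r' \<xi>0 t v}"
  proof -
    obtain T1 T2 X Y Q C where T: "0 \<le> T1" "T1 \<le> T2"
      and ph: "\<And>\<xi>0 t v. norm \<xi>0 \<le> \<epsilon> \<Longrightarrow> reaches D F_sw r' \<xi>0 t v \<Longrightarrow> phase_bounds T1 T2 X Y Q C t v"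
      using reaches_phase_bounds[OF less_imp_le[OF \<epsilon>]] by blast
    have V_bound: "norm v \<le> \<rho> + (q + norm c * \<rho>)" if "V v < R\<^sup>2" "\<bar>Z v\<bar> \<le> q" for v q
    proof -
      have fst: "norm (fst v) \<le> \<rho>" using norm_fst_le_\<rho> that(1) by simp
      have "\<bar>c \<bullet> fst v\<bar> \<le> norm c * \<rho>"
        using Cauchy_Schwarz_ineq2[of c "fst v"] mult_left_mono[OF fst, of "norm c"] by simp
      then have "\<bar>snd v\<bar> \<le> q + norm c * \<rho>" using that(2) by (simp add: Z_def)
      then show ?thesis using fst norm_Pair_le[of "fst v" "snd v"] by simp
    qed
    show ?thesis
    proof (rule bdd_aboveI)
      fix n assume "n \<in> {norm v | v t \<xi>0. norm \<xi>0 \<le> \<epsilon> \<and> reaches D F_sw r' \<xi>0 t v}"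
      then obtain \<xi>0 t v where n: "n = norm v" and "norm \<xi>0 \<le> \<epsilon>" "reaches D F_sw r' \<xi>0 t v"
        by blast
      from ph[OF this(2,3)] show "n \<le> max (X + Y) (max (\<rho> + (sqrt Q + norm c * \<rho>)) (\<rho> + (1 / \<omega> + norm c * \<rho>)))"
        unfolding phase_bounds_def
      proof (elim disjE conjE)
        assume "norm (fst v) \<le> X" "\<bar>snd v\<bar> \<le> Y"
        then have "n \<le> X + Y" using norm_Pair_le[of "fst v" "snd v"] n by simp
        then show ?thesis by simp
      next
        assume "V v < R\<^sup>2" "(Z v)\<^sup>2 \<le> Q"
        then have "n \<le> \<rho> + (sqrt Q + norm c * \<rho>)"
          unfolding n by (intro V_bound real_le_rsqrt) auto
        then show ?thesis by simp
      next
        assume "V v < R\<^sup>2" "\<omega> * \<bar>Z v\<bar> < 1"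
        then have "n \<le> \<rho> + (1 / \<omega> + norm c * \<rho>)"
          unfolding n using pos by (intro V_bound) (auto simp: field_simps)
        then show ?thesis by simp
      qed
    qed
  qed
  show "\<exists>\<delta>>0. \<forall>\<xi>0 t v. norm \<xi>0 \<le> \<delta> \<and> reaches D F_sw r' \<xi>0 t v \<longrightarrow> norm v \<le> \<epsilon>"
  proof -
    \<comment> \<open>The three thresholds for W force \<open>V < R^2\<close>, then
      \<open>\<omega> |Z| < 1\<close>, and finally norm at most \<epsilon> by coercivity.\<close>
    obtain \<eta> where \<eta>: "\<eta> > 0" "\<And>\<xi>. norm \<xi> \<le> \<eta> \<Longrightarrow> W \<xi> < Min {R\<^sup>2, M * (1 / \<omega>)\<^sup>2, \<kappa> * \<epsilon>\<^sup>2}"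
      using W_small[of "Min {R\<^sup>2, M * (1 / \<omega>)\<^sup>2, \<kappa> * \<epsilon>\<^sup>2}"] pos \<kappa>(1) \<epsilon> by auto
    have "norm v \<le> \<epsilon>" if "norm \<xi>0 \<le> \<eta>" and rv: "reaches D F_sw r' \<xi>0 t v" for \<xi>0 t v
    proof -
      have W0: "W \<xi>0 < R\<^sup>2" "W \<xi>0 < M * (1 / \<omega>)\<^sup>2" "W \<xi>0 < \<kappa> * \<epsilon>\<^sup>2"
        using \<eta>(2)[OF that(1)] by auto
      have V0: "V \<xi>0 < R\<^sup>2" using W0(1) pos by (auto simp: W_def intro: le_less_trans[rotated])
      have "M * (Z \<xi>0)\<^sup>2 < M * (1 / \<omega>)\<^sup>2" using W0(2) V_nonneg[of \<xi>0] unfolding W_def by linarith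
      then have "(Z \<xi>0)\<^sup>2 < (1 / \<omega>)\<^sup>2" using pos by (simp only: mult_less_cancel_left_pos)
      then have "\<bar>Z \<xi>0\<bar> < \<bar>1 / \<omega>\<bar>" by (simp only: not_le[symmetric] abs_le_square_iff simp_thms)
      then have Z0: "\<omega> * \<bar>Z \<xi>0\<bar> < 1" using pos by (simp add: field_simps)
      obtain d w T \<xi> where *: "d \<in> Linf_loc D" "w \<in> Linf_loc {0..}" "solution_on F_sw r' \<xi>0 d w T \<xi>"
          "0 \<le> t" "ereal t < T" "v = \<xi> t"
        using rv unfolding reaches_def by blast
      have "W v \<le> W \<xi>0" unfolding *(6) by (rule solution_unsaturated[OF *(3,1,2) V0 Z0 *(4,5)])
      then show ?thesis using W0(3) by (intro norm_le[OF \<epsilon>]) linarith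
    qed
    then show ?thesis using \<eta>(1) by blast
  qed
  fix R0 :: real assume R0: "R0 \<ge> 0"
  show "\<exists>\<tau>\<ge>0. \<forall>\<xi>0 t v. norm \<xi>0 \<le> R0 \<and> \<tau> \<le> t \<and> reaches D F_sw r' \<xi>0 t v \<longrightarrow> norm v \<le> \<epsilon>"
  proof -
    obtain T1 T2 X Y Q C where T: "0 \<le> T1" "T1 \<le> T2"
      and ph: "\<And>\<xi>0 t v. norm \<xi>0 \<le> R0 \<Longrightarrow> reaches D F_sw r' \<xi>0 t v \<Longrightarrow> phase_bounds T1 T2 X Y Q C t v"
      using reaches_phase_bounds[OF R0] by blast
    \<comment> \<open>After this time
      \<open>\<gamma> \<kappa> \<epsilon>^2 (t - T2) \<ge> |C|\<close>, so W above
      \<open>\<kappa> \<epsilon>^2\<close> would violate the decay bound. The summand 1 gives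
      \<open>t > T2\<close>, which excludes the first two phases.\<close>
    define \<tau> where "\<tau> = T2 + (1 + \<bar>C\<bar> / (\<gamma> * \<kappa> * \<epsilon>\<^sup>2))"
    have \<gamma>\<kappa>: "\<gamma> * \<kappa> * \<epsilon>\<^sup>2 > 0" using rates \<kappa>(1) \<epsilon> by simp
    then have q: "0 \<le> \<bar>C\<bar> / (\<gamma> * \<kappa> * \<epsilon>\<^sup>2)" by simp
    have "norm v \<le> \<epsilon>" if "norm \<xi>0 \<le> R0" "\<tau> \<le> t" "reaches D F_sw r' \<xi>0 t v" for \<xi>0 t v
    proof (rule norm_le[OF \<epsilon>], rule ccontr)
      assume not: "\<not> W v \<le> \<kappa> * \<epsilon>\<^sup>2"
      have t: "T2 < t" "\<bar>C\<bar> / (\<gamma> * \<kappa> * \<epsilon>\<^sup>2) \<le> t - T2"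
        using that(2) q by (auto simp: \<tau>_def)
      then have "W v * (1 + \<gamma> * (t - T2)) \<le> C"
        using ph[OF that(1,3)] T by (auto simp: phase_bounds_def)
      moreover have "\<kappa> * \<epsilon>\<^sup>2 * (1 + \<gamma> * (t - T2)) < W v * (1 + \<gamma> * (t - T2))"
        using not t(1) rates by (intro mult_strict_right_mono) (auto intro: add_pos_nonneg)
      moreover have "\<bar>C\<bar> \<le> (t - T2) * (\<gamma> * \<kappa> * \<epsilon>\<^sup>2)"
        using t(2) \<gamma>\<kappa> by (simp only: pos_divide_le_eq)
      then have "\<bar>C\<bar> \<le> \<kappa> * \<epsilon>\<^sup>2 * (1 + \<gamma> * (t - T2))"
      proof -
        have "\<kappa> * \<epsilon>\<^sup>2 * (1 + \<gamma> * (t - T2)) = \<kappa> * \<epsilon>\<^sup>2 + (t - T2) * (\<gamma> * \<kappa> * \<epsilon>\<^sup>2)"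
          by (simp add: algebra_simps)
        moreover have "0 \<le> \<kappa> * \<epsilon>\<^sup>2" using \<kappa>(1) by simp
        ultimately show ?thesis using \<open>\<bar>C\<bar> \<le> (t - T2) * (\<gamma> * \<kappa> * \<epsilon>\<^sup>2)\<close> by linarith
      qed
      ultimately show False by linarith
    qed
    moreover have "\<tau> \<ge> 0" using T q by (simp add: \<tau>_def)
    ultimately show ?thesis by blast
  qed
qed

end

text \<open>The arc lemmas bound the step before r' is fixed; each smaller r' then gives an instance
  of \<open>switched_loop\<close>. The bound r is included so that the nominal system can be
  compared by slowing its sampling down to r'.\<close>

theorem (in saturated_loop) RGAS_of_nominal:
  assumes r: "r > 0" and k: "locally_bounded k"
    and nominal: "RGAS D (\<lambda>d x x\<^sub>\<tau>. fst (\<Phi> (d, x, k x\<^sub>\<tau>))) r"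
  shows "\<exists>r_max>0. \<forall>r'. 0 < r' \<and> r' \<le> r_max \<longrightarrow>
    RGAS D (\<lambda>d \<xi> \<xi>\<^sub>\<tau>. \<Phi> (d, fst \<xi>, switched k \<xi>\<^sub>\<tau>)) r'"
proof -
  obtain h1 where h1: "h1 > 0" and dyn: "\<And>d a b \<xi> t. loop_arc d a b \<xi> \<Longrightarrow> b - a \<le> h1 \<Longrightarrow> t \<in> {a..b} \<Longrightarrow>
    V (\<xi> t) < R\<^sup>2 \<and> (1 \<le> \<omega> * \<bar>Z (\<xi> a)\<bar> \<longrightarrow> (Z (\<xi> t))\<^sup>2 \<le> (Z (\<xi> a))\<^sup>2 - \<mu> / (2 * \<omega>) * (t - a)) \<and>
    (\<omega> * \<bar>Z (\<xi> a)\<bar> < 1 \<longrightarrow> \<omega> * \<bar>Z (\<xi> t)\<bar> < 1 \<and> W (\<xi> t) * (1 + \<delta> / (1 + M) * (t - a)) \<le> W (\<xi> a))"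
    using loop_arc_dynamics by blast
  obtain h2 where h2: "h2 > 0" and ex: "\<And>d a b \<xi>0. d \<in> Linf_loc D \<Longrightarrow> 0 \<le> a \<Longrightarrow> a \<le> b \<Longrightarrow> b - a \<le> h2 \<Longrightarrow>
    V \<xi>0 < R\<^sup>2 \<Longrightarrow> \<exists>\<xi>. \<xi> a = \<xi>0 \<and> loop_arc d a b \<xi>"
    using loop_arc_exists by blast
  have "RGAS D (\<lambda>d \<xi> \<xi>\<^sub>\<tau>. \<Phi> (d, fst \<xi>, switched k \<xi>\<^sub>\<tau>)) r'"
    if r': "0 < r'" "r' \<le> min r (min h1 h2)" for r'
  proof -
    interpret switched_loop D \<Phi> P p c \<beta> M R K \<omega> \<delta> \<mu> \<rho> U L k r r' "\<mu> / (2 * \<omega>)" "\<delta> / (1 + M)"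
    proof
      show "0 < \<mu> / (2 * \<omega>)" "0 < \<delta> / (1 + M)" using pos by (simp_all add: add_pos_pos)
      fix d a b \<xi> t assume arc: "loop_arc d a b \<xi>" "b - a \<le> r'" "t \<in> {a..b}"
      then have "b - a \<le> h1" using r' by simp
      note * = dyn[OF arc(1) this arc(3)]
      show "V (\<xi> t) < R\<^sup>2" using * by blast
      show "(Z (\<xi> t))\<^sup>2 \<le> (Z (\<xi> a))\<^sup>2 - \<mu> / (2 * \<omega>) * (t - a)" if "1 \<le> \<omega> * \<bar>Z (\<xi> a)\<bar>"
        using * that by blast
      show "\<omega> * \<bar>Z (\<xi> t)\<bar> < 1" "W (\<xi> t) * (1 + \<delta> / (1 + M) * (t - a)) \<le> W (\<xi> a)"
        if "\<omega> * \<bar>Z (\<xi> a)\<bar> < 1"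
        using * that by blast+
    next
      fix d a b \<xi>0 assume "d \<in> Linf_loc D" "0 \<le> a" "a \<le> b" "b - a \<le> r'" "V \<xi>0 < R\<^sup>2"
      then show "\<exists>\<xi>. \<xi> a = \<xi>0 \<and> loop_arc d a b \<xi>" using ex r' by simp
    qed (use r r' k nominal in auto)
    show ?thesis by (rule switched_RGAS)
  qed
  moreover have "0 < min r (min h1 h2)" using r h1 h2 by simp
  ultimately show ?thesis by blast
qed

section \<open>The integrator chain\<close>

lemma outer_prod_mult_vec: "outer_prod u v *v x = (v \<bullet> x) *\<^sub>R u"
  by (simp add: outer_prod_def matrix_vector_mult_def inner_vec_def vec_eq_iff sum_distrib_left ac_simps)

lemma transpose_outer_prod: "transpose (outer_prod u v) = outer_prod v u"
  by (simp add: outer_prod_def transpose_def vec_eq_iff mult.commute)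

lemma transpose_add: "transpose (A + B) = transpose A + (transpose B :: real^'n^'m)"
  by (simp add: transpose_def vec_eq_iff)

text \<open>A kernel vector x of A annihilates both summands of the form, since they equal
  \<open>x'P(Ax)\<close> and \<open>(Ax)'Px\<close>. It ensures that \<open>matrix_inv\<close> in
  the definition of c is a genuine inverse.\<close>

lemma negative_definite_closed_loop_invertible:
  fixes A P :: "real^'n^'n"
  assumes "negative_definite (P ** A + transpose A ** P)"
  shows "invertible (transpose A)"
proof -
  have "x = 0" if x: "A *v x = 0" for x
  proof (rule ccontr)
    assume "x \<noteq> 0"
    then have "x \<bullet> ((P ** A + transpose A ** P) *v x) < 0"
      using assms by (simp add: negative_definite_def)
    moreover have "x \<bullet> ((transpose A ** P) *v x) = (A *v x) \<bullet> (P *v x)"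
      unfolding matrix_vector_mul_assoc[symmetric] transpose_matrix_vector
      by (metis dot_lmul_matrix inner_commute)
    ultimately show False
      by (simp add: matrix_vector_mult_add_rdistrib matrix_vector_mul_assoc[symmetric] x inner_add_right)
  qed
  then have "\<exists>B. B ** A = mat 1" by (simp add: matrix_left_invertible_ker)
  then have "invertible A" by (simp add: invertible_left_inverse)
  then show ?thesis by (rule transpose_invertible)
qed

theorem lemma3p1:
  fixes D :: "(real^'l) set"
    and A P :: "real^'n::{finite,linorder}^'n::{finite,linorder}"
    and b c p :: "real^'n::{finite,linorder}"
    and f :: "(real^'l) \<times> (real^'n::{finite,linorder}) \<times> real \<Rightarrow> real^'n::{finite,linorder}"
    and g :: "(real^'l) \<times> (real^'n::{finite,linorder}) \<times> real \<Rightarrow> real"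
    and k :: "real^'n::{finite,linorder} \<Rightarrow> real"
    and r M R K \<omega> \<delta> :: real
  assumes D: "D \<noteq> {}" "compact D"
    and b: "b = first_unit"
    and A: "A = shift_matrix"
    and f: "locally_lipschitz_on (D \<times> UNIV \<times> UNIV) f" "\<And>d. d \<in> D \<Longrightarrow> f (d, 0, 0) = 0"
    and g: "locally_lipschitz_on (D \<times> UNIV \<times> UNIV) g" "\<And>d. d \<in> D \<Longrightarrow> g (d, 0, 0) = 0"
    and r: "r > 0"
    and k: "locally_bounded k" "k 0 = 0" "isCont k 0"
    and nominal: "RGAS D (nominal_loop A b f k) r"
    and P: "transpose P = P" "positive_definite P"
    and p: "negative_definite
              (P ** (A + outer_prod b p) + (transpose A + outer_prod p b) ** P)"
    and c: "c = - (matrix_inv (transpose A + outer_prod p b) *v last_unit)"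
    and pos: "M > 0" "R > 0" "K > 0" "\<omega> > 0" "\<delta> > 0"
    and cond1: "Sup {x \<bullet> (P *v (A *v x + f (d, x, u) + u *\<^sub>R b)) | d x u.
                  d \<in> D \<and> x \<bullet> (P *v x) = R\<^sup>2 \<and> \<bar>u - p \<bullet> x\<bar> \<le> K * \<bar>c \<bullet> b\<bar>} < 0"
    and cond2: "Sup {\<bar>g (d, x, u) + c \<bullet> f (d, x, u)\<bar> | d x u.
                  d \<in> D \<and> x \<bullet> (P *v x) \<le> R\<^sup>2 \<and> \<bar>u - p \<bullet> x\<bar> \<le> K * \<bar>c \<bullet> b\<bar>} < K * (c \<bullet> b)\<^sup>2"
    and cond3: "\<And>d x z u. d \<in> D \<Longrightarrow> x \<bullet> (P *v x) \<le> R\<^sup>2 \<Longrightarrow> \<omega> * \<bar>z\<bar> \<le> 1 \<Longrightarrow>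
                  u = p \<bullet> x - K * (c \<bullet> b) * \<omega> * z \<Longrightarrow>
                  z * (M * g (d, x, u) + M * (c \<bullet> f (d, x, u)) - K * (c \<bullet> b) * \<omega> * (b \<bullet> (P *v x)))
                  \<le> (M * K * (c \<bullet> b)\<^sup>2 * \<omega> - \<delta>) * \<bar>z\<bar>\<^sup>2
                     - x \<bullet> (P *v ((A + outer_prod b p + mat \<delta>) *v x + f (d, x, u)))"
  shows "\<exists>r_max>0. \<forall>r'. 0 < r' \<and> r' \<le> r_max \<longrightarrow>
           RGAS D (augmented_loop A b f g (switched_feedback k P p b c R K \<omega>)) r'"
proof -
  define \<beta> where "\<beta> = c \<bullet> b"
  define \<Phi> where "\<Phi> = (\<lambda>q. (A *v fst (snd q) + f q + snd (snd q) *\<^sub>R b, last_comp (fst (snd q)) + g q))"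
  have \<Phi>: "fst (\<Phi> (d, x, u)) = A *v x + f (d, x, u) + u *\<^sub>R b" "snd (\<Phi> (d, x, u)) = last_comp x + g (d, x, u)" for d x u
    by (simp_all add: \<Phi>_def)
  have last: "last_comp x = last_unit \<bullet> x" for x :: "real^'n::{finite,linorder}"
    by (simp add: last_comp_def last_unit_def inner_axis' )
  have P_lin: "bounded_linear ((*v) P)" and A_lin: "bounded_linear ((*v) A)"
    by (simp_all add: matrix_vector_mul_bounded_linear)
  have P_sym: "x \<bullet> (P *v y) = (P *v x) \<bullet> y" for x y
    by (metis P(1) dot_lmul_matrix transpose_matrix_vector)

  text \<open>\<open>c\<close> is chosen such that \<open>c' (A + b p') x = - x\<^sub>n\<close>, which cancels the integrator input
    \<open>x\<^sub>n\<close> in the derivative of \<open>z = y + c' x\<close>.\<close>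

  have c_id: "c \<bullet> (A *v x) = - last_comp x - \<beta> * (p \<bullet> x)" for x
  proof -
    let ?E = "A + outer_prod b p"
    have t: "transpose ?E = transpose A + outer_prod p b"
      by (simp add: transpose_add transpose_outer_prod)
    have "invertible (transpose A + outer_prod p b)"
      using negative_definite_closed_loop_invertible[of P ?E] p by (simp add: t)
    then have "(transpose A + outer_prod p b) ** matrix_inv (transpose A + outer_prod p b) = mat 1"
      unfolding invertible_def matrix_inv_def by (rule someI_ex[THEN conjunct1])
    then have "transpose ?E *v c = - last_unit"
      unfolding t c by (simp add: vec.neg matrix_vector_mul_assoc)
    then have "(transpose ?E *v c) \<bullet> x = - last_comp x" by (simp add: last)
    moreover have "(transpose ?E *v c) \<bullet> x = c \<bullet> (?E *v x)"
      by (metis dot_lmul_matrix transpose_matrix_vector transpose_transpose)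
    ultimately show ?thesis
      by (simp add: matrix_vector_mult_add_rdistrib outer_prod_mult_vec inner_add_right \<beta>_def)
  qed
  have drift: "snd (\<Phi> (d, x, u)) + c \<bullet> fst (\<Phi> (d, x, u)) - \<beta> * (u - p \<bullet> x) = g (d, x, u) + c \<bullet> f (d, x, u)" for d x u
    by (simp add: \<Phi> inner_add_right c_id \<beta>_def algebra_simps)

  obtain \<kappa> where \<kappa>: "\<kappa> > 0" "\<And>x. \<kappa> * (norm x)\<^sup>2 \<le> x \<bullet> (P *v x)"
  proof -
    have "continuous_on (sphere 0 1) (\<lambda>x. x \<bullet> (P *v x))"
      by (intro continuous_intros bounded_linear.continuous_on[OF P_lin])
    moreover have "sphere (0 :: real^'n::{finite,linorder}) 1 \<noteq> {}"
      by (metis dist_0_norm empty_iff mem_sphere norm_axis_1)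
    ultimately obtain v where v: "v \<in> sphere 0 1" "\<And>w. w \<in> sphere 0 1 \<Longrightarrow> v \<bullet> (P *v v) \<le> w \<bullet> (P *v w)"
      using continuous_attains_inf[OF compact_sphere, of 0 1 "\<lambda>x. x \<bullet> (P *v x)"] by blast
    show ?thesis
    proof
      have "v \<noteq> 0" using v(1) by auto
      then show "v \<bullet> (P *v v) > 0" using P(2) by (simp add: positive_definite_def)
      show "v \<bullet> (P *v v) * (norm x)\<^sup>2 \<le> x \<bullet> (P *v x)" for x
      proof (cases "x = 0")
        case False
        define e where "e = inverse (norm x) *\<^sub>R x"
        have "x = norm x *\<^sub>R e" using False by (simp add: e_def)
        then have "x \<bullet> (P *v x) = (norm x *\<^sub>R e) \<bullet> (P *v (norm x *\<^sub>R e))" by simp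
        also have "\<dots> = (norm x)\<^sup>2 * (e \<bullet> (P *v e))"
          by (simp add: matrix_vector_mult_scaleR power2_eq_square)
        also have "\<dots> \<ge> (norm x)\<^sup>2 * (v \<bullet> (P *v v))"
          using False by (intro mult_left_mono v(2)) (auto simp: e_def)
        finally show ?thesis by (simp add: mult.commute)
      qed simp
    qed
  qed
  \<comment> \<open>The summand 1 leaves room for the unit balls of the Picard iteration.\<close>
  define \<rho> where "\<rho> = R / sqrt \<kappa> + 1"
  have norm_le: "norm x + 1 \<le> \<rho>" if "x \<bullet> (P *v x) \<le> R\<^sup>2" for x
  proof -
    have "(sqrt \<kappa> * norm x)\<^sup>2 \<le> R\<^sup>2"
      using \<kappa>(2)[of x] that \<kappa>(1) by (simp add: power_mult_distrib)
    then have "sqrt \<kappa> * norm x \<le> R" by (rule power2_le_imp_le) (use pos(2) in simp)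
    then show ?thesis using \<kappa>(1) by (simp add: \<rho>_def field_simps)
  qed
  define U where "U = norm p * \<rho> + K * \<bar>\<beta>\<bar>"

  have f_cont: "continuous_on (D \<times> UNIV \<times> UNIV) f" and g_cont: "continuous_on (D \<times> UNIV \<times> UNIV) g"
    using f(1) g(1) by (auto intro: locally_lipschitz_on_imp_continuous_on)
  have \<Phi>_cont: "continuous_on (D \<times> UNIV \<times> UNIV) \<Phi>"
    unfolding \<Phi>_def last
    by (intro continuous_intros f_cont g_cont bounded_linear.continuous_on[OF A_lin])

  let ?S = "D \<times> cball (0 :: real^'n::{finite,linorder}) \<rho> \<times> cball (0 :: real) U"
  have S: "compact ?S" "?S \<subseteq> D \<times> UNIV \<times> UNIV" using D(2) by (auto intro!: compact_Times)
  obtain Lf where Lf: "Lf-lipschitz_on ?S f" using locally_lipschitz_on_compact[OF f(1) S] by blast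
  obtain Lg where Lg: "Lg-lipschitz_on ?S g" using locally_lipschitz_on_compact[OF g(1) S] by blast
  obtain KA where KA: "KA > 0" "\<And>x. norm (A *v x) \<le> norm x * KA"
    using bounded_linear.pos_bounded[OF A_lin] by blast
  define L where "L = KA + Lf + norm b + 1 + Lg + 1"
  have L0: "Lf \<ge> 0" "Lg \<ge> 0" using Lf Lg by (auto dest: lipschitz_on_nonneg)
  have \<Phi>_lip: "norm (\<Phi> (d, x, u) - \<Phi> (d, x', u')) \<le> L * (norm (x - x') + \<bar>u - u'\<bar>)"
    if "d \<in> D" "norm x \<le> \<rho>" "norm x' \<le> \<rho>" "\<bar>u\<bar> \<le> U" "\<bar>u'\<bar> \<le> U" for d x x' u u'
  proof -
    define s where "s = norm (x - x') + \<bar>u - u'\<bar>"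
    have s: "norm (x - x') \<le> s" "\<bar>u - u'\<bar> \<le> s" "0 \<le> s" by (auto simp: s_def)
    have dist: "dist (d, x, u) (d, x', u') \<le> s"
      using norm_Pair_le[of "x - x'" "u - u'"]
      by (simp add: dist_norm norm_Pair s_def)
    have in_S: "(d, x, u) \<in> ?S" "(d, x', u') \<in> ?S" using that by auto
    have fle: "norm (f (d, x, u) - f (d, x', u')) \<le> Lf * s"
      using lipschitz_onD[OF Lf in_S] mult_left_mono[OF dist L0(1)] by (simp add: dist_norm)
    have gle: "\<bar>g (d, x, u) - g (d, x', u')\<bar> \<le> Lg * s"
      using lipschitz_onD[OF Lg in_S] mult_left_mono[OF dist L0(2)] by (simp add: dist_real_def)
    have Ale: "norm (A *v (x - x')) \<le> s * KA"
      using order_trans[OF KA(2) mult_right_mono[OF s(1)]] KA(1) by simp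
    have ble: "norm ((u - u') *\<^sub>R b) \<le> s * norm b"
      using mult_right_mono[OF s(2), of "norm b"] by simp
    have lle: "\<bar>last_comp (x - x')\<bar> \<le> s"
      using component_le_norm_cart[of "x - x'" "Max UNIV"] s(1) unfolding last_comp_def by linarith
    have "\<Phi> (d, x, u) - \<Phi> (d, x', u') =
      (A *v (x - x') + (f (d, x, u) - f (d, x', u')) + (u - u') *\<^sub>R b,
        last_comp (x - x') + (g (d, x, u) - g (d, x', u')))"
      by (simp add: \<Phi>_def matrix_vector_mult_diff_distrib last inner_diff_right algebra_simps)
    also have "norm \<dots> \<le> norm (A *v (x - x') + (f (d, x, u) - f (d, x', u')) + (u - u') *\<^sub>R b) +
        \<bar>last_comp (x - x') + (g (d, x, u) - g (d, x', u'))\<bar>"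
      using norm_Pair_le by (metis real_norm_def)
    also have "\<dots> \<le> (norm (A *v (x - x')) + norm (f (d, x, u) - f (d, x', u')) + norm ((u - u') *\<^sub>R b)) +
        (\<bar>last_comp (x - x')\<bar> + \<bar>g (d, x, u) - g (d, x', u')\<bar>)"
      by (intro add_mono norm_triangle_mono order_refl abs_triangle_ineq)
    also have "\<dots> \<le> (s * KA + Lf * s + s * norm b) + (s + Lg * s)"
      by (intro add_mono fle gle Ale ble lle)
    also have "\<dots> \<le> L * s" using s(3) by (simp add: L_def algebra_simps)
    finally show ?thesis by (simp add: s_def)
  qed

  \<comment> \<open>\<open>Sup\<close> of a set of reals bounds its elements only if the set is
    bounded above. The states and controls in question lie in the compact set \<open>?S\<close>,
    where continuous functions are bounded.\<close>
  let ?T = "{(d, x, u) | d x u. d \<in> D \<and> x \<bullet> (P *v x) \<le> R\<^sup>2 \<and> \<bar>u - p \<bullet> x\<bar> \<le> K * \<bar>\<beta>\<bar>}"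
  have T_S: "?T \<subseteq> ?S"
  proof
    fix q assume "q \<in> ?T"
    then obtain d x u where q: "q = (d, x, u)" and *: "d \<in> D" "x \<bullet> (P *v x) \<le> R\<^sup>2" "\<bar>u - p \<bullet> x\<bar> \<le> K * \<bar>\<beta>\<bar>"
      by blast
    have nx: "norm x \<le> \<rho>" using norm_le[OF *(2)] by simp
    have "\<bar>p \<bullet> x\<bar> \<le> norm p * \<rho>"
      using Cauchy_Schwarz_ineq2[of p x] mult_left_mono[OF nx, of "norm p"] by simp
    then have "\<bar>u\<bar> \<le> U" using *(3) unfolding U_def by linarith
    then show "q \<in> ?S" using * nx by (simp add: q)
  qed
  have bounded_T: "bounded (h ` ?T)" if "continuous_on (D \<times> UNIV \<times> UNIV) h"
    for h :: "(real^'l) \<times> (real^'n::{finite,linorder}) \<times> real \<Rightarrow> real"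
  proof (rule bounded_subset)
    show "bounded (h ` ?S)"
      by (intro compact_imp_bounded compact_continuous_image continuous_on_subset[OF that] S)
    show "h ` ?T \<subseteq> h ` ?S" using T_S by (rule image_mono)
  qed

  define h1 where "h1 = (\<lambda>q. fst (snd q) \<bullet> (P *v fst (\<Phi> q)))"
  define h2 where "h2 = (\<lambda>q. \<bar>g q + c \<bullet> f q\<bar>)"
  have "continuous_on (D \<times> UNIV \<times> UNIV) h1"
    unfolding h1_def by (intro continuous_intros \<Phi>_cont bounded_linear.continuous_on[OF P_lin])
  then have bd1: "bdd_above (h1 ` ?T)" by (rule bounded_imp_bdd_above[OF bounded_T])
  have "continuous_on (D \<times> UNIV \<times> UNIV) h2"
    unfolding h2_def by (intro continuous_intros f_cont g_cont)
  then have bd2: "bdd_above (h2 ` ?T)" by (rule bounded_imp_bdd_above[OF bounded_T])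
  let ?S1 = "{x \<bullet> (P *v (A *v x + f (d, x, u) + u *\<^sub>R b)) | d x u.
                  d \<in> D \<and> x \<bullet> (P *v x) = R\<^sup>2 \<and> \<bar>u - p \<bullet> x\<bar> \<le> K * \<bar>c \<bullet> b\<bar>}"
  let ?S2 = "{\<bar>g (d, x, u) + c \<bullet> f (d, x, u)\<bar> | d x u.
                  d \<in> D \<and> x \<bullet> (P *v x) \<le> R\<^sup>2 \<and> \<bar>u - p \<bullet> x\<bar> \<le> K * \<bar>c \<bullet> b\<bar>}"
  have "?S1 \<subseteq> h1 ` ?T"
  proof
    fix y assume "y \<in> ?S1"
    then obtain d x u where "y = h1 (d, x, u)" "d \<in> D" "x \<bullet> (P *v x) = R\<^sup>2" "\<bar>u - p \<bullet> x\<bar> \<le> K * \<bar>\<beta>\<bar>"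
      by (auto simp: h1_def \<Phi> \<beta>_def)
    then show "y \<in> h1 ` ?T" by (intro image_eqI[of y h1 "(d, x, u)"]) simp_all
  qed
  then have bd1': "bdd_above ?S1" using bd1 by (rule bdd_above_mono[rotated])
  have "?S2 \<subseteq> h2 ` ?T"
  proof
    fix y assume "y \<in> ?S2"
    then obtain d x u where "y = h2 (d, x, u)" "d \<in> D" "x \<bullet> (P *v x) \<le> R\<^sup>2" "\<bar>u - p \<bullet> x\<bar> \<le> K * \<bar>\<beta>\<bar>"
      by (auto simp: h2_def \<beta>_def)
    then show "y \<in> h2 ` ?T" by (intro image_eqI[of y h2 "(d, x, u)"]) simp_all
  qed
  then have bd2': "bdd_above ?S2" using bd2 by (rule bdd_above_mono[rotated])
  \<comment> \<open>One margin for both strict inequalities.\<close>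
  define \<mu> where "\<mu> = min (- Sup ?S1) (K * \<beta>\<^sup>2 - Sup ?S2)"
  have \<mu>: "\<mu> > 0" using cond1 cond2 by (simp add: \<mu>_def \<beta>_def)

  interpret saturated_loop D \<Phi> "(*v) P" p c \<beta> M R K \<omega> \<delta> \<mu> \<rho> U L
  proof (rule saturated_loop.intro)
    show "\<Phi> (d, 0, 0) = 0" if "d \<in> D" for d
      using that f(2) g(2) by (simp add: \<Phi>_def last zero_prod_def)
    show "x \<bullet> (P *v x) > 0" if "x \<noteq> 0" for x using P(2) that by (simp add: positive_definite_def)
    show "0 < L" unfolding L_def using KA(1) L0 norm_ge_zero[of b] by linarith
    show "norm p * \<rho> + K * \<bar>\<beta>\<bar> \<le> U" by (simp add: U_def)
    fix d x u assume d: "d \<in> D"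
    show "x \<bullet> (P *v fst (\<Phi> (d, x, u))) \<le> - \<mu>" if "x \<bullet> (P *v x) = R\<^sup>2" "\<bar>u - p \<bullet> x\<bar> \<le> K * \<bar>\<beta>\<bar>"
    proof -
      have "x \<bullet> (P *v fst (\<Phi> (d, x, u))) \<in> ?S1" using d that by (auto simp: \<Phi> \<beta>_def)
      then have "x \<bullet> (P *v fst (\<Phi> (d, x, u))) \<le> Sup ?S1" using bd1' by (rule cSup_upper)
      moreover have "\<mu> \<le> - Sup ?S1" by (simp add: \<mu>_def)
      ultimately show ?thesis by linarith
    qed
    show "\<bar>snd (\<Phi> (d, x, u)) + c \<bullet> fst (\<Phi> (d, x, u)) - \<beta> * (u - p \<bullet> x)\<bar> \<le> K * \<beta>\<^sup>2 - \<mu>"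
      if "x \<bullet> (P *v x) \<le> R\<^sup>2" "\<bar>u - p \<bullet> x\<bar> \<le> K * \<bar>\<beta>\<bar>"
    proof -
      have "\<bar>g (d, x, u) + c \<bullet> f (d, x, u)\<bar> \<in> ?S2" using d that by (auto simp: \<beta>_def)
      then have "\<bar>g (d, x, u) + c \<bullet> f (d, x, u)\<bar> \<le> Sup ?S2" using bd2' by (rule cSup_upper)
      moreover have "\<mu> \<le> K * \<beta>\<^sup>2 - Sup ?S2" by (simp add: \<mu>_def)
      ultimately show ?thesis unfolding drift by linarith
    qed
    fix z assume x: "x \<bullet> (P *v x) \<le> R\<^sup>2" and z: "\<omega> * \<bar>z\<bar> \<le> 1" and u: "u = p \<bullet> x - K * \<beta> * \<omega> * z"
    have 1: "z * (M * g (d, x, u) + M * (c \<bullet> f (d, x, u)) - K * \<beta> * \<omega> * (b \<bullet> (P *v x)))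
        \<le> (M * K * \<beta>\<^sup>2 * \<omega> - \<delta>) * z\<^sup>2 - x \<bullet> (P *v ((A + outer_prod b p + mat \<delta>) *v x + f (d, x, u)))"
      using cond3[OF d x z] u by (simp add: \<beta>_def)
    have 2: "x \<bullet> (P *v ((A + outer_prod b p + mat \<delta>) *v x + f (d, x, u)))
        = x \<bullet> (P *v (A *v x)) + (p \<bullet> x) * (b \<bullet> (P *v x)) + \<delta> * (x \<bullet> (P *v x)) + x \<bullet> (P *v f (d, x, u))"
    proof -
      have "mat \<delta> *v x = \<delta> *\<^sub>R x"
        by (simp add: mat_def matrix_vector_mult_def vec_eq_iff mult_delta_left)
      then show ?thesis
        using P_sym[of x b]
        by (simp add: matrix_vector_mult_add_rdistrib matrix_vector_right_distrib outer_prod_mult_vec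
          matrix_vector_mult_scaleR inner_add_right inner_commute)
    qed
    have 3: "x \<bullet> (P *v fst (\<Phi> (d, x, u))) = x \<bullet> (P *v (A *v x)) + x \<bullet> (P *v f (d, x, u)) + u * (b \<bullet> (P *v x))"
      using P_sym[of x b]
      by (simp add: \<Phi> matrix_vector_right_distrib matrix_vector_mult_scaleR inner_add_right inner_commute)
    have 4: "snd (\<Phi> (d, x, u)) + c \<bullet> fst (\<Phi> (d, x, u)) = g (d, x, u) + c \<bullet> f (d, x, u) - K * \<beta>\<^sup>2 * \<omega> * z"
      using drift[of d x u] by (simp add: u power2_eq_square algebra_simps)
    \<comment> \<open>The left side is half the derivative of \<open>V + M z^2\<close> under the
      unsaturated feedback. The mixed term of the third condition is the z-part of
      \<open>u b'Px\<close>, and its \<open>M K \<beta>^2 \<omega> z^2\<close> is M z times the last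
      term of 4, so the condition is the goal rearranged.\<close>
    show "x \<bullet> (P *v fst (\<Phi> (d, x, u))) + M * z * (snd (\<Phi> (d, x, u)) + c \<bullet> fst (\<Phi> (d, x, u)))
        \<le> - \<delta> * (z\<^sup>2 + x \<bullet> (P *v x))"
      unfolding 3 4 using 1[unfolded 2] by (simp add: u power2_eq_square algebra_simps)
  qed (fact D P_lin P_sym pos \<mu> norm_le \<Phi>_cont \<Phi>_lip)+

  have "(\<lambda>d x x\<^sub>\<tau>. fst (\<Phi> (d, x, k x\<^sub>\<tau>))) = nominal_loop A b f k"
    by (simp add: fun_eq_iff nominal_loop_def \<Phi> Let_def)
  then have nom: "RGAS D (\<lambda>d x x\<^sub>\<tau>. fst (\<Phi> (d, x, k x\<^sub>\<tau>))) r" using nominal by simp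
  have "switched k \<xi> = switched_feedback k P p b c R K \<omega> \<xi>" for \<xi>
    unfolding switched_def feedback_def V_def Z_def
    by (simp add: switched_feedback_def \<beta>_def split_def)
  then have "(\<lambda>d \<xi> \<xi>\<^sub>\<tau>. \<Phi> (d, fst \<xi>, switched k \<xi>\<^sub>\<tau>)) = augmented_loop A b f g (switched_feedback k P p b c R K \<omega>)"
    by (simp add: fun_eq_iff augmented_loop_def \<Phi>_def Let_def)
  then show ?thesis using RGAS_of_nominal[OF r k(1) nom] by simp
qed

end
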